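(* Let $(M,g)$ be a flat Riemannian manifold, let $TM$ be its tangent bundle endowed with $G=ag^s+bg^h+cg^v$, where $a,b,c$ are real constants with $a\neq0$, $a+c\neq0$ and $\alpha:=a(a+c)-b^2\neq0$, and let $Z$ be a vector field on $TM$. Then $Z$ is a homothetic vector field on $(TM,G)$ if and only if $Z$ can be expressed as $$Z=\frac1\alpha\Big\{[a\zeta-b\xi]^h+{}^*\big[aC(\xi)-bP+\lambda ab\,I\big]+[(a+c)\xi-b\zeta]^v+\iota\big[(a+c)P-bC(\xi)+\lambda(\alpha-b^2)I\big]\Big\},$$ where $\lambda\in\mathbb{R}$ is a constant and 1. $\zeta$ is a homothetic vector field on $M$ satisfying $\mathcal{L}_\zeta g=2\lambda(a+c)g$; 2. $P$ is a $(1,1)$-tensor field on $M$ which is skew-symmetric and parallel; 3. $\xi$ is a vector field on $(M,g)$ satisfying $\nabla^2\xi(U,V)+\nabla^2\xi(V,U)=0$ for all $U,V\in\mathfrak{X}(M)$.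
   Context: A vector field $Z$ on a pseudo-Riemannian manifold $(N,h)$ is homothetic if $\mathcal{L}_Zh=2\mu h$ for some real constant $\mu$. $\nabla$ is the Levi-Civita connection of $g$. For $(x,u)\in TM$ and $X\in T_xM$, $X^h$ and $X^v$ denote the horizontal and vertical lifts of $X$ to $(x,u)$; in induced coordinates $(x^i,u^i)$: $X^h=X^i\partial_{x^i}-\Gamma^i_{jk}u^jX^k\partial_{u^i}$, $X^v=X^i\partial_{u^i}$. For a $(1,1)$-tensor field $P$ on $M$, the vector fields $\iota P$ and ${}^*P$ on $TM$ are $(\iota P)_{(x,u)}=[P(u)]^v_{(x,u)}$ and $({}^*P)_{(x,u)}=[P(u)]^h_{(x,u)}$. Classical lifts of $g$ to $TM$, for $X,Y\in T_xM$: - $g^s(X^h,Y^h)=g(X,Y)$, $g^s(X^h,Y^v)=g^s(X^v,Y^h)=0$, $g^s(X^v,Y^v)=g(X,Y)$; - $g^h(X^h,Y^h)=0$, $g^h(X^h,Y^v)=g^h(X^v,Y^h)=g(X,Y)$, $g^h(X^v,Y^v)=0$; - $g^v(X^h,Y^h)=g(X,Y)$, $g^v(X^h,Y^v)=g^v(X^v,Y^h)=0$, $g^v(X^v,Y^v)=0$. $I$ is the identity $(1,1)$-tensor field on $M$. For a vector field $\xi$ on $M$, $C(\xi)$ is the $(1,1)$-tensor field on $M$ defined by $g(C(\xi)Y,W)=-g(Y,\nabla_W\xi)$ for all vector fields $Y,W$ on $M$. $\nabla^2\xi(U,V)=\nabla_U\nabla_V\xi-\nabla_{\nabla_UV}\xi$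 is the second covariant derivative of $\xi$. Skew-symmetric means $g(PX,Y)+g(X,PY)=0$; parallel means $\nabla P=0$. *)

theory Defs
  imports "HOL-Analysis.Analysis" "HOL-Library.Function_Algebras"
begin

text \<open>
  Tangent vectors, vector fields and tensor fields are represented by functions. Together with
  the pointwise addition of Function_Algebras, the following instance lets linear combinations
  of them be written with \<open>+\<close>, \<open>-\<close> and \<open>*\<^sub>R\<close>.
\<close>

instantiation "fun" :: (type, real_vector) real_vector
begin

definition scaleR_fun :: "real \<Rightarrow> ('a \<Rightarrow> 'b) \<Rightarrow> 'a \<Rightarrow> 'b" where
  "scaleR_fun r f = (\<lambda>x. r *\<^sub>R f x)"

instance
  by standard (simp_all add: scaleR_fun_def fun_eq_iff algebra_simps)

end

lemma scaleR_fun_apply [simp]: "(r *\<^sub>R f) x = r *\<^sub>R f x"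
  by (simp add: scaleR_fun_def)


section \<open>Smooth manifolds\<close>

text \<open>Both notions are only used for open \<open>S\<close>.\<close>

primrec Ck_on :: "nat \<Rightarrow> 'e::euclidean_space set \<Rightarrow> ('e \<Rightarrow> 'f::real_normed_vector) \<Rightarrow> bool" where
  "Ck_on 0 S f \<longleftrightarrow> continuous_on S f"
| "Ck_on (Suc k) S f \<longleftrightarrow> (\<forall>x\<in>S. f differentiable (at x)) \<and>
     (\<forall>v. Ck_on k S (\<lambda>x. frechet_derivative f (at x) v))"

definition smooth_on :: "'e::euclidean_space set \<Rightarrow> ('e \<Rightarrow> 'f::real_normed_vector) \<Rightarrow> bool" where
  "smooth_on S f \<longleftrightarrow> (\<forall>k. Ck_on k S f)"

text \<open>
  An atlas is an indexed family of charts \<open>chart_map N i : chart_dom N i \<rightarrow> 'e\<close>,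
  \<open>i \<in> index N\<close>. The underlying point set and its topology are those determined by the charts.
\<close>

record ('i, 'a, 'e) atlas =
  index :: "'i set"
  chart_dom :: "'i \<Rightarrow> 'a set"
  chart_map :: "'i \<Rightarrow> 'a \<Rightarrow> 'e"

definition points :: "('i, 'a, 'e) atlas \<Rightarrow> 'a set" where
  "points N = (\<Union>i\<in>index N. chart_dom N i)"

definition charts_at :: "('i, 'a, 'e) atlas \<Rightarrow> 'a \<Rightarrow> 'i set" where
  "charts_at N p = {i \<in> index N. p \<in> chart_dom N i}"

definition chart_img :: "('i, 'a, 'e) atlas \<Rightarrow> 'i \<Rightarrow> 'e set" where
  "chart_img N i = chart_map N i ` chart_dom N i"

definition chart_inv :: "('i, 'a, 'e) atlas \<Rightarrow> 'i \<Rightarrow> 'e \<Rightarrow> 'a" where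
  "chart_inv N i = inv_into (chart_dom N i) (chart_map N i)"

definition transition :: "('i, 'a, 'e) atlas \<Rightarrow> 'i \<Rightarrow> 'i \<Rightarrow> 'e \<Rightarrow> 'e" where
  "transition N i j = chart_map N j \<circ> chart_inv N i"

definition atlas_topology :: "('i, 'a, 'e::euclidean_space) atlas \<Rightarrow> 'a topology" where
  "atlas_topology N = topology (\<lambda>W. W \<subseteq> points N \<and>
     (\<forall>i\<in>index N. open (chart_map N i ` (W \<inter> chart_dom N i))))"

definition smooth_manifold :: "('i, 'a, 'e::euclidean_space) atlas \<Rightarrow> bool" where
  "smooth_manifold N \<longleftrightarrow>
     (\<forall>i\<in>index N. inj_on (chart_map N i) (chart_dom N i)) \<and>
     (\<forall>i\<in>index N. \<forall>j\<in>index N.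
        open (chart_map N i ` (chart_dom N i \<inter> chart_dom N j)) \<and>
        smooth_on (chart_map N i ` (chart_dom N i \<inter> chart_dom N j)) (transition N i j)) \<and>
     Hausdorff_space (atlas_topology N) \<and> second_countable (atlas_topology N)"


section \<open>Tangent vectors and tensor fields\<close>

text \<open>
  A tangent vector at \<open>p\<close> is the family of its components in the charts at \<open>p\<close>, subject to the
  usual transformation law; the entries at all other indices are set to \<open>0\<close>, so that equality
  of tangent vectors is equality of functions.
\<close>

type_synonym ('i, 'e) tvec = "'i \<Rightarrow> 'e"
type_synonym ('i, 'a, 'e) vfield = "'a \<Rightarrow> ('i, 'e) tvec"
type_synonym ('i, 'a, 'e) tensor02 = "'a \<Rightarrow> ('i, 'e) tvec \<Rightarrow> ('i, 'e) tvec \<Rightarrow> real"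
type_synonym ('i, 'a, 'e) tensor11 = "'a \<Rightarrow> ('i, 'e) tvec \<Rightarrow> ('i, 'e) tvec"

definition tangent_space :: "('i, 'a, 'e::euclidean_space) atlas \<Rightarrow> 'a \<Rightarrow> ('i, 'e) tvec set" where
  "tangent_space N p = {v.
     (\<forall>i\<in>charts_at N p. \<forall>j\<in>charts_at N p.
        v j = frechet_derivative (transition N i j) (at (chart_map N i p)) (v i)) \<and>
     (\<forall>i. i \<notin> charts_at N p \<longrightarrow> v i = 0)}"

text \<open>The tangent vector at \<open>p\<close> whose component in the chart \<open>i\<close> is \<open>u\<close>.\<close>

definition tvec_of :: "('i, 'a, 'e::euclidean_space) atlas \<Rightarrow> 'i \<Rightarrow> 'a \<Rightarrow> 'e \<Rightarrow> ('i, 'e) tvec" where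
  "tvec_of N i p u = (\<lambda>j. if j \<in> charts_at N p
     then frechet_derivative (transition N i j) (at (chart_map N i p)) u else 0)"

definition vf_comp :: "('i, 'a, 'e) atlas \<Rightarrow> ('i, 'a, 'e) vfield \<Rightarrow> 'i \<Rightarrow> 'e \<Rightarrow> 'e" where
  "vf_comp N X i x = X (chart_inv N i x) i"

definition t02_comp ::
  "('i, 'a, 'e::euclidean_space) atlas \<Rightarrow> ('i, 'a, 'e) tensor02 \<Rightarrow> 'i \<Rightarrow> 'e \<Rightarrow> 'e \<Rightarrow> 'e \<Rightarrow> real" where
  "t02_comp N h i x u v =
     h (chart_inv N i x) (tvec_of N i (chart_inv N i x) u) (tvec_of N i (chart_inv N i x) v)"

definition t11_comp ::
  "('i, 'a, 'e::euclidean_space) atlas \<Rightarrow> ('i, 'a, 'e) tensor11 \<Rightarrow> 'i \<Rightarrow> 'e \<Rightarrow> 'e \<Rightarrow> 'e" where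
  "t11_comp N P i x u = P (chart_inv N i x) (tvec_of N i (chart_inv N i x) u) i"

text \<open>The values of fields at points outside \<open>points N\<close> are irrelevant throughout.\<close>

definition vector_field :: "('i, 'a, 'e::euclidean_space) atlas \<Rightarrow> ('i, 'a, 'e) vfield \<Rightarrow> bool" where
  "vector_field N X \<longleftrightarrow> (\<forall>p\<in>points N. X p \<in> tangent_space N p) \<and>
     (\<forall>i\<in>index N. smooth_on (chart_img N i) (vf_comp N X i))"

definition tensor11_field ::
  "('i, 'a, 'e::euclidean_space) atlas \<Rightarrow> ('i, 'a, 'e) tensor11 \<Rightarrow> bool" where
  "tensor11_field N P \<longleftrightarrow>
     (\<forall>p\<in>points N. \<forall>u\<in>tangent_space N p. \<forall>v\<in>tangent_space N p. \<forall>r.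
        P p u \<in> tangent_space N p \<and> P p (u + v) = P p u + P p v \<and> P p (r *\<^sub>R u) = r *\<^sub>R P p u) \<and>
     (\<forall>i\<in>index N. \<forall>u. smooth_on (chart_img N i) (\<lambda>x. t11_comp N P i x u))"

definition riemannian_metric ::
  "('i, 'a, 'e::euclidean_space) atlas \<Rightarrow> ('i, 'a, 'e) tensor02 \<Rightarrow> bool" where
  "riemannian_metric N g \<longleftrightarrow>
     (\<forall>p\<in>points N. \<forall>u\<in>tangent_space N p. \<forall>v\<in>tangent_space N p. \<forall>w\<in>tangent_space N p. \<forall>r.
        g p (u + v) w = g p u w + g p v w \<and> g p (r *\<^sub>R u) w = r * g p u w \<and>
        g p u v = g p v u \<and> (u \<noteq> 0 \<longrightarrow> g p u u > 0)) \<and>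
     (\<forall>i\<in>index N. \<forall>u v. smooth_on (chart_img N i) (\<lambda>x. t02_comp N g i x u v))"


section \<open>Lie derivative and homothetic vector fields\<close>

definition lie_bracket ::
  "('i, 'a, 'e::euclidean_space) atlas \<Rightarrow> ('i, 'a, 'e) vfield \<Rightarrow> ('i, 'a, 'e) vfield \<Rightarrow> ('i, 'a, 'e) vfield"
  where
  "lie_bracket N X Y = (\<lambda>p i. if i \<in> charts_at N p
     then frechet_derivative (vf_comp N Y i) (at (chart_map N i p)) (X p i)
        - frechet_derivative (vf_comp N X i) (at (chart_map N i p)) (Y p i)
     else 0)"

text \<open>
  The components in the chart \<open>i\<close> of the Lie derivative of a (0,2)-tensor field, in index notation
  \<open>Z\<^sup>k \<partial>\<^sub>k h\<^sub>r\<^sub>s + h\<^sub>k\<^sub>s \<partial>\<^sub>r Z\<^sup>k + h\<^sub>r\<^sub>k \<partial>\<^sub>s Z\<^sup>k\<close>.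
\<close>

definition lie_derivative ::
  "('i, 'a, 'e::euclidean_space) atlas \<Rightarrow> ('i, 'a, 'e) vfield \<Rightarrow> ('i, 'a, 'e) tensor02 \<Rightarrow>
   'i \<Rightarrow> 'e \<Rightarrow> 'e \<Rightarrow> 'e \<Rightarrow> real" where
  "lie_derivative N Z h i x u v =
     frechet_derivative (\<lambda>y. t02_comp N h i y u v) (at x) (vf_comp N Z i x)
     + t02_comp N h i x (frechet_derivative (vf_comp N Z i) (at x) u) v
     + t02_comp N h i x u (frechet_derivative (vf_comp N Z i) (at x) v)"

text \<open>The equation \<open>L\<^sub>Z h = k h\<close>.\<close>

definition lie_derivative_eq_scale ::
  "('i, 'a, 'e::euclidean_space) atlas \<Rightarrow> ('i, 'a, 'e) vfield \<Rightarrow> ('i, 'a, 'e) tensor02 \<Rightarrow> real \<Rightarrow> bool"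
  where
  "lie_derivative_eq_scale N Z h k \<longleftrightarrow> (\<forall>i\<in>index N. \<forall>x\<in>chart_img N i. \<forall>u v.
     lie_derivative N Z h i x u v = k * t02_comp N h i x u v)"

definition homothetic ::
  "('i, 'a, 'e::euclidean_space) atlas \<Rightarrow> ('i, 'a, 'e) tensor02 \<Rightarrow> ('i, 'a, 'e) vfield \<Rightarrow> bool" where
  "homothetic N h Z \<longleftrightarrow> vector_field N Z \<and> (\<exists>\<mu>. lie_derivative_eq_scale N Z h (2 * \<mu>))"


section \<open>Levi-Civita connection\<close>

text \<open>
  \<open>christoffel M g i x u v\<close> is the vector \<open>w\<^sup>r = \<Gamma>\<^sup>r\<^sub>s\<^sub>t(x) u\<^sup>s v\<^sup>t\<close> in the chart \<open>i\<close>; to avoid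
  inverting the matrix of \<open>g\<close>, the formula
  \<open>2 \<Gamma>\<^sup>r\<^sub>s\<^sub>t = g\<^sup>r\<^sup>k (\<partial>\<^sub>s g\<^sub>t\<^sub>k + \<partial>\<^sub>t g\<^sub>s\<^sub>k - \<partial>\<^sub>k g\<^sub>s\<^sub>t)\<close> is stated after pairing with a vector \<open>z\<close>.
\<close>

definition christoffel ::
  "('i, 'a, 'e::euclidean_space) atlas \<Rightarrow> ('i, 'a, 'e) tensor02 \<Rightarrow> 'i \<Rightarrow> 'e \<Rightarrow> 'e \<Rightarrow> 'e \<Rightarrow> 'e" where
  "christoffel M g i x u v = (THE w. \<forall>z. 2 * t02_comp M g i x w z =
     frechet_derivative (\<lambda>y. t02_comp M g i y v z) (at x) u
     + frechet_derivative (\<lambda>y. t02_comp M g i y u z) (at x) v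
     - frechet_derivative (\<lambda>y. t02_comp M g i y u v) (at x) z)"

text \<open>\<open>nabla M g Y p v\<close> is \<open>\<nabla>\<^sub>v Y\<close> for a tangent vector \<open>v\<close> at \<open>p\<close>.\<close>

definition nabla ::
  "('i, 'a, 'e::euclidean_space) atlas \<Rightarrow> ('i, 'a, 'e) tensor02 \<Rightarrow> ('i, 'a, 'e) vfield \<Rightarrow> ('i, 'a, 'e) tensor11"
  where
  "nabla M g Y = (\<lambda>p v i. if i \<in> charts_at M p
     then frechet_derivative (vf_comp M Y i) (at (chart_map M i p)) (v i)
        + christoffel M g i (chart_map M i p) (v i) (Y p i)
     else 0)"

definition cov_deriv ::
  "('i, 'a, 'e::euclidean_space) atlas \<Rightarrow> ('i, 'a, 'e) tensor02 \<Rightarrow>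
   ('i, 'a, 'e) vfield \<Rightarrow> ('i, 'a, 'e) vfield \<Rightarrow> ('i, 'a, 'e) vfield" where
  "cov_deriv M g X Y = (\<lambda>p. nabla M g Y p (X p))"

definition curvature ::
  "('i, 'a, 'e::euclidean_space) atlas \<Rightarrow> ('i, 'a, 'e) tensor02 \<Rightarrow>
   ('i, 'a, 'e) vfield \<Rightarrow> ('i, 'a, 'e) vfield \<Rightarrow> ('i, 'a, 'e) vfield \<Rightarrow> ('i, 'a, 'e) vfield" where
  "curvature M g X Y W = cov_deriv M g X (cov_deriv M g Y W) - cov_deriv M g Y (cov_deriv M g X W)
     - cov_deriv M g (lie_bracket M X Y) W"

definition flat ::
  "('i, 'a, 'e::euclidean_space) atlas \<Rightarrow> ('i, 'a, 'e) tensor02 \<Rightarrow> bool" where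
  "flat M g \<longleftrightarrow> (\<forall>X Y W. vector_field M X \<longrightarrow> vector_field M Y \<longrightarrow> vector_field M W \<longrightarrow>
     (\<forall>p\<in>points M. curvature M g X Y W p = 0))"

definition second_cov_deriv ::
  "('i, 'a, 'e::euclidean_space) atlas \<Rightarrow> ('i, 'a, 'e) tensor02 \<Rightarrow>
   ('i, 'a, 'e) vfield \<Rightarrow> ('i, 'a, 'e) vfield \<Rightarrow> ('i, 'a, 'e) vfield \<Rightarrow> ('i, 'a, 'e) vfield" where
  "second_cov_deriv M g \<xi> U V =
     cov_deriv M g U (cov_deriv M g V \<xi>) - cov_deriv M g (cov_deriv M g U V) \<xi>"

definition skew_symmetric ::
  "('i, 'a, 'e::euclidean_space) atlas \<Rightarrow> ('i, 'a, 'e) tensor02 \<Rightarrow> ('i, 'a, 'e) tensor11 \<Rightarrow> bool" where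
  "skew_symmetric M g P \<longleftrightarrow> (\<forall>p\<in>points M. \<forall>u\<in>tangent_space M p. \<forall>v\<in>tangent_space M p.
     g p (P p u) v + g p u (P p v) = 0)"

text \<open>The equation \<open>\<nabla>P = 0\<close>, where \<open>(\<nabla>\<^sub>X P) Y = \<nabla>\<^sub>X (P Y) - P (\<nabla>\<^sub>X Y)\<close>.\<close>

definition parallel ::
  "('i, 'a, 'e::euclidean_space) atlas \<Rightarrow> ('i, 'a, 'e) tensor02 \<Rightarrow> ('i, 'a, 'e) tensor11 \<Rightarrow> bool" where
  "parallel M g P \<longleftrightarrow> (\<forall>X Y. vector_field M X \<longrightarrow> vector_field M Y \<longrightarrow>
     (\<forall>p\<in>points M. cov_deriv M g X (\<lambda>q. P q (Y q)) p - P p (cov_deriv M g X Y p) = 0))"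

definition C_tensor ::
  "('i, 'a, 'e::euclidean_space) atlas \<Rightarrow> ('i, 'a, 'e) tensor02 \<Rightarrow> ('i, 'a, 'e) vfield \<Rightarrow> ('i, 'a, 'e) tensor11"
  where
  "C_tensor M g \<xi> = (\<lambda>p y. THE z. z \<in> tangent_space M p \<and>
     (\<forall>w\<in>tangent_space M p. g p z w = - g p y (nabla M g \<xi> p w)))"

definition id_tensor :: "('i, 'a, 'e) tensor11" where
  "id_tensor = (\<lambda>p v. v)"


section \<open>The tangent bundle\<close>

text \<open>
  Every chart of \<open>M\<close> induces a chart of the tangent bundle, so both atlases have the same index
  set. A tangent vector of the tangent bundle has components \<open>(X, Y)\<close> with respect to
  \<open>\<partial>/\<partial>x\<close>, \<open>\<partial>/\<partial>u\<close>.
\<close>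

type_synonym ('i, 'a, 'e) tpoint = "'a \<times> ('i, 'e) tvec"

definition tangent_bundle ::
  "('i, 'a, 'e::euclidean_space) atlas \<Rightarrow> ('i, ('i, 'a, 'e) tpoint, 'e \<times> 'e) atlas" where
  "tangent_bundle M =
     \<lparr>index = index M,
      chart_dom = (\<lambda>i. {(p, u). p \<in> chart_dom M i \<and> u \<in> tangent_space M p}),
      chart_map = (\<lambda>i (p, u). (chart_map M i p, u i))\<rparr>"

definition h_lift_vec ::
  "('i, 'a, 'e::euclidean_space) atlas \<Rightarrow> ('i, 'a, 'e) tensor02 \<Rightarrow>
   ('i, 'a, 'e) tpoint \<Rightarrow> ('i, 'e) tvec \<Rightarrow> ('i, 'e \<times> 'e) tvec" where
  "h_lift_vec M g = (\<lambda>(p, u) X i. if i \<in> charts_at M p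
     then (X i, - christoffel M g i (chart_map M i p) (u i) (X i)) else 0)"

definition v_lift_vec ::
  "('i, 'a, 'e::euclidean_space) atlas \<Rightarrow> ('i, 'a, 'e) tpoint \<Rightarrow> ('i, 'e) tvec \<Rightarrow> ('i, 'e \<times> 'e) tvec" where
  "v_lift_vec M = (\<lambda>(p, u) X i. if i \<in> charts_at M p then (0, X i) else 0)"

definition h_lift ::
  "('i, 'a, 'e::euclidean_space) atlas \<Rightarrow> ('i, 'a, 'e) tensor02 \<Rightarrow>
   ('i, 'a, 'e) vfield \<Rightarrow> ('i, ('i, 'a, 'e) tpoint, 'e \<times> 'e) vfield" where
  "h_lift M g X = (\<lambda>(p, u). h_lift_vec M g (p, u) (X p))"

definition v_lift ::
  "('i, 'a, 'e::euclidean_space) atlas \<Rightarrow> ('i, 'a, 'e) vfield \<Rightarrow> ('i, ('i, 'a, 'e) tpoint, 'e \<times> 'e) vfield"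
  where
  "v_lift M X = (\<lambda>(p, u). v_lift_vec M (p, u) (X p))"

definition star_lift ::
  "('i, 'a, 'e::euclidean_space) atlas \<Rightarrow> ('i, 'a, 'e) tensor02 \<Rightarrow>
   ('i, 'a, 'e) tensor11 \<Rightarrow> ('i, ('i, 'a, 'e) tpoint, 'e \<times> 'e) vfield" where
  "star_lift M g P = (\<lambda>(p, u). h_lift_vec M g (p, u) (P p u))"

definition iota_lift ::
  "('i, 'a, 'e::euclidean_space) atlas \<Rightarrow> ('i, 'a, 'e) tensor11 \<Rightarrow> ('i, ('i, 'a, 'e) tpoint, 'e \<times> 'e) vfield"
  where
  "iota_lift M P = (\<lambda>(p, u). v_lift_vec M (p, u) (P p u))"

text \<open>The parts \<open>X\<close> and \<open>Y\<close> of a tangent vector \<open>X\<^sup>h + Y\<^sup>v\<close> of the tangent bundle.\<close>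

definition h_part ::
  "('i, 'a, 'e::euclidean_space) atlas \<Rightarrow> ('i, 'a, 'e) tpoint \<Rightarrow> ('i, 'e \<times> 'e) tvec \<Rightarrow> ('i, 'e) tvec" where
  "h_part M = (\<lambda>(p, u) A i. if i \<in> charts_at M p then fst (A i) else 0)"

definition v_part ::
  "('i, 'a, 'e::euclidean_space) atlas \<Rightarrow> ('i, 'a, 'e) tensor02 \<Rightarrow>
   ('i, 'a, 'e) tpoint \<Rightarrow> ('i, 'e \<times> 'e) tvec \<Rightarrow> ('i, 'e) tvec" where
  "v_part M g = (\<lambda>(p, u) A i. if i \<in> charts_at M p
     then snd (A i) + christoffel M g i (chart_map M i p) (u i) (fst (A i)) else 0)"

lemma tangent_space_outside: "v \<in> tangent_space N p \<Longrightarrow> i \<notin> charts_at N p \<Longrightarrow> v i = 0"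
  by (simp add: tangent_space_def)

lemma lift_decomposition:
  assumes "X \<in> tangent_space M p" "Y \<in> tangent_space M p"
  shows "h_part M (p, u) (h_lift_vec M g (p, u) X + v_lift_vec M (p, u) Y) = X"
    and "v_part M g (p, u) (h_lift_vec M g (p, u) X + v_lift_vec M (p, u) Y) = Y"
  using assms[THEN tangent_space_outside]
  by (simp_all add: h_part_def v_part_def h_lift_vec_def v_lift_vec_def fun_eq_iff)

lemma decomposition_lift:
  assumes "A \<in> tangent_space (tangent_bundle M) (p, u)" "u \<in> tangent_space M p"
  shows "h_lift_vec M g (p, u) (h_part M (p, u) A) + v_lift_vec M (p, u) (v_part M g (p, u) A) = A"
proof
  fix i
  have "A i = 0" if "i \<notin> charts_at M p"
    using tangent_space_outside[OF assms(1), of i] that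
    by (auto simp: charts_at_def tangent_bundle_def)
  then show "(h_lift_vec M g (p, u) (h_part M (p, u) A)
      + v_lift_vec M (p, u) (v_part M g (p, u) A)) i = A i"
    by (auto simp: h_part_def v_part_def h_lift_vec_def v_lift_vec_def prod_eq_iff)
qed

text \<open>
  The lifts of the metric, extended bilinearly from horizontal and vertical lifts; their values on
  those are verified in \<open>metric_lift_values\<close> below.
\<close>

definition metric_s ::
  "('i, 'a, 'e::euclidean_space) atlas \<Rightarrow> ('i, 'a, 'e) tensor02 \<Rightarrow> ('i, ('i, 'a, 'e) tpoint, 'e \<times> 'e) tensor02"
  where
  "metric_s M g = (\<lambda>q A B. g (fst q) (h_part M q A) (h_part M q B)
     + g (fst q) (v_part M g q A) (v_part M g q B))"

definition metric_h ::
  "('i, 'a, 'e::euclidean_space) atlas \<Rightarrow> ('i, 'a, 'e) tensor02 \<Rightarrow> ('i, ('i, 'a, 'e) tpoint, 'e \<times> 'e) tensor02"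
  where
  "metric_h M g = (\<lambda>q A B. g (fst q) (h_part M q A) (v_part M g q B)
     + g (fst q) (v_part M g q A) (h_part M q B))"

definition metric_v ::
  "('i, 'a, 'e::euclidean_space) atlas \<Rightarrow> ('i, 'a, 'e) tensor02 \<Rightarrow> ('i, ('i, 'a, 'e) tpoint, 'e \<times> 'e) tensor02"
  where
  "metric_v M g = (\<lambda>q A B. g (fst q) (h_part M q A) (h_part M q B))"

lemma smooth_on_imp_differentiable:
  "smooth_on S f \<Longrightarrow> x \<in> S \<Longrightarrow> f differentiable (at x)"
  by (metis Ck_on.simps(2) smooth_on_def)

lemma open_chart_img:
  "smooth_manifold N \<Longrightarrow> i \<in> index N \<Longrightarrow> open (chart_img N i)"
  unfolding smooth_manifold_def chart_img_def by (metis Int_absorb)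

lemma transition_chart_map:
  assumes "smooth_manifold N" "i \<in> charts_at N p"
  shows "transition N i j (chart_map N i p) = chart_map N j p"
  using assms by (simp add: smooth_manifold_def charts_at_def transition_def chart_inv_def)

lemma transition_differentiable:
  assumes "smooth_manifold N" "i \<in> charts_at N p" "j \<in> charts_at N p"
  shows "transition N i j differentiable (at (chart_map N i p))"
  using assms by (auto simp: smooth_manifold_def charts_at_def intro!: smooth_on_imp_differentiable)

lemma transition_linear:
  assumes "smooth_manifold N" "i \<in> charts_at N p" "j \<in> charts_at N p"
  shows "linear (frechet_derivative (transition N i j) (at (chart_map N i p)))"
  by (intro linear_frechet_derivative transition_differentiable assms)

lemma transition_cocycle:
  assumes N: "smooth_manifold N"
    and i: "i \<in> charts_at N p" and j: "j \<in> charts_at N p" and k: "k \<in> charts_at N p"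
  shows "frechet_derivative (transition N i k) (at (chart_map N i p)) u =
    frechet_derivative (transition N j k) (at (chart_map N j p))
      (frechet_derivative (transition N i j) (at (chart_map N i p)) u)"
proof -
  let ?S = "chart_map N i ` (chart_dom N i \<inter> chart_dom N j)"
  have S: "open ?S" "chart_map N i p \<in> ?S"
    using N i j by (auto simp: smooth_manifold_def charts_at_def)
  have "(transition N j k \<circ> transition N i j has_derivative
      frechet_derivative (transition N j k) (at (chart_map N j p)) \<circ>
      frechet_derivative (transition N i j) (at (chart_map N i p))) (at (chart_map N i p))"
    using transition_differentiable[OF N i j] transition_differentiable[OF N j k]
      transition_chart_map[OF N i, of j]
    by (intro diff_chain_at) (simp_all add: frechet_derivative_works)
  then have "(transition N i k has_derivative
      frechet_derivative (transition N j k) (at (chart_map N j p)) \<circ>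
      frechet_derivative (transition N i j) (at (chart_map N i p))) (at (chart_map N i p))"
  proof (rule has_derivative_transform_within_open[OF _ S])
    fix x assume "x \<in> ?S"
    then show "(transition N j k \<circ> transition N i j) x = transition N i k x"
      using N i j by (auto simp: smooth_manifold_def charts_at_def transition_def chart_inv_def)
  qed
  then show ?thesis
    by (metis comp_apply frechet_derivative_at)
qed

lemma transition_id:
  assumes N: "smooth_manifold N" and i: "i \<in> charts_at N p"
  shows "frechet_derivative (transition N i i) (at (chart_map N i p)) u = u"
proof -
  have S: "open (chart_img N i)" "chart_map N i p \<in> chart_img N i"
    using open_chart_img[OF N, of i] i by (auto simp: charts_at_def chart_img_def)
  have "(transition N i i has_derivative (\<lambda>x. x)) (at (chart_map N i p))"
    by (rule has_derivative_transform_within_open[OF has_derivative_ident S])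
      (simp add: transition_def chart_inv_def chart_img_def f_inv_into_f)
  then show ?thesis
    by (metis frechet_derivative_at)
qed

lemma subspace_tangent_space:
  assumes N: "smooth_manifold N"
  shows "subspace (tangent_space N p)"
proof -
  let ?D = "\<lambda>i j. frechet_derivative (transition N i j) (at (chart_map N i p))"
  have iff: "v \<in> tangent_space N p \<longleftrightarrow>
      (\<forall>i j. i \<in> charts_at N p \<longrightarrow> j \<in> charts_at N p \<longrightarrow> ?D i j (v i) = v j) \<and>
      (\<forall>i. i \<notin> charts_at N p \<longrightarrow> v i = 0)" for v
    unfolding tangent_space_def mem_Collect_eq Ball_def by (intro iffI conjI) (blast intro: sym)+
  have lin: "?D i j 0 = 0" "?D i j (u + v) = ?D i j u + ?D i j v" "?D i j (c *\<^sub>R u) = c *\<^sub>R ?D i j u"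
    if "i \<in> charts_at N p" "j \<in> charts_at N p" for i j u v c
    using transition_linear[OF N that] by (rule linear_0 linear_add linear_scale)+
  show ?thesis
    by (intro subspaceI) (simp_all add: iff lin)
qed

lemma tvec_of_tangent_space:
  assumes N: "smooth_manifold N" and i: "i \<in> charts_at N p"
  shows "tvec_of N i p u \<in> tangent_space N p" and "tvec_of N i p u i = u"
proof -
  show "tvec_of N i p u \<in> tangent_space N p"
    unfolding tangent_space_def tvec_of_def
    by (simp, intro ballI, rule transition_cocycle[OF N i])
  show "tvec_of N i p u i = u"
    using transition_id[OF N i] i by (simp add: tvec_of_def)
qed

lemma chart_inv_charts_at:
  assumes "i \<in> index N" "x \<in> chart_img N i"
  shows "i \<in> charts_at N (chart_inv N i x)" "chart_map N i (chart_inv N i x) = x"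
  using assms by (auto simp: charts_at_def chart_img_def chart_inv_def inv_into_into f_inv_into_f)

lemma tvec_of_eq:
  assumes "u \<in> tangent_space N p" "i \<in> charts_at N p"
  shows "tvec_of N i p (u i) = u"
proof
  fix j
  show "tvec_of N i p (u i) j = u j"
  proof (cases "j \<in> charts_at N p")
    case True
    then have "u j = frechet_derivative (transition N i j) (at (chart_map N i p)) (u i)"
      using assms unfolding tangent_space_def by blast
    with True show ?thesis
      by (simp add: tvec_of_def)
  qed (use tangent_space_outside[OF assms(1)] in \<open>simp add: tvec_of_def\<close>)
qed

lemma christoffel_zero:
  assumes M: "smooth_manifold M" and g: "riemannian_metric M g"
    and i: "i \<in> index M" and x: "x \<in> chart_img M i"
  shows "christoffel M g i x u 0 = 0"
proof -
  note S = open_chart_img[OF M i]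
  have tv: "tvec_of M i (chart_inv M i y) w \<in> tangent_space M (chart_inv M i y)"
    and tv0: "tvec_of M i (chart_inv M i y) 0 = 0"
    and pt: "chart_inv M i y \<in> points M" if y: "y \<in> chart_img M i" for y w
  proof -
    note c = chart_inv_charts_at[OF i y]
    show "tvec_of M i (chart_inv M i y) w \<in> tangent_space M (chart_inv M i y)"
      by (rule tvec_of_tangent_space[OF M c(1)])
    show "tvec_of M i (chart_inv M i y) 0 = 0"
      using transition_linear[OF M c(1)] by (simp add: tvec_of_def fun_eq_iff linear_0)
    show "chart_inv M i y \<in> points M"
      using c i by (auto simp: points_def charts_at_def)
  qed
  have zero: "t02_comp M g i y 0 w = 0" "t02_comp M g i y w 0 = 0" if y: "y \<in> chart_img M i" for y w
  proof -
    let ?p = "chart_inv M i y" and ?w = "tvec_of M i (chart_inv M i y) w"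
    have "g ?p (0 *\<^sub>R ?w) ?w = 0 * g ?p ?w ?w" "g ?p ?w 0 = g ?p 0 ?w"
      using g pt[OF y] tv[OF y, of w] tv[OF y, of 0] tv0[OF y]
      unfolding riemannian_metric_def by metis+
    then show "t02_comp M g i y 0 w = 0" "t02_comp M g i y w 0 = 0"
      using tv0[OF y] by (simp_all add: t02_comp_def)
  qed
  have der: "frechet_derivative f (at x) = (\<lambda>_. 0)"
    if "\<And>y. y \<in> chart_img M i \<Longrightarrow> f y = 0" for f :: "_ \<Rightarrow> real"
  proof -
    have "(f has_derivative (\<lambda>_. 0)) (at x)"
      by (rule has_derivative_transform_within_open[OF has_derivative_const[of 0] S x])
        (simp add: that)
    then show ?thesis
      by (metis frechet_derivative_at)
  qed
  have lin: "frechet_derivative (\<lambda>y. t02_comp M g i y u z) (at x) 0 = 0" for z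
  proof -
    have "smooth_on (chart_img M i) (\<lambda>y. t02_comp M g i y u z)"
      using g i by (simp add: riemannian_metric_def)
    then show ?thesis
      by (intro linear_0 linear_frechet_derivative smooth_on_imp_differentiable[OF _ x])
  qed
  have "w = 0" if w: "\<forall>z. 2 * t02_comp M g i x w z = 0" for w
  proof (rule ccontr)
    let ?w = "tvec_of M i (chart_inv M i x) w"
    assume "w \<noteq> 0"
    then have "?w \<noteq> 0"
      using tvec_of_tangent_space(2)[OF M chart_inv_charts_at(1)[OF i x], of w] by auto
    then have "g (chart_inv M i x) ?w ?w > 0"
      using g pt[OF x] tv[OF x, of w] unfolding riemannian_metric_def by blast
    then show False
      using w by (simp add: t02_comp_def)
  qed
  then show ?thesis
    unfolding christoffel_def by (intro the_equality) (simp_all add: zero x der lin)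
qed

lemma metric_lift_values:
  fixes M :: "('i, 'a, 'e::euclidean_space) atlas"
    and u :: "('i, 'e) tvec"
  assumes M: "smooth_manifold M" and g: "riemannian_metric M g" and p: "p \<in> points M"
    and X: "X \<in> tangent_space M p" and Y: "Y \<in> tangent_space M p"
  defines "q \<equiv> (p, u)"
  defines "Xh \<equiv> h_lift_vec M g q X" and "Xv \<equiv> v_lift_vec M q X"
    and "Yh \<equiv> h_lift_vec M g q Y" and "Yv \<equiv> v_lift_vec M q Y"
  shows "metric_s M g q Xh Yh = g p X Y" "metric_s M g q Xh Yv = 0"
    "metric_s M g q Xv Yh = 0" "metric_s M g q Xv Yv = g p X Y"
    "metric_h M g q Xh Yh = 0" "metric_h M g q Xh Yv = g p X Y"
    "metric_h M g q Xv Yh = g p X Y" "metric_h M g q Xv Yv = 0"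
    "metric_v M g q Xh Yh = g p X Y" "metric_v M g q Xh Yv = 0"
    "metric_v M g q Xv Yh = 0" "metric_v M g q Xv Yv = 0"
proof -
  have zero: "0 \<in> tangent_space M p"
    using subspace_tangent_space[OF M] by (rule subspace_0)
  have g0: "g p 0 W = 0" "g p W 0 = 0" if W: "W \<in> tangent_space M p" for W
  proof -
    have "g p (0 *\<^sub>R W) W = 0 * g p W W" and "g p W 0 = g p 0 W"
      using g p W zero unfolding riemannian_metric_def by blast+
    then show "g p 0 W = 0" "g p W 0 = 0" by simp_all
  qed
  have "h_part M q (h_lift_vec M g q W) = W" "v_part M g q (h_lift_vec M g q W) = 0"
    "h_part M q (v_lift_vec M q W) = 0" "v_part M g q (h_lift_vec M g q 0 + v_lift_vec M q W) = W"
    if W: "W \<in> tangent_space M p" for W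
    using tangent_space_outside[OF W] lift_decomposition[OF zero W]
    by (simp_all add: q_def h_part_def v_part_def h_lift_vec_def v_lift_vec_def fun_eq_iff)
  moreover have "v_part M g q (v_lift_vec M q W) = W" if W: "W \<in> tangent_space M p" for W
  proof
    fix i
    show "v_part M g q (v_lift_vec M q W) i = W i"
      using tangent_space_outside[OF W, of i] christoffel_zero[OF M g, of i "chart_map M i p" "u i"]
      by (auto simp: q_def v_part_def v_lift_vec_def charts_at_def chart_img_def)
  qed
  ultimately show "metric_s M g q Xh Yh = g p X Y" "metric_s M g q Xh Yv = 0"
    "metric_s M g q Xv Yh = 0" "metric_s M g q Xv Yv = g p X Y"
    "metric_h M g q Xh Yh = 0" "metric_h M g q Xh Yv = g p X Y"
    "metric_h M g q Xv Yh = g p X Y" "metric_h M g q Xv Yv = 0"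
    "metric_v M g q Xh Yh = g p X Y" "metric_v M g q Xh Yv = 0"
    "metric_v M g q Xv Yh = 0" "metric_v M g q Xv Yv = 0"
    using X Y zero g0
    by (simp_all add: Xh_def Xv_def Yh_def Yv_def metric_s_def metric_h_def metric_v_def q_def)
qed

end

theory Submission
  imports Defs
begin

text \<open>
  Write \<open>Z = H\<^sup>h + V\<^sup>v\<close>, where the horizontal and vertical parts \<open>H\<close> and \<open>V\<close> are vectors of the base that
  depend on the point \<open>(x, u)\<close> of the tangent bundle, and put \<open>Q = (a + c) H + b V\<close> and \<open>N = b H + a V\<close>.
  These are the components of the one-form \<open>G(Z, \<cdot>)\<close>, and as \<open>\<alpha> \<noteq> 0\<close> they determine \<open>Z\<close>. In the absence of
  curvature the Lie derivative of \<open>G\<close> becomes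
  \<open>(L\<^sub>Z G)(W, W') = g(\<nabla>\<^sub>W Q, X') + g(\<nabla>\<^sub>W N, K') + g(X, \<nabla>\<^bsub>W'\<^esub> Q) + g(K, \<nabla>\<^bsub>W'\<^esub> N)\<close>
  for \<open>W = X\<^sup>h + K\<^sup>v\<close> and \<open>W' = X'\<^sup>h + K'\<^sup>v\<close> (\<open>lie_derivative_bundle_metric\<close>). The
  computation takes place in an arbitrary chart, with Christoffel symbols in place of flat coordinates.

  The equation \<open>L\<^sub>Z G = 2 \<lambda> G\<close> is now solved by type. On two vertical vectors it says that \<open>N\<close> is an infinitesimal
  similarity of each fibre, so that it is affine: \<open>N = \<xi> + P u + \<lambda> a u\<close> with \<open>P\<close> skew-symmetric
  (\<open>similarity_field_affine\<close>). On a horizontal and a vertical vector it expresses the fibre derivative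
  of \<open>Q\<close> by \<open>\<nabla>\<xi>\<close> and \<open>(\<nabla>P) u\<close>. The latter term is skew-symmetric, so it does not contribute to the integral
  along rays in the fibre; therefore \<open>Q = \<zeta> + C(\<xi>) u + 2 \<lambda> b u\<close>, and comparison with the fibre derivative
  gives \<open>\<nabla>P = 0\<close> (\<open>T_solution\<close>). On two horizontal vectors the equation is affine in \<open>u\<close>. Its constant part is
  \<open>L\<^sub>\<zeta> g = 2 \<lambda> (a + c) g\<close>, and its linear part is the vanishing of the symmetrised \<open>\<nabla>\<^sup>2\<xi>\<close>, because \<open>\<nabla>C(\<xi>)\<close> is the
  negative adjoint of \<open>\<nabla>\<^sup>2\<xi>\<close> (\<open>nab_end_adjoint\<close>). All these steps are reversible
  (\<open>homothety_system_converse\<close>), and solving for \<open>H\<close> and \<open>V\<close> gives the formula for \<open>Z\<close>.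

  To transfer this to the manifold, the parts \<open>H\<close> and \<open>V\<close> must be independent of the chart, which is the
  transformation law of the Christoffel symbols (\<open>christoffel_transform\<close>), and the Christoffel symbols must
  be smooth, which follows from the smoothness of a dual frame (\<open>smooth_dual_frame\<close>). Flatness and
  the conditions on \<open>P\<close> and \<open>\<xi>\<close> quantify over global vector fields; their pointwise meaning is extracted by
  extending tangent vectors with bump functions (\<open>vector_field_extension\<close>).
\<close>

section \<open>Calculus of smooth maps\<close>

abbreviation fd :: "('x::real_normed_vector \<Rightarrow> 'y::real_normed_vector) \<Rightarrow> 'x \<Rightarrow> 'x \<Rightarrow> 'y" where
  "fd f x \<equiv> frechet_derivative f (at x)"

lemma fd_eq: "(f has_derivative f') (at x) \<Longrightarrow> fd f x = f'"
  by (rule frechet_derivative_at[symmetric])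

lemma has_derivative_fd: "f differentiable (at x) \<Longrightarrow> (f has_derivative fd f x) (at x)"
  by (simp add: frechet_derivative_works)

lemma has_derivative_cong_open:
  assumes "open S" "x \<in> S" "\<And>y. y \<in> S \<Longrightarrow> f y = g y"
  shows "(f has_derivative f') (at x) \<longleftrightarrow> (g has_derivative f') (at x)"
  using assms by (auto elim!: has_derivative_transform_within_open)

lemma fd_cong:
  assumes "open S" "x \<in> S" "\<And>y. y \<in> S \<Longrightarrow> f y = g y"
  shows "fd f x = fd g x"
  using has_derivative_cong_open[OF assms] by (simp add: frechet_derivative_def)

lemma differentiable_cong:
  assumes "open S" "x \<in> S" "f differentiable (at x)" "\<And>y. y \<in> S \<Longrightarrow> f y = g y"
  shows "g differentiable (at x)"
  using assms(3) has_derivative_cong_open[OF assms(1,2,4)] unfolding differentiable_def by simp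

lemma linear_expand:
  fixes h :: "'v::euclidean_space \<Rightarrow> 'w::real_normed_vector"
  assumes "linear h"
  shows "h v = (\<Sum>b\<in>Basis. (v \<bullet> b) *\<^sub>R h b)"
proof -
  have "h v = h (\<Sum>b\<in>Basis. (v \<bullet> b) *\<^sub>R b)"
    by (simp only: euclidean_representation)
  also have "\<dots> = (\<Sum>b\<in>Basis. (v \<bullet> b) *\<^sub>R h b)"
    by (simp add: linear_sum[OF assms] linear_scale[OF assms])
  finally show ?thesis .
qed

lemma Ck_on_cong:
  assumes "open S" "Ck_on k S f" "\<And>x. x \<in> S \<Longrightarrow> f x = g x"
  shows "Ck_on k S g"
  using assms(2,3)
proof (induction k arbitrary: f g)
  case 0
  then show ?case
    by (metis Ck_on.simps(1) continuous_on_cong)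
next
  case (Suc k)
  have eq: "g differentiable (at x)" "fd f x = fd g x" if x: "x \<in> S" for x
  proof -
    have d: "f differentiable (at x)"
      using Suc.prems(1) x by simp
    show "g differentiable (at x)"
      by (rule differentiable_cong[OF assms(1) x d Suc.prems(2)])
    show "fd f x = fd g x"
      by (rule fd_cong[OF assms(1) x Suc.prems(2)])
  qed
  have "Ck_on k S (\<lambda>x. fd f x v)" for v
    using Suc.prems(1) by simp
  then have "Ck_on k S (\<lambda>x. fd g x v)" for v
    by (rule Suc.IH) (simp add: eq)
  with eq show ?case
    by simp
qed

lemma Ck_on_SucI:
  assumes S: "open S" and der: "\<And>x. x \<in> S \<Longrightarrow> (f has_derivative f' x) (at x)"
    and "\<And>v. Ck_on k S (\<lambda>x. f' x v)"
  shows "Ck_on (Suc k) S f"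
  unfolding Ck_on.simps
proof (intro conjI ballI allI)
  show "f differentiable (at x)" if "x \<in> S" for x
    using der[OF that] by (rule differentiableI)
  show "Ck_on k S (\<lambda>x. fd f x v)" for v
    using assms(3)[of v] by (rule Ck_on_cong[OF S]) (simp add: fd_eq[OF der])
qed

lemma Ck_on_subset: "Ck_on k S f \<Longrightarrow> T \<subseteq> S \<Longrightarrow> Ck_on k T f"
proof (induction k arbitrary: f)
  case (Suc k)
  then show ?case
    by auto
qed (use continuous_on_subset in auto)

lemma Ck_on_Suc_imp: "Ck_on (Suc k) S f \<Longrightarrow> Ck_on k S f"
proof (induction k arbitrary: f)
  case 0
  then show ?case
    by (simp add: continuous_at_imp_continuous_on differentiable_imp_continuous_within)
qed (use Ck_on.simps(2) in blast)

lemma Ck_on_local: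
  assumes "\<And>x. x \<in> S \<Longrightarrow> \<exists>T. open T \<and> x \<in> T \<and> Ck_on k T f"
  shows "Ck_on k S f"
  using assms
proof (induction k arbitrary: f)
  case 0
  then have "isCont f x" if "x \<in> S" for x
    using that continuous_on_eq_continuous_at by fastforce
  then show ?case
    by (simp add: continuous_at_imp_continuous_on)
next
  case (Suc k)
  show ?case
    unfolding Ck_on.simps
  proof (intro conjI ballI allI)
    show "f differentiable (at x)" if "x \<in> S" for x
      using Suc.prems[OF that] by auto
    show "Ck_on k S (\<lambda>x. fd f x v)" for v
    proof (rule Suc.IH)
      fix x
      assume "x \<in> S"
      then obtain T where "open T" "x \<in> T" "Ck_on (Suc k) T f"
        using Suc.prems by blast
      then show "\<exists>T. open T \<and> x \<in> T \<and> Ck_on k T (\<lambda>x. fd f x v)"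
        by auto
    qed
  qed
qed

lemma Ck_on_const: "Ck_on k S (\<lambda>x. c)"
  by (induction k arbitrary: c) simp_all

lemma Ck_on_linear: "bounded_linear h \<Longrightarrow> Ck_on k S h"
proof (cases k)
  case (Suc l)
  assume h: "bounded_linear h"
  then have "fd h x = h" for x
    by (intro fd_eq bounded_linear_imp_has_derivative)
  then show ?thesis
    using h Suc by (simp add: bounded_linear_imp_differentiable Ck_on_const)
qed (simp add: linear_continuous_on)

lemma Ck_on_add:
  assumes S: "open S" and "Ck_on k S f" "Ck_on k S g"
  shows "Ck_on k S (\<lambda>x. f x + g x)"
  using assms(2,3)
proof (induction k arbitrary: f g)
  case (Suc k)
  have der: "((\<lambda>x. f x + g x) has_derivative (\<lambda>v. fd f x v + fd g x v)) (at x)" if "x \<in> S" for x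
    using that Suc.prems by (intro has_derivative_add has_derivative_fd) auto
  moreover have "Ck_on k S (\<lambda>x. fd f x v + fd g x v)" for v
    using Suc.prems by (intro Suc.IH) simp_all
  ultimately show ?case
    by (rule Ck_on_SucI[OF S])
qed (simp add: continuous_on_add)

lemma Ck_on_bilinear:
  assumes pr: "bounded_bilinear pr" and S: "open S" and "Ck_on k S f" "Ck_on k S g"
  shows "Ck_on k S (\<lambda>x. pr (f x) (g x))"
  using assms(3,4)
proof (induction k arbitrary: f g)
  case 0
  then show ?case
    by (simp add: bounded_bilinear.continuous_on[OF pr])
next
  case (Suc k)
  have der: "((\<lambda>x. pr (f x) (g x)) has_derivative
      (\<lambda>v. pr (f x) (fd g x v) + pr (fd f x v) (g x))) (at x)" if "x \<in> S" for x
    using that Suc.prems by (intro bounded_bilinear.FDERIV[OF pr] has_derivative_fd) auto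
  moreover have "Ck_on k S (\<lambda>x. pr (f x) (fd g x v) + pr (fd f x v) (g x))" for v
    using Suc.prems Ck_on_Suc_imp[OF Suc.prems(1)] Ck_on_Suc_imp[OF Suc.prems(2)]
    by (intro Ck_on_add[OF S] Suc.IH) simp_all
  ultimately show ?case
    by (rule Ck_on_SucI[OF S])
qed

lemma Ck_on_sum:
  assumes "open S" "\<And>i. i \<in> I \<Longrightarrow> Ck_on k S (f i)"
  shows "Ck_on k S (\<lambda>x. \<Sum>i\<in>I. f i x)"
  using assms(2)
  by (induction I rule: infinite_finite_induct) (simp_all add: Ck_on_const Ck_on_add[OF assms(1)])

text \<open>Metric, Christoffel symbols and differentials of transition maps are smooth after evaluation at
  fixed vectors and linear in these. Expansion in a basis turns evaluation at a varying vector into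
  sums of products.\<close>

lemma Ck_on_apply:
  fixes \<phi> :: "'e::euclidean_space \<Rightarrow> 'v::euclidean_space \<Rightarrow> 'w::real_normed_vector"
  assumes S: "open S" and lin: "\<And>x. x \<in> S \<Longrightarrow> linear (\<phi> x)"
    and \<phi>: "\<And>v. Ck_on k S (\<lambda>x. \<phi> x v)" and f: "Ck_on k S f"
  shows "Ck_on k S (\<lambda>x. \<phi> x (f x))"
proof (rule Ck_on_cong[OF S])
  show "Ck_on k S (\<lambda>x. \<Sum>b\<in>Basis. (f x \<bullet> b) *\<^sub>R \<phi> x b)"
    by (intro Ck_on_sum S Ck_on_bilinear[OF bounded_bilinear_scaleR] \<phi>
        Ck_on_bilinear[OF bounded_bilinear_inner] f Ck_on_const)
qed (simp add: linear_expand[OF lin, symmetric])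

lemma Ck_on_compose:
  fixes f :: "'e::euclidean_space \<Rightarrow> 'f::euclidean_space"
  assumes S: "open S" and fS: "f ` S \<subseteq> T" and "Ck_on k T h" "Ck_on k S f"
  shows "Ck_on k S (\<lambda>x. h (f x))"
  using assms(3,4)
proof (induction k arbitrary: h)
  case 0
  then show ?case
    using continuous_on_compose2 fS by auto
next
  case (Suc k)
  have der: "((\<lambda>x. h (f x)) has_derivative (\<lambda>v. fd h (f x) (fd f x v))) (at x)" if "x \<in> S" for x
    using that Suc.prems fS by (intro has_derivative_compose[OF has_derivative_fd has_derivative_fd]) auto
  moreover have "Ck_on k S (\<lambda>x. fd h (f x) (fd f x v))" for v
  proof (rule Ck_on_apply[OF S])
    show "linear (fd h (f x))" if "x \<in> S" for x
      using that Suc.prems fS by (intro linear_frechet_derivative) auto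
    show "Ck_on k S (\<lambda>x. fd h (f x) v)" for v
      using Suc.prems by (intro Suc.IH Ck_on_Suc_imp[of k S f]) auto
  qed (use Suc.prems in simp)
  ultimately show ?case
    by (rule Ck_on_SucI[OF S])
qed

lemma smooth_on_cong: "open S \<Longrightarrow> smooth_on S f \<Longrightarrow> (\<And>x. x \<in> S \<Longrightarrow> f x = g x) \<Longrightarrow> smooth_on S g"
  unfolding smooth_on_def using Ck_on_cong by blast

lemma smooth_on_subset: "smooth_on S f \<Longrightarrow> T \<subseteq> S \<Longrightarrow> smooth_on T f"
  unfolding smooth_on_def using Ck_on_subset by blast

lemma smooth_on_local:
  "(\<And>x. x \<in> S \<Longrightarrow> \<exists>T. open T \<and> x \<in> T \<and> smooth_on T f) \<Longrightarrow> smooth_on S f"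
  unfolding smooth_on_def by (intro allI Ck_on_local) blast

lemma smooth_on_const: "smooth_on S (\<lambda>x. c)"
  and smooth_on_linear: "bounded_linear h \<Longrightarrow> smooth_on S h"
  by (simp_all add: smooth_on_def Ck_on_const Ck_on_linear)

lemma smooth_on_add: "open S \<Longrightarrow> smooth_on S f \<Longrightarrow> smooth_on S g \<Longrightarrow> smooth_on S (\<lambda>x. f x + g x)"
  by (simp add: smooth_on_def Ck_on_add)

lemma smooth_on_bilinear:
  "bounded_bilinear pr \<Longrightarrow> open S \<Longrightarrow> smooth_on S f \<Longrightarrow> smooth_on S g \<Longrightarrow>
    smooth_on S (\<lambda>x. pr (f x) (g x))"
  by (simp add: smooth_on_def Ck_on_bilinear)

lemmas smooth_on_scaleR = smooth_on_bilinear[OF bounded_bilinear_scaleR]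

lemma smooth_on_diff:
  assumes "open S" "smooth_on S f" "smooth_on S g"
  shows "smooth_on S (\<lambda>x. f x - g x)"
  using smooth_on_add[OF assms(1,2) smooth_on_scaleR[OF assms(1) smooth_on_const[of S "- 1"] assms(3)]]
  by simp

lemma smooth_on_sum:
  "open S \<Longrightarrow> (\<And>i. i \<in> I \<Longrightarrow> smooth_on S (f i)) \<Longrightarrow> smooth_on S (\<lambda>x. \<Sum>i\<in>I. f i x)"
  by (simp add: smooth_on_def Ck_on_sum)

lemma smooth_on_apply:
  fixes \<phi> :: "'e::euclidean_space \<Rightarrow> 'v::euclidean_space \<Rightarrow> 'w::real_normed_vector"
  assumes "open S" "\<And>x. x \<in> S \<Longrightarrow> linear (\<phi> x)" "\<And>v. smooth_on S (\<lambda>x. \<phi> x v)" "smooth_on S f"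
  shows "smooth_on S (\<lambda>x. \<phi> x (f x))"
  using assms by (simp add: smooth_on_def Ck_on_apply)

lemma smooth_on_compose:
  fixes f :: "'e::euclidean_space \<Rightarrow> 'f::euclidean_space"
  assumes "open S" "f ` S \<subseteq> T" "smooth_on T h" "smooth_on S f"
  shows "smooth_on S (\<lambda>x. h (f x))"
  using assms by (simp add: smooth_on_def Ck_on_compose[of S f T])

lemma smooth_on_fd:
  assumes "smooth_on S f"
  shows "smooth_on S (\<lambda>x. fd f x v)"
proof -
  have "Ck_on (Suc k) S f" for k
    using assms unfolding smooth_on_def by blast
  then show ?thesis
    unfolding smooth_on_def by simp
qed

text \<open>Obtained by expansion in a basis. The base point is allowed to vary through a map \<open>k\<close>, because the same rule is needed on the
  base manifold (\<open>k\<close> the identity) and on its tangent bundle (\<open>k\<close> the projection).\<close>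

lemma has_derivative_apply:
  fixes \<phi> :: "'e::real_normed_vector \<Rightarrow> 'v::euclidean_space \<Rightarrow> 'w::real_normed_vector"
    and k :: "'d::real_normed_vector \<Rightarrow> 'e"
  assumes S: "open S" "k x \<in> S" and lin: "\<And>y. y \<in> S \<Longrightarrow> linear (\<phi> y)"
    and \<phi>: "\<And>v. (\<lambda>y. \<phi> y v) differentiable (at (k x))"
    and k: "(k has_derivative k') (at x)" and f: "(f has_derivative f') (at x)"
  shows "((\<lambda>y. \<phi> (k y) (f y)) has_derivative
    (\<lambda>h. fd (\<lambda>y. \<phi> y (f x)) (k x) (k' h) + \<phi> (k x) (f' h))) (at x)"
proof -
  have part: "((\<lambda>y. \<Sum>b\<in>Basis. (F y \<bullet> b) *\<^sub>R \<phi> (l y) b) has_derivative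
      (\<lambda>h. \<Sum>b\<in>Basis. (F z \<bullet> b) *\<^sub>R fd (\<lambda>y. \<phi> y b) (k x) (l' h) + (F' h \<bullet> b) *\<^sub>R \<phi> (l z) b)) (at z)"
    if "(F has_derivative F') (at z)" "(l has_derivative l') (at z)" "l z = k x"
    for F F' l l' and z :: "'z::real_normed_vector"
  proof (intro has_derivative_sum has_derivative_scaleR has_derivative_inner_left that(1))
    show "((\<lambda>y. \<phi> (l y) b) has_derivative (\<lambda>h. fd (\<lambda>y. \<phi> y b) (k x) (l' h))) (at z)" for b
      using has_derivative_compose[OF that(2), of "\<lambda>y. \<phi> y b"] has_derivative_fd[OF \<phi>] that(3) by simp
  qed
  have eq: "(\<Sum>b\<in>Basis. (v \<bullet> b) *\<^sub>R \<phi> y b) = \<phi> y v" if "y \<in> S" for y v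
    by (rule linear_expand[OF lin[OF that], symmetric])
  have "fd (\<lambda>y. \<phi> y (f x)) (k x) h = (\<Sum>b\<in>Basis. (f x \<bullet> b) *\<^sub>R fd (\<lambda>y. \<phi> y b) (k x) h)" for h
  proof -
    have "((\<lambda>y. \<phi> y (f x)) has_derivative
        (\<lambda>h. \<Sum>b\<in>Basis. (f x \<bullet> b) *\<^sub>R fd (\<lambda>y. \<phi> y b) (k x) h)) (at (k x))"
      using part[OF has_derivative_const[of "f x"] has_derivative_ident refl, simplified]
      by (rule has_derivative_transform_within_open[OF _ S]) (simp_all add: eq)
    then show ?thesis
      by (simp add: fd_eq)
  qed
  moreover have "\<phi> (k x) (f' h) = (\<Sum>b\<in>Basis. (f' h \<bullet> b) *\<^sub>R \<phi> (k x) b)" for h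
    by (rule linear_expand[OF lin[OF S(2)]])
  moreover have "((\<lambda>p. \<phi> (fst p) (snd p)) has_derivative
      (\<lambda>h. \<Sum>b\<in>Basis. (f x \<bullet> b) *\<^sub>R fd (\<lambda>y. \<phi> y b) (k x) (fst h) + (snd h \<bullet> b) *\<^sub>R \<phi> (k x) b))
      (at (k x, f x))"
  proof (rule has_derivative_transform_within_open[where s = "S \<times> UNIV"])
    show "((\<lambda>p. \<Sum>b\<in>Basis. (snd p \<bullet> b) *\<^sub>R \<phi> (fst p) b) has_derivative
        (\<lambda>h. \<Sum>b\<in>Basis. (f x \<bullet> b) *\<^sub>R fd (\<lambda>y. \<phi> y b) (k x) (fst h) + (snd h \<bullet> b) *\<^sub>R \<phi> (k x) b))
        (at (k x, f x))"
      using part[OF has_derivative_snd[OF has_derivative_ident] has_derivative_fst[OF has_derivative_ident],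
          of "(k x, f x)"] by simp
  qed (use S eq in \<open>auto intro: open_Times\<close>)
  ultimately have "((\<lambda>p. \<phi> (fst p) (snd p)) has_derivative
      (\<lambda>h. fd (\<lambda>y. \<phi> y (f x)) (k x) (fst h) + \<phi> (k x) (snd h))) (at (k x, f x))"
    by (simp add: sum.distrib linear_expand[OF lin[OF S(2)], symmetric])
  from has_derivative_compose[OF has_derivative_Pair[OF k f] this] show ?thesis
    by simp
qed

text \<open>The form of the rule for metrics and Christoffel symbols: it is applied to one argument after the other.\<close>

lemma has_derivative_apply2:
  fixes \<phi> :: "'e::real_normed_vector \<Rightarrow> 'u::euclidean_space \<Rightarrow> 'v::euclidean_space \<Rightarrow> 'w::real_normed_vector"
    and k :: "'d::real_normed_vector \<Rightarrow> 'e"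
  assumes S: "open S" "k x \<in> S"
    and lin: "\<And>y v. y \<in> S \<Longrightarrow> linear (\<lambda>u. \<phi> y u v)" "\<And>y u. y \<in> S \<Longrightarrow> linear (\<phi> y u)"
    and \<phi>: "\<And>u v. (\<lambda>y. \<phi> y u v) differentiable (at (k x))"
    and k: "(k has_derivative k') (at x)" and f: "(f has_derivative f') (at x)"
    and l: "(l has_derivative l') (at x)"
  shows "((\<lambda>y. \<phi> (k y) (f y) (l y)) has_derivative
    (\<lambda>h. fd (\<lambda>y. \<phi> y (f x) (l x)) (k x) (k' h) + \<phi> (k x) (f' h) (l x) + \<phi> (k x) (f x) (l' h))) (at x)"
proof -
  let ?\<psi> = "\<lambda>q v. \<phi> (fst q) (snd q) v"
  have der: "((\<lambda>q. ?\<psi> q v) has_derivative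
      (\<lambda>h. fd (\<lambda>y. \<phi> y (f x) v) (k x) (fst h) + \<phi> (k x) (snd h) v)) (at (k x, f x))" for v
    by (rule has_derivative_apply[where k = fst and f = snd and x = "(k x, f x)" and \<phi> = "\<lambda>y u. \<phi> y u v",
          simplified, OF S lin(1) \<phi> has_derivative_fst[OF has_derivative_ident]
            has_derivative_snd[OF has_derivative_ident]])
  have "((\<lambda>y. ?\<psi> (k y, f y) (l y)) has_derivative
     (\<lambda>h. fd (\<lambda>q. ?\<psi> q (l x)) (k x, f x) (k' h, f' h) + ?\<psi> (k x, f x) (l' h))) (at x)"
  proof (rule has_derivative_apply[where S = "S \<times> UNIV"])
    show "(\<lambda>q. ?\<psi> q v) differentiable at (k x, f x)" for v
      by (rule differentiableI[OF der])
  qed (use S lin k f l in \<open>auto intro: open_Times has_derivative_Pair\<close>)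
  then show ?thesis
    by (simp add: fd_eq[OF der])
qed

lemma linear_fd_family:
  assumes S: "open S" "x \<in> S" and lin: "\<And>y. y \<in> S \<Longrightarrow> linear (\<phi> y)"
    and \<phi>: "\<And>v. (\<lambda>y. \<phi> y v) differentiable (at x)"
  shows "linear (\<lambda>v. fd (\<lambda>y. \<phi> y v) x h)"
proof (rule linearI)
  fix v w r
  have "((\<lambda>y. \<phi> y v + \<phi> y w) has_derivative (\<lambda>h. fd (\<lambda>y. \<phi> y v) x h + fd (\<lambda>y. \<phi> y w) x h)) (at x)"
    "((\<lambda>y. r *\<^sub>R \<phi> y v) has_derivative (\<lambda>h. r *\<^sub>R fd (\<lambda>y. \<phi> y v) x h)) (at x)"
    by (intro derivative_intros has_derivative_fd[OF \<phi>])+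
  then have "((\<lambda>y. \<phi> y (v + w)) has_derivative (\<lambda>h. fd (\<lambda>y. \<phi> y v) x h + fd (\<lambda>y. \<phi> y w) x h)) (at x)"
    "((\<lambda>y. \<phi> y (r *\<^sub>R v)) has_derivative (\<lambda>h. r *\<^sub>R fd (\<lambda>y. \<phi> y v) x h)) (at x)"
    by (auto elim!: has_derivative_transform_within_open[OF _ S]
        simp: linear_add[OF lin] linear_scale[OF lin])
  then show "fd (\<lambda>y. \<phi> y (v + w)) x h = fd (\<lambda>y. \<phi> y v) x h + fd (\<lambda>y. \<phi> y w) x h"
    "fd (\<lambda>y. \<phi> y (r *\<^sub>R v)) x h = r *\<^sub>R fd (\<lambda>y. \<phi> y v) x h"
    by (simp_all add: fd_eq)
qed

text \<open>Two applications of the mean value theorem turn the second difference quotient into a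
  mixed second derivative at a nearby point.\<close>

lemma second_difference:
  fixes f :: "'e::euclidean_space \<Rightarrow> real"
  assumes S: "open S" "x \<in> S" and f: "smooth_on S f" and e: "e > 0"
  shows "\<exists>d>0. \<forall>t. 0 < t \<and> t < d \<longrightarrow>
    \<bar>(f (x + t *\<^sub>R u + t *\<^sub>R v) - f (x + t *\<^sub>R u) - f (x + t *\<^sub>R v) + f x)
      - t * t * fd (\<lambda>y. fd f y u) x v\<bar> \<le> e * (t * t)"
proof -
  define F where "F = (\<lambda>y. fd (\<lambda>y. fd f y u) y v)"
  have "smooth_on S F"
    unfolding F_def by (intro smooth_on_fd f)
  then have "continuous_on S F"
    unfolding smooth_on_def by (auto dest: spec[of _ 0])
  then have "isCont F x"
    using S continuous_on_eq_continuous_at by blast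
  then obtain d0 where d0: "d0 > 0" "\<And>y. dist y x < d0 \<Longrightarrow> \<bar>F y - F x\<bar> < e"
    using e unfolding continuous_at_eps_delta dist_real_def by blast
  obtain d1 where d1: "d1 > 0" "ball x d1 \<subseteq> S"
    using S open_contains_ball by blast
  \<comment> \<open>the parallelogram with sides \<open>t u\<close>, \<open>t v\<close> lies within distance \<open>t K\<close> of \<open>x\<close>\<close>
  define K where "K = norm u + norm v + 1"
  have K: "K > 0"
    unfolding K_def by (simp add: add_nonneg_pos)
  define d where "d = min d0 d1 / K"
  have near: "dist (x + s *\<^sub>R u + r *\<^sub>R v) x < min d0 d1"
    if "0 \<le> s" "s \<le> t" "0 \<le> r" "r \<le> t" "t < d" "0 < t" for s r t
  proof -
    have "dist (x + s *\<^sub>R u + r *\<^sub>R v) x \<le> s * norm u + r * norm v"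
      using that norm_triangle_ineq[of "s *\<^sub>R u" "r *\<^sub>R v"] by (simp add: dist_norm algebra_simps)
    also have "\<dots> \<le> t * norm u + t * norm v"
      using that by (intro add_mono mult_right_mono) auto
    also have "\<dots> < t * K"
      using that by (simp add: K_def algebra_simps)
    also have "\<dots> < min d0 d1"
      using that K by (simp add: d_def pos_less_divide_eq)
    finally show ?thesis .
  qed
  have inS: "x + s *\<^sub>R u + r *\<^sub>R v \<in> S"
    if "0 \<le> s" "s \<le> t" "0 \<le> r" "r \<le> t" "t < d" "0 < t" for s r t
    using near[OF that] d1 by (auto simp: dist_commute)
  have df: "f differentiable (at y)" "(\<lambda>y. fd f y u) differentiable (at y)" if "y \<in> S" for y
    using that f smooth_on_fd[OF f] by (auto intro: smooth_on_imp_differentiable)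
  have main: "\<bar>(f (x + t *\<^sub>R u + t *\<^sub>R v) - f (x + t *\<^sub>R u) - f (x + t *\<^sub>R v) + f x)
      - t * t * F x\<bar> \<le> e * (t * t)" if t: "0 < t" "t < d" for t
  proof -
    let ?h = "\<lambda>s. f (x + s *\<^sub>R u + t *\<^sub>R v) - f (x + s *\<^sub>R u)"
    have "(?h has_derivative (\<lambda>k. k * (fd f (x + s *\<^sub>R u + t *\<^sub>R v) u - fd f (x + s *\<^sub>R u) u))) (at s)"
      if s: "0 \<le> s" "s \<le> t" for s
    proof -
      have m: "x + s *\<^sub>R u + t *\<^sub>R v \<in> S" "x + s *\<^sub>R u \<in> S"
        using inS[of s t t] inS[of s t 0] s t by auto
      have "(?h has_derivative (\<lambda>k. fd f (x + s *\<^sub>R u + t *\<^sub>R v) (k *\<^sub>R u) - fd f (x + s *\<^sub>R u) (k *\<^sub>R u))) (at s)"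
        by (rule derivative_eq_intros has_derivative_compose[OF _ has_derivative_fd[OF df(1)]] m refl
            | simp)+
      then show ?thesis
        using m by (simp add: linear_scale[OF linear_frechet_derivative] df algebra_simps)
    qed
    then obtain s where s: "0 < s" "s < t"
      "?h t - ?h 0 = t * (fd f (x + s *\<^sub>R u + t *\<^sub>R v) u - fd f (x + s *\<^sub>R u) u)"
      using mvt_simple[of 0 t ?h "\<lambda>s k. k * (fd f (x + s *\<^sub>R u + t *\<^sub>R v) u - fd f (x + s *\<^sub>R u) u)"] t
        has_derivative_at_withinI by fastforce
    let ?k = "\<lambda>r. fd f (x + s *\<^sub>R u + r *\<^sub>R v) u"
    have "(?k has_derivative (\<lambda>h. h * F (x + s *\<^sub>R u + r *\<^sub>R v))) (at r)" if r: "0 \<le> r" "r \<le> t" for r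
    proof -
      have m: "x + s *\<^sub>R u + r *\<^sub>R v \<in> S"
        using inS[of s t r] s r t by auto
      have "(?k has_derivative (\<lambda>h. fd (\<lambda>y. fd f y u) (x + s *\<^sub>R u + r *\<^sub>R v) (h *\<^sub>R v))) (at r)"
        by (rule derivative_eq_intros has_derivative_compose[OF _ has_derivative_fd[OF df(2)]] m refl
            | simp)+
      then show ?thesis
        using m by (simp add: linear_scale[OF linear_frechet_derivative] df F_def)
    qed
    then obtain r where r: "0 < r" "r < t" "?k t - ?k 0 = t * F (x + s *\<^sub>R u + r *\<^sub>R v)"
      using mvt_simple[of 0 t ?k "\<lambda>r h. h * F (x + s *\<^sub>R u + r *\<^sub>R v)"] t
        has_derivative_at_withinI by fastforce
    have "\<bar>F (x + s *\<^sub>R u + r *\<^sub>R v) - F x\<bar> \<le> e"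
      using d0(2)[of "x + s *\<^sub>R u + r *\<^sub>R v"] near[of s t r] s r t by auto
    then have "\<bar>t * t * F (x + s *\<^sub>R u + r *\<^sub>R v) - t * t * F x\<bar> \<le> e * (t * t)"
      by (metis abs_mult abs_mult_self_eq mult.commute mult_left_mono right_diff_distrib' zero_le_square)
    then show ?thesis
      using s(3) r(3) by (simp add: algebra_simps)
  qed
  have "d > 0"
    unfolding d_def using d0 d1 K by simp
  with main show ?thesis
    unfolding F_def by blast
qed

text \<open>The second difference is symmetric in the two directions, so both mixed derivatives are limits of
  the same quotient.\<close>

lemma fd_commute:
  fixes f :: "'e::euclidean_space \<Rightarrow> 'f::euclidean_space"
  assumes S: "open S" "x \<in> S" and f: "smooth_on S f"
  shows "fd (\<lambda>y. fd f y u) x v = fd (\<lambda>y. fd f y v) x u"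
proof (rule euclidean_eqI)
  fix b :: 'f
  let ?f = "\<lambda>x. f x \<bullet> b"
  have sm: "smooth_on S ?f"
    by (intro smooth_on_bilinear[OF bounded_bilinear_inner] S f smooth_on_const)
  have inn: "fd (\<lambda>y. fd ?f y u) x v = fd (\<lambda>y. fd f y u) x v \<bullet> b" for u v
  proof -
    have 1: "fd ?f y u = fd f y u \<bullet> b" if "y \<in> S" for y u
      by (simp add: fd_eq[OF has_derivative_inner_left[OF has_derivative_fd[OF
              smooth_on_imp_differentiable[OF f that]]]])
    have d: "(\<lambda>y. fd f y u) differentiable (at x)"
      by (intro smooth_on_imp_differentiable[OF smooth_on_fd[OF f] S(2)])
    have "((\<lambda>y. fd f y u \<bullet> b) has_derivative (\<lambda>v. fd (\<lambda>y. fd f y u) x v \<bullet> b)) (at x)"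
      by (intro has_derivative_inner_left has_derivative_fd d)
    then have "((\<lambda>y. fd ?f y u) has_derivative (\<lambda>v. fd (\<lambda>y. fd f y u) x v \<bullet> b)) (at x)"
      by (rule has_derivative_transform_within_open[OF _ S]) (simp add: 1)
    then show ?thesis
      by (simp add: fd_eq)
  qed
  let ?L = "fd (\<lambda>y. fd ?f y u) x v" and ?R = "fd (\<lambda>y. fd ?f y v) x u"
  have "\<bar>?L - ?R\<bar> \<le> 2 * e" if e: "e > 0" for e
  proof -
    obtain d d' where d: "d > 0" "d' > 0"
      and L: "\<And>t. 0 < t \<and> t < d \<Longrightarrow> \<bar>(?f (x + t *\<^sub>R u + t *\<^sub>R v) - ?f (x + t *\<^sub>R u) - ?f (x + t *\<^sub>R v) + ?f x)
        - t * t * ?L\<bar> \<le> e * (t * t)"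
      and R: "\<And>t. 0 < t \<and> t < d' \<Longrightarrow> \<bar>(?f (x + t *\<^sub>R v + t *\<^sub>R u) - ?f (x + t *\<^sub>R v) - ?f (x + t *\<^sub>R u) + ?f x)
        - t * t * ?R\<bar> \<le> e * (t * t)"
      using second_difference[OF S sm e, of u v] second_difference[OF S sm e, of v u] by blast
    define t where "t = min d d' / 2"
    have t: "0 < t" "t < d" "t < d'"
      using d by (auto simp: t_def)
    have "x + t *\<^sub>R v + t *\<^sub>R u = x + t *\<^sub>R u + t *\<^sub>R v" by simp
    then have "\<bar>t * t * ?L - t * t * ?R\<bar> \<le> 2 * (e * (t * t))"
      using L[of t] R[of t] t by (smt (verit, best))
    then have "(t * t) * \<bar>?L - ?R\<bar> \<le> (t * t) * (2 * e)"
      by (simp add: abs_mult flip: right_diff_distrib) (simp add: algebra_simps)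
    then show ?thesis
      using t by (simp add: mult_le_cancel_left)
  qed
  then have half: "\<bar>?L - ?R\<bar> \<le> e" if "e > 0" for e
    using that by (metis field_sum_of_halves half_gt_zero mult_2)
  have "\<bar>?L - ?R\<bar> \<le> 0"
    by (rule field_le_epsilon, unfold add_0, rule half)
  then show "fd (\<lambda>y. fd f y u) x v \<bullet> b = fd (\<lambda>y. fd f y v) x u \<bullet> b"
    by (simp add: inn)
qed

section \<open>Riemannian metrics on open sets\<close>

locale local_metric =
  fixes U :: "'e::euclidean_space set" and \<gamma> :: "'e \<Rightarrow> 'e \<Rightarrow> 'e \<Rightarrow> real"
  assumes open_U: "open U"
    and lin1: "x \<in> U \<Longrightarrow> linear (\<lambda>u. \<gamma> x u v)"
    and sym: "x \<in> U \<Longrightarrow> \<gamma> x u v = \<gamma> x v u"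
    and pos: "x \<in> U \<Longrightarrow> u \<noteq> 0 \<Longrightarrow> \<gamma> x u u > 0"
    and smooth_metric: "smooth_on U (\<lambda>x. \<gamma> x u v)"
begin

lemma lin2: "x \<in> U \<Longrightarrow> linear (\<gamma> x u)"
  using lin1[of x u] sym[of x] by (simp add: linear_iff)

lemma metric_simps:
  assumes "x \<in> U"
  shows "\<gamma> x (u + v) w = \<gamma> x u w + \<gamma> x v w" "\<gamma> x w (u + v) = \<gamma> x w u + \<gamma> x w v"
    "\<gamma> x (u - v) w = \<gamma> x u w - \<gamma> x v w" "\<gamma> x w (u - v) = \<gamma> x w u - \<gamma> x w v"
    "\<gamma> x (r *\<^sub>R u) w = r * \<gamma> x u w" "\<gamma> x w (r *\<^sub>R u) = r * \<gamma> x w u"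
    "\<gamma> x (- u) w = - \<gamma> x u w" "\<gamma> x w (- u) = - \<gamma> x w u"
    "\<gamma> x 0 w = 0" "\<gamma> x w 0 = 0"
  by (simp_all add: linear_add[OF lin1] linear_add[OF lin2] linear_diff[OF lin1] linear_diff[OF lin2]
      linear_scale[OF lin1] linear_scale[OF lin2] linear_neg[OF lin1] linear_neg[OF lin2]
      linear_0[OF lin1] linear_0[OF lin2] assms)

lemma metric_eqI:
  assumes x: "x \<in> U" and eq: "\<And>z. \<gamma> x u z = \<gamma> x v z"
  shows "u = v"
proof (rule ccontr)
  assume "u \<noteq> v"
  then have "\<gamma> x (u - v) (u - v) > 0"
    by (intro pos x) simp
  then show False
    by (simp add: metric_simps(3)[OF x] eq)
qed

lemma metric_differentiable: "x \<in> U \<Longrightarrow> (\<lambda>y. \<gamma> y u v) differentiable (at x)"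
  by (rule smooth_on_imp_differentiable[OF smooth_metric])

text \<open>The vector representing a covector with respect to \<open>\<gamma>\<close>.\<close>

definition sharp :: "'e \<Rightarrow> ('e \<Rightarrow> real) \<Rightarrow> 'e" where
  "sharp x \<omega> = (THE w. \<forall>z. \<gamma> x w z = \<omega> z)"

lemma sharp_unique:
  assumes "x \<in> U" "\<And>z. \<gamma> x w z = \<omega> z"
  shows "sharp x \<omega> = w"
  unfolding sharp_def using assms by (intro the_equality) (auto intro: metric_eqI)

lemma sharp:
  assumes x: "x \<in> U" and \<omega>: "linear \<omega>"
  shows "\<gamma> x (sharp x \<omega>) z = \<omega> z"
proof -
  define G where "G = (\<lambda>w. \<Sum>b\<in>Basis. \<gamma> x w b *\<^sub>R b)"
  have G_inner: "G w \<bullet> z = \<gamma> x w z" for w z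
  proof -
    have "G w \<bullet> z = (\<Sum>b\<in>Basis. (z \<bullet> b) *\<^sub>R \<gamma> x w b)"
      by (simp add: G_def inner_sum_left inner_commute[of z] mult.commute)
    then show ?thesis
      by (simp only: linear_expand[OF lin2[OF x], of w z])
  qed
  have "linear G"
    by (rule linearI)
      (simp_all add: G_def metric_simps[OF x] scaleR_add_left sum.distrib scaleR_sum_right)
  moreover have "inj G"
    by (rule injI, rule metric_eqI[OF x]) (simp flip: G_inner)
  ultimately have "surj G"
    by (simp add: linear_injective_imp_surjective)
  then obtain w where w: "(\<Sum>b\<in>Basis. \<omega> b *\<^sub>R b) = G w"
    by (rule surjE)
  have "\<gamma> x w z = \<omega> z" for z
  proof -
    have "\<gamma> x w z = (\<Sum>b\<in>Basis. (z \<bullet> b) *\<^sub>R \<omega> b)"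
      unfolding G_inner[symmetric] w[symmetric] by (simp add: inner_sum_left inner_commute[of z] mult.commute)
    then show ?thesis
      by (simp only: linear_expand[OF \<omega>, of z])
  qed
  then show ?thesis
    using sharp_unique[OF x, of w \<omega>] by simp
qed

text \<open>The frame of \<open>\<gamma>\<close>-gradients of the coordinate functions. Every \<open>sharp x \<omega>\<close> is a
  combination of it with coefficients \<open>\<omega> b\<close>, so that only the smoothness of this frame has to be established.\<close>

definition dual_frame :: "'e \<Rightarrow> 'e \<Rightarrow> 'e" where
  "dual_frame b x = sharp x (\<lambda>z. z \<bullet> b)"

lemma dual_frame: "x \<in> U \<Longrightarrow> \<gamma> x (dual_frame b x) z = z \<bullet> b"
  unfolding dual_frame_def by (rule sharp) (auto intro: bounded_linear.linear bounded_linear_inner_left)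

lemma sharp_dual_frame:
  assumes x: "x \<in> U" and \<omega>: "linear \<omega>"
  shows "sharp x \<omega> = (\<Sum>b\<in>Basis. \<omega> b *\<^sub>R dual_frame b x)"
proof (rule sharp_unique[OF x])
  fix z
  have "\<gamma> x (\<Sum>b\<in>Basis. \<omega> b *\<^sub>R dual_frame b x) z = (\<Sum>b\<in>Basis. (z \<bullet> b) *\<^sub>R \<omega> b)"
    by (simp add: linear_sum[OF lin1[OF x]] metric_simps[OF x] dual_frame[OF x] mult.commute)
  then show "\<gamma> x (\<Sum>b\<in>Basis. \<omega> b *\<^sub>R dual_frame b x) z = \<omega> z"
    by (simp only: linear_expand[OF \<omega>, of z])
qed

text \<open>The frame is a slice of the inverse of \<open>(y, w) \<mapsto> (y, \<gamma> y w)\<close>, a map with invertible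
  derivative, and the inverse function theorem applies to that map.\<close>

lemma dual_frame_differentiable:
  assumes x: "x \<in> U"
  shows "dual_frame b differentiable (at x)"
proof -
  define G where "G = (\<lambda>y w. \<Sum>b\<in>Basis. \<gamma> y w b *\<^sub>R b)"
  define inv where "inv = (\<lambda>y v. sharp y (\<lambda>z. z \<bullet> v))"
  define w where "w = dual_frame b x"
  have lin_inner: "linear (\<lambda>z::'e. z \<bullet> v)" for v
    by (auto intro: bounded_linear.linear bounded_linear_inner_left)
  have lin_G: "linear (G y)" if "y \<in> U" for y
    by (rule linearI)
      (simp_all add: G_def metric_simps[OF that] scaleR_add_left sum.distrib scaleR_sum_right)
  have inv_G: "inv y (G y v) = v" if y: "y \<in> U" for y v
    unfolding inv_def
  proof (rule sharp_unique[OF y])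
    fix z
    have "z \<bullet> G y v = (\<Sum>b\<in>Basis. (z \<bullet> b) *\<^sub>R \<gamma> y v b)"
      by (simp add: G_def inner_sum_right mult.commute)
    then show "\<gamma> y v z = z \<bullet> G y v"
      by (simp only: linear_expand[OF lin2[OF y], of v z])
  qed
  have G_inv: "G y (inv y v) = v" if y: "y \<in> U" for y v
    unfolding G_def inv_def sharp[OF y lin_inner]
    by (simp add: inner_commute[of _ v] euclidean_representation)
  have G_diff: "(\<lambda>y. G y v) differentiable (at y)" if "y \<in> U" for y v
    unfolding G_def using metric_differentiable[OF that] by (intro differentiable_sum) auto
  let ?f = "\<lambda>q. (fst q, G (fst q) (snd q))" and ?g = "\<lambda>q. (fst q, inv (fst q) (snd q))"
  have der: "(?f has_derivative
      (\<lambda>h. (fst h, fd (\<lambda>y. G y (snd q)) (fst q) (fst h) + G (fst q) (snd h)))) (at q)"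
    if "fst q \<in> U" for q
    using that by (intro has_derivative_Pair has_derivative_apply[where \<phi> = G, OF open_U]
        has_derivative_fst has_derivative_snd has_derivative_ident lin_G G_diff)
  have "(?g has_derivative
      (\<lambda>h. (fst h, inv x (snd h - fd (\<lambda>y. G y w) x (fst h))))) (at (?f (x, w)))"
  proof (rule has_derivative_inverse_strong[where f = ?f and S = "U \<times> UNIV"])
    show "continuous_on (U \<times> UNIV) ?f"
      by (intro continuous_at_imp_continuous_on ballI has_derivative_continuous[OF der]) auto
    show "(?f has_derivative (\<lambda>h. (fst h, fd (\<lambda>y. G y w) x (fst h) + G x (snd h)))) (at (x, w))"
      using der[of "(x, w)"] x by simp
    show "(\<lambda>h. (fst h, fd (\<lambda>y. G y w) x (fst h) + G x (snd h))) \<circ>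
        (\<lambda>h. (fst h, inv x (snd h - fd (\<lambda>y. G y w) x (fst h)))) = id"
      by (simp add: fun_eq_iff G_inv[OF x])
  qed (use x inv_G open_U in \<open>auto intro: open_Times\<close>)
  moreover have "G x w = b"
    using G_inv[OF x, of b] by (simp add: w_def inv_def dual_frame_def)
  ultimately have g: "(?g has_derivative
      (\<lambda>h. (fst h, inv x (snd h - fd (\<lambda>y. G y w) x (fst h))))) (at (x, b))"
    by simp
  from has_derivative_snd[OF has_derivative_compose[OF has_derivative_Pair[OF has_derivative_ident
        has_derivative_const[of b]] g]]
  have "(\<lambda>y. inv y b) differentiable (at x)"
    by (auto intro: differentiableI)
  then show ?thesis
    by (simp add: inv_def dual_frame_def[abs_def])
qed

text \<open>Differentiating \<open>\<gamma> (dual_frame b) z = z \<bullet> b\<close> expresses the derivatives of the frame through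
  the frame, so that smoothness follows by induction on the order of differentiability.\<close>

lemma smooth_dual_frame: "smooth_on U (dual_frame b)"
proof -
  let ?L = "\<lambda>b x v b'. fd (\<lambda>y. \<gamma> y (dual_frame b x) b') x v"
  have lin_d: "linear (\<lambda>w. fd (\<lambda>y. \<gamma> y w z) x v)" "linear (\<lambda>z. fd (\<lambda>y. \<gamma> y w z) x v)"
    if "x \<in> U" for x v z w
    by (rule linear_fd_family[OF open_U that]; simp add: lin1 lin2 metric_differentiable that)+
  have der: "(dual_frame b has_derivative
      (\<lambda>v. \<Sum>b'\<in>Basis. (- ?L b x v b') *\<^sub>R dual_frame b' x)) (at x)" if x: "x \<in> U" for x b
  proof -
    let ?e = "dual_frame b"
    \<comment> \<open>the derivative of the constant \<open>z \<bullet> b\<close>\<close>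
    have "?L b x v z + \<gamma> x (fd ?e x v) z = 0" for v z
    proof -
      have "((\<lambda>y. \<gamma> y (?e y) z) has_derivative (\<lambda>v. ?L b x v z + \<gamma> x (fd ?e x v) z)) (at x)"
        by (rule has_derivative_apply[where k = "\<lambda>y. y", OF open_U x])
          (auto intro: lin1 metric_differentiable x has_derivative_fd dual_frame_differentiable)
      moreover have "((\<lambda>y. \<gamma> y (?e y) z) has_derivative (\<lambda>v. 0)) (at x)"
        by (rule has_derivative_transform_within_open[OF has_derivative_const[of "z \<bullet> b"] open_U x])
          (simp add: dual_frame)
      ultimately show ?thesis
        by (rule has_derivative_unique[THEN fun_cong])
    qed
    then have "fd ?e x v = sharp x (\<lambda>z. - ?L b x v z)" for v
      by (intro sharp_unique[OF x, symmetric]) (simp add: eq_neg_iff_add_eq_0 add.commute)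
    moreover have "linear (\<lambda>z. - ?L b x v z)" for v
      using lin_d(2)[OF x] by (simp add: linear_compose_neg)
    ultimately have "fd ?e x = (\<lambda>v. \<Sum>b'\<in>Basis. (- ?L b x v b') *\<^sub>R dual_frame b' x)"
      by (intro ext) (simp add: sharp_dual_frame[OF x])
    then show ?thesis
      using has_derivative_fd[OF dual_frame_differentiable[OF x, of b]] by simp
  qed
  have "Ck_on k U (dual_frame b)" for k
  proof (induction k arbitrary: b)
    case 0
    show ?case
      using dual_frame_differentiable
      by (simp add: continuous_at_imp_continuous_on differentiable_imp_continuous_within)
  next
    case (Suc k)
    show ?case
    proof (rule Ck_on_SucI[OF open_U der])
      fix v
      have "Ck_on k U (\<lambda>x. ?L b x v b')" for b'
      proof (rule Ck_on_apply[where \<phi> = "\<lambda>x w. fd (\<lambda>y. \<gamma> y w b') x v", OF open_U])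
        show "Ck_on k U (\<lambda>x. fd (\<lambda>y. \<gamma> y w b') x v)" for w
          using smooth_on_fd[OF smooth_metric, of w b' v] unfolding smooth_on_def by blast
      qed (rule lin_d(1) Suc.IH; assumption?)+
      then have "Ck_on k U (\<lambda>x. (- 1) *\<^sub>R ?L b x v b')" for b'
        by (intro Ck_on_bilinear[OF bounded_bilinear_scaleR] open_U Ck_on_const)
      then show "Ck_on k U (\<lambda>x. \<Sum>b'\<in>Basis. (- ?L b x v b') *\<^sub>R dual_frame b' x)"
        by (intro Ck_on_sum Ck_on_bilinear[OF bounded_bilinear_scaleR] open_U Suc.IH) simp
    qed
  qed
  then show ?thesis
    by (simp add: smooth_on_def)
qed

lemma smooth_sharp:
  assumes "\<And>x. x \<in> U \<Longrightarrow> linear (\<omega> x)" "\<And>z. smooth_on U (\<lambda>x. \<omega> x z)"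
  shows "smooth_on U (\<lambda>x. sharp x (\<omega> x))"
proof (rule smooth_on_cong[OF open_U])
  show "smooth_on U (\<lambda>x. \<Sum>b\<in>Basis. \<omega> x b *\<^sub>R dual_frame b x)"
    by (intro smooth_on_sum smooth_on_scaleR open_U assms smooth_dual_frame)
qed (simp add: sharp_dual_frame assms(1))

end

section \<open>Christoffel symbols\<close>

definition koszul :: "('e::euclidean_space \<Rightarrow> 'e \<Rightarrow> 'e \<Rightarrow> real) \<Rightarrow> 'e \<Rightarrow> 'e \<Rightarrow> 'e \<Rightarrow> 'e \<Rightarrow> real" where
  "koszul \<gamma> x u v z = fd (\<lambda>y. \<gamma> y v z) x u + fd (\<lambda>y. \<gamma> y u z) x v - fd (\<lambda>y. \<gamma> y u v) x z"

definition christoffel_symbol :: "('e::euclidean_space \<Rightarrow> 'e \<Rightarrow> 'e \<Rightarrow> real) \<Rightarrow> 'e \<Rightarrow> 'e \<Rightarrow> 'e \<Rightarrow> 'e" where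
  "christoffel_symbol \<gamma> x u v = (THE w. \<forall>z. 2 * \<gamma> x w z = koszul \<gamma> x u v z)"

lemma (in local_metric) metric_fd_linear:
  assumes "x \<in> U"
  shows "linear (\<lambda>u. fd (\<lambda>y. \<gamma> y u v) x h)" "linear (\<lambda>v. fd (\<lambda>y. \<gamma> y u v) x h)"
    "linear (\<lambda>h. fd (\<lambda>y. \<gamma> y u v) x h)"
proof -
  show "linear (\<lambda>u. fd (\<lambda>y. \<gamma> y u v) x h)" "linear (\<lambda>v. fd (\<lambda>y. \<gamma> y u v) x h)"
    by (rule linear_fd_family[OF open_U assms]; simp add: lin1 lin2 metric_differentiable assms)+
  show "linear (\<lambda>h. fd (\<lambda>y. \<gamma> y u v) x h)"
    using linear_frechet_derivative[OF metric_differentiable[OF assms]] .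
qed

lemma (in local_metric) metric_fd_sym:
  "x \<in> U \<Longrightarrow> fd (\<lambda>y. \<gamma> y u v) x = fd (\<lambda>y. \<gamma> y v u) x"
  by (rule fd_cong[OF open_U]) (simp_all add: sym)

text \<open>The Christoffel symbols are a parameter of the locale, because on a manifold they are given by a
  constant of their own.\<close>

locale local_connection = local_metric U \<gamma>
  for U :: "'e::euclidean_space set" and \<gamma> :: "'e \<Rightarrow> 'e \<Rightarrow> 'e \<Rightarrow> real" +
  fixes \<Gamma> :: "'e \<Rightarrow> 'e \<Rightarrow> 'e \<Rightarrow> 'e"
  assumes \<Gamma>_eq: "\<Gamma> = christoffel_symbol \<gamma>"
begin

lemma koszul_linear:
  assumes "x \<in> U"
  shows "linear (koszul \<gamma> x u v)" "linear (\<lambda>u. koszul \<gamma> x u v z)" "linear (\<lambda>v. koszul \<gamma> x u v z)"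
  unfolding koszul_def[abs_def]
  using metric_fd_linear[OF assms] by (auto intro!: linear_compose_add linear_compose_sub)

lemma chr_sharp:
  assumes x: "x \<in> U"
  shows "\<Gamma> x u v = sharp x (\<lambda>z. koszul \<gamma> x u v z / 2)"
proof -
  have "(\<forall>z. 2 * \<gamma> x w z = koszul \<gamma> x u v z) = (\<forall>z. \<gamma> x w z = koszul \<gamma> x u v z / 2)" for w
    by (simp add: field_simps)
  then show ?thesis
    by (simp add: \<Gamma>_eq christoffel_symbol_def sharp_def)
qed

lemma linear_half: "linear f \<Longrightarrow> linear (\<lambda>z. f z / (2::real))"
  using linear_compose_scale_right[of f "1/2"] by simp

lemma chr_koszul:
  assumes x: "x \<in> U"
  shows "2 * \<gamma> x (\<Gamma> x u v) z = koszul \<gamma> x u v z"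
  unfolding chr_sharp[OF x] sharp[OF x linear_half[OF koszul_linear(1)[OF x]]] by simp

lemma chr_unique:
  assumes "x \<in> U" "\<And>z. 2 * \<gamma> x w z = koszul \<gamma> x u v z"
  shows "\<Gamma> x u v = w"
  using assms chr_koszul[OF assms(1), of u v] by (intro metric_eqI) (auto simp flip: assms(2))

lemma chr_sym: "x \<in> U \<Longrightarrow> \<Gamma> x u v = \<Gamma> x v u"
  by (rule chr_unique) (simp_all add: chr_koszul, simp add: koszul_def metric_fd_sym[of x u v])

lemma chr_lin1: "x \<in> U \<Longrightarrow> linear (\<lambda>u. \<Gamma> x u v)"
proof (rule linearI)
  fix u u' r
  assume x: "x \<in> U"
  note k = chr_koszul[OF x] linear_add[OF koszul_linear(2)[OF x]] linear_scale[OF koszul_linear(2)[OF x]]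
  show "\<Gamma> x (u + u') v = \<Gamma> x u v + \<Gamma> x u' v"
    by (rule chr_unique[OF x]) (simp add: metric_simps[OF x] k distrib_left)
  show "\<Gamma> x (r *\<^sub>R u) v = r *\<^sub>R \<Gamma> x u v"
    using k by (intro chr_unique[OF x]) (simp add: metric_simps[OF x] mult.left_commute)
qed

lemma chr_lin2: "x \<in> U \<Longrightarrow> linear (\<Gamma> x u)"
  using chr_lin1[of x u] chr_sym[of x] by (simp add: linear_iff)

lemma chr_simps:
  assumes "x \<in> U"
  shows "\<Gamma> x (u + v) w = \<Gamma> x u w + \<Gamma> x v w" "\<Gamma> x w (u + v) = \<Gamma> x w u + \<Gamma> x w v"
    "\<Gamma> x (u - v) w = \<Gamma> x u w - \<Gamma> x v w" "\<Gamma> x w (u - v) = \<Gamma> x w u - \<Gamma> x w v"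
    "\<Gamma> x (r *\<^sub>R u) w = r *\<^sub>R \<Gamma> x u w" "\<Gamma> x w (r *\<^sub>R u) = r *\<^sub>R \<Gamma> x w u"
    "\<Gamma> x (- u) w = - \<Gamma> x u w" "\<Gamma> x w (- u) = - \<Gamma> x w u"
    "\<Gamma> x 0 w = 0" "\<Gamma> x w 0 = 0"
  by (simp_all add: linear_add[OF chr_lin1] linear_add[OF chr_lin2] linear_diff[OF chr_lin1]
      linear_diff[OF chr_lin2] linear_scale[OF chr_lin1] linear_scale[OF chr_lin2]
      linear_neg[OF chr_lin1] linear_neg[OF chr_lin2] linear_0[OF chr_lin1] linear_0[OF chr_lin2] assms)

lemma smooth_chr: "smooth_on U (\<lambda>x. \<Gamma> x u v)"
proof (rule smooth_on_cong[OF open_U])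
  show "smooth_on U (\<lambda>x. sharp x (\<lambda>z. (1/2) *\<^sub>R koszul \<gamma> x u v z))"
  proof (rule smooth_sharp)
    show "linear (\<lambda>z. (1/2) *\<^sub>R koszul \<gamma> x u v z)" if "x \<in> U" for x
      using linear_half[OF koszul_linear(1)[OF that]] by simp
    show "smooth_on U (\<lambda>x. (1/2) *\<^sub>R koszul \<gamma> x u v z)" for z
      unfolding koszul_def
      by (intro smooth_on_scaleR smooth_on_const smooth_on_diff smooth_on_add open_U
          smooth_on_fd smooth_metric)
  qed
qed (simp add: chr_sharp)

lemma chr_differentiable: "x \<in> U \<Longrightarrow> (\<lambda>y. \<Gamma> y u v) differentiable (at x)"
  by (rule smooth_on_imp_differentiable[OF smooth_chr])

text \<open>Adding the Koszul formulas for the pairs \<open>(h, u)\<close> and \<open>(h, v)\<close> leaves only the derivative in the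
  direction \<open>h\<close>.\<close>

lemma metric_compat:
  assumes x: "x \<in> U"
  shows "fd (\<lambda>y. \<gamma> y u v) x h = \<gamma> x (\<Gamma> x h u) v + \<gamma> x u (\<Gamma> x h v)"
proof -
  have "2 * (\<gamma> x (\<Gamma> x h u) v + \<gamma> x u (\<Gamma> x h v)) = 2 * fd (\<lambda>y. \<gamma> y u v) x h"
    unfolding distrib_left sym[OF x, of u "\<Gamma> x h v"] chr_koszul[OF x]
    by (simp add: koszul_def metric_fd_sym[OF x, of u v] metric_fd_sym[OF x, of h v]
        metric_fd_sym[OF x, of h u])
  then show ?thesis
    by simp
qed

text \<open>Metric compatibility absorbs the derivative of the coefficients into Christoffel terms, so that a
  scalar product is differentiated covariantly in each factor.\<close>

lemma has_derivative_metric: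
  assumes x: "k p \<in> U" and k: "(k has_derivative k') (at p)" and f: "(f has_derivative f') (at p)"
    and l: "(l has_derivative l') (at p)"
  shows "((\<lambda>q. \<gamma> (k q) (f q) (l q)) has_derivative
    (\<lambda>h. \<gamma> (k p) (f' h + \<Gamma> (k p) (k' h) (f p)) (l p)
       + \<gamma> (k p) (f p) (l' h + \<Gamma> (k p) (k' h) (l p)))) (at p)"
proof -
  have "((\<lambda>q. \<gamma> (k q) (f q) (l q)) has_derivative
    (\<lambda>h. fd (\<lambda>y. \<gamma> y (f p) (l p)) (k p) (k' h) + \<gamma> (k p) (f' h) (l p) + \<gamma> (k p) (f p) (l' h))) (at p)"
    by (rule has_derivative_apply2[where \<phi> = \<gamma>, OF open_U x lin1 lin2 metric_differentiable[OF x] k f l])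
  then show ?thesis
    by (simp add: metric_compat[OF x] metric_simps[OF x] add.commute add.left_commute)
qed

lemma has_derivative_chr:
  assumes x: "k p \<in> U" and k: "(k has_derivative k') (at p)" and f: "(f has_derivative f') (at p)"
    and l: "(l has_derivative l') (at p)"
  shows "((\<lambda>q. \<Gamma> (k q) (f q) (l q)) has_derivative
    (\<lambda>h. fd (\<lambda>y. \<Gamma> y (f p) (l p)) (k p) (k' h) + \<Gamma> (k p) (f' h) (l p) + \<Gamma> (k p) (f p) (l' h))) (at p)"
  by (rule has_derivative_apply2[where \<phi> = \<Gamma>, OF open_U x chr_lin1 chr_lin2 chr_differentiable[OF x] k f l])

lemma chr_fd_sym: "x \<in> U \<Longrightarrow> fd (\<lambda>y. \<Gamma> y u v) x = fd (\<lambda>y. \<Gamma> y v u) x"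
  by (rule fd_cong[OF open_U]) (simp_all add: chr_sym)

definition curv :: "'e \<Rightarrow> 'e \<Rightarrow> 'e \<Rightarrow> 'e \<Rightarrow> 'e" where
  "curv x u v w = fd (\<lambda>y. \<Gamma> y v w) x u - fd (\<lambda>y. \<Gamma> y u w) x v + \<Gamma> x u (\<Gamma> x v w) - \<Gamma> x v (\<Gamma> x u w)"

end

text \<open>The second derivatives of the transition map enter the Koszul formula symmetrically, which
  leaves exactly one of them.\<close>

lemma chr_transform:
  assumes "local_connection U \<gamma> \<Gamma>" and "local_connection U' \<gamma>' \<Gamma>'"
    and W: "open W" "x \<in> W" "W \<subseteq> U" and T: "smooth_on W T" "T ` W \<subseteq> U'"
    and isometry: "\<And>y u v. y \<in> W \<Longrightarrow> \<gamma> y u v = \<gamma>' (T y) (fd T y u) (fd T y v)"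
    and surj: "surj (fd T x)"
  shows "fd T x (\<Gamma> x u v) = \<Gamma>' (T x) (fd T x u) (fd T x v) + fd (\<lambda>y. fd T y u) x v"
proof -
  interpret A: local_connection U \<gamma> \<Gamma> by fact
  interpret B: local_connection U' \<gamma>' \<Gamma>' by fact
  let ?D = "fd T x" and ?H = "\<lambda>u v. fd (\<lambda>y. fd T y u) x v"
  have x: "x \<in> U" and Tx: "T x \<in> U'"
    using W T by auto
  have dT: "(T has_derivative ?D) (at x)" and dDT: "((\<lambda>y. fd T y u) has_derivative ?H u) (at x)" for u
    using T(1) smooth_on_fd[OF T(1)] W(2) by (auto intro: has_derivative_fd smooth_on_imp_differentiable)
  have Hsym: "?H u v = ?H v u" for u v
    by (rule fd_commute[OF W(1,2) T(1)])
  have d\<gamma>: "fd (\<lambda>y. \<gamma> y u v) x h = fd (\<lambda>y. \<gamma>' y (?D u) (?D v)) (T x) (?D h)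
      + \<gamma>' (T x) (?H u h) (?D v) + \<gamma>' (T x) (?D u) (?H v h)" for u v h
  proof -
    have "((\<lambda>y. \<gamma>' (T y) (fd T y u) (fd T y v)) has_derivative
      (\<lambda>h. fd (\<lambda>y. \<gamma>' y (?D u) (?D v)) (T x) (?D h)
      + \<gamma>' (T x) (?H u h) (?D v) + \<gamma>' (T x) (?D u) (?H v h))) (at x)"
      by (rule has_derivative_apply2[where \<phi> = \<gamma>', OF B.open_U Tx B.lin1 B.lin2
            B.metric_differentiable[OF Tx] dT dDT dDT])
    then have "((\<lambda>y. \<gamma> y u v) has_derivative
      (\<lambda>h. fd (\<lambda>y. \<gamma>' y (?D u) (?D v)) (T x) (?D h)
      + \<gamma>' (T x) (?H u h) (?D v) + \<gamma>' (T x) (?D u) (?H v h))) (at x)"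
      by (rule has_derivative_transform_within_open[OF _ W(1,2)]) (simp add: isometry)
    then show ?thesis
      by (simp add: fd_eq)
  qed
  show ?thesis
  proof (rule B.metric_eqI[OF Tx])
    fix z'
    obtain z where z: "z' = ?D z"
      using surj by (metis surjD)
    have "2 * \<gamma>' (T x) (?D (\<Gamma> x u v)) (?D z) = koszul \<gamma> x u v z"
      using A.chr_koszul[OF x] isometry[OF W(2)] by simp
    also have "\<dots> = koszul \<gamma>' (T x) (?D u) (?D v) (?D z) + 2 * \<gamma>' (T x) (?H u v) (?D z)"
      unfolding koszul_def d\<gamma>
      by (simp add: Hsym[of v u] Hsym[of z v] Hsym[of z u] B.sym[OF Tx, of "?D u"] B.sym[OF Tx, of "?D v"])
    also have "\<dots> = 2 * \<gamma>' (T x) (\<Gamma>' (T x) (?D u) (?D v) + ?H u v) (?D z)"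
      by (simp add: B.chr_koszul[OF Tx] B.metric_simps[OF Tx] distrib_left flip: B.chr_koszul[OF Tx])
    finally show "\<gamma>' (T x) (?D (\<Gamma> x u v)) z' = \<gamma>' (T x) (\<Gamma>' (T x) (?D u) (?D v) + ?H u v) z'"
      by (simp add: z)
  qed
qed

section \<open>Bump functions\<close>

definition flat_exp :: "nat \<Rightarrow> real \<Rightarrow> real" where
  "flat_exp n t = (if t \<le> 0 then 0 else exp (- 1 / t) / t ^ n)"

lemma flat_exp_tendsto: "((\<lambda>t. flat_exp n t) \<longlongrightarrow> 0) (at 0)"
proof -
  have "((\<lambda>t. inverse t ^ n / exp (inverse t)) \<longlongrightarrow> 0) (at_right (0::real))"
    by (rule filterlim_compose[OF tendsto_power_div_exp_0 filterlim_inverse_at_top_right])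
  then have "((\<lambda>t. flat_exp n t) \<longlongrightarrow> 0) (at_right 0)"
    by (rule Lim_transform_eventually)
      (auto simp: flat_exp_def eventually_at_filter exp_minus divide_simps)
  moreover have "((\<lambda>t. flat_exp n t) \<longlongrightarrow> 0) (at_left 0)"
    by (rule tendsto_eventually) (auto simp: flat_exp_def eventually_at_filter)
  ultimately show ?thesis
    by (simp add: filterlim_split_at)
qed

text \<open>The derivative of a member of the family is a linear combination of members, which makes smoothness
  of the whole family a simple induction.\<close>

lemma flat_exp_has_derivative:
  "(flat_exp n has_real_derivative flat_exp (n + 2) t - n * flat_exp (n + 1) t) (at t)"
proof (cases t "0::real" rule: linorder_cases)
  case less
  have "((\<lambda>t. 0) has_real_derivative 0) (at t)" by simp
  then have "(flat_exp n has_real_derivative 0) (at t)"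
    by (rule has_field_derivative_transform_within_open[of _ _ _ "{..<0}"])
      (use less in \<open>auto simp: flat_exp_def\<close>)
  then show ?thesis
    using less by (simp add: flat_exp_def)
next
  case equal
  have "((\<lambda>h. (flat_exp n (0 + h) - flat_exp n 0) / h) \<longlongrightarrow> 0) (at 0)"
  proof (rule Lim_transform_eventually[OF flat_exp_tendsto])
    show "\<forall>\<^sub>F h in at 0. flat_exp (n + 1) h = (flat_exp n (0 + h) - flat_exp n 0) / h"
      by (auto simp: flat_exp_def eventually_at_filter field_simps)
  qed
  then show ?thesis
    using equal by (simp add: DERIV_def flat_exp_def)
next
  case greater
  have "((\<lambda>t. exp (- 1 / t) / t ^ n) has_real_derivative
      (exp (- 1 / t) * (1 / t\<^sup>2) * t ^ n - exp (- 1 / t) * (n * t ^ (n - 1))) / (t ^ n)\<^sup>2) (at t)"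
    using greater by (auto intro!: derivative_eq_intros simp: power2_eq_square)
  moreover have "(exp (- 1 / t) * (1 / t\<^sup>2) * t ^ n - exp (- 1 / t) * (n * t ^ (n - 1))) / (t ^ n)\<^sup>2
      = flat_exp (n + 2) t - n * flat_exp (n + 1) t"
    using greater by (cases n) (simp_all add: flat_exp_def field_simps power2_eq_square)
  ultimately have "((\<lambda>t. exp (- 1 / t) / t ^ n) has_real_derivative
      flat_exp (n + 2) t - n * flat_exp (n + 1) t) (at t)"
    by simp
  then show ?thesis
    by (rule has_field_derivative_transform_within_open[of _ _ _ "{0<..}"])
      (use greater in \<open>auto simp: flat_exp_def\<close>)
qed

lemma smooth_flat_exp: "smooth_on UNIV (flat_exp n)"
proof -
  have "Ck_on k UNIV (flat_exp n)" for k
  proof (induction k arbitrary: n)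
    case 0
    show ?case
      using flat_exp_has_derivative by (auto intro!: continuous_at_imp_continuous_on DERIV_isCont)
  next
    case (Suc k)
    show ?case
    proof (rule Ck_on_SucI)
      show "(flat_exp n has_derivative (\<lambda>v. v *\<^sub>R (flat_exp (n + 2) t + (- n) *\<^sub>R flat_exp (n + 1) t))) (at t)" for t
        using flat_exp_has_derivative[of n t] by (simp add: has_field_derivative_def mult.commute[of _ "_ - _"])
      show "Ck_on k UNIV (\<lambda>t. v *\<^sub>R (flat_exp (n + 2) t + (- n) *\<^sub>R flat_exp (n + 1) t))" for v
        by (intro Ck_on_bilinear[OF bounded_bilinear_scaleR] Ck_on_add Ck_on_const Suc.IH open_UNIV)
    qed simp
  qed
  then show ?thesis
    by (simp add: smooth_on_def)
qed

lemma bump_function: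
  fixes x0 :: "'e::euclidean_space"
  assumes "r > 0"
  obtains \<beta> :: "'e \<Rightarrow> real" where "smooth_on UNIV \<beta>" "\<beta> x0 = 1" "\<And>x. x \<notin> cball x0 r \<Longrightarrow> \<beta> x = 0"
proof
  let ?\<beta> = "\<lambda>x. (1 / flat_exp 0 (r\<^sup>2)) *\<^sub>R flat_exp 0 (r\<^sup>2 - (x - x0) \<bullet> (x - x0))"
  show "smooth_on UNIV ?\<beta>"
    by (intro smooth_on_scaleR smooth_on_const open_UNIV smooth_on_compose[OF _ _ smooth_flat_exp]
        smooth_on_diff smooth_on_bilinear[OF bounded_bilinear_inner] smooth_on_linear[OF bounded_linear_ident]) auto
  show "?\<beta> x0 = 1"
    using assms by (simp add: flat_exp_def)
  show "?\<beta> x = 0" if "x \<notin> cball x0 r" for x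
  proof -
    have "r\<^sup>2 \<le> (norm (x - x0))\<^sup>2"
      using that assms by (intro power_mono) (auto simp: dist_norm norm_minus_commute)
    then show ?thesis
      by (simp add: flat_exp_def power2_norm_eq_inner)
  qed
qed

section \<open>Extension of tangent vectors to vector fields\<close>

lemma openin_atlas_topology:
  assumes N: "smooth_manifold N"
  shows "openin (atlas_topology N) W \<longleftrightarrow> W \<subseteq> points N \<and>
    (\<forall>i\<in>index N. open (chart_map N i ` (W \<inter> chart_dom N i)))"
proof -
  have inj: "inj_on (chart_map N i) (chart_dom N i)" if "i \<in> index N" for i
    using N that by (simp add: smooth_manifold_def)
  have "istopology (\<lambda>W. W \<subseteq> points N \<and> (\<forall>i\<in>index N. open (chart_map N i ` (W \<inter> chart_dom N i))))"
    unfolding istopology_def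
  proof (intro conjI allI impI ballI; (elim conjE)?)
    fix S T i
    assume ST: "\<forall>i\<in>index N. open (chart_map N i ` (S \<inter> chart_dom N i))"
      "\<forall>i\<in>index N. open (chart_map N i ` (T \<inter> chart_dom N i))" and i: "i \<in> index N"
    have "chart_map N i ` (S \<inter> T \<inter> chart_dom N i)
        = chart_map N i ` (S \<inter> chart_dom N i) \<inter> chart_map N i ` (T \<inter> chart_dom N i)"
      using inj[OF i] by (auto simp: inj_on_def)
    then show "open (chart_map N i ` (S \<inter> T \<inter> chart_dom N i))"
      using ST i by auto
  next
    fix K i
    assume K: "\<forall>S\<in>K. S \<subseteq> points N \<and> (\<forall>i\<in>index N. open (chart_map N i ` (S \<inter> chart_dom N i)))"
      and i: "i \<in> index N"
    have "chart_map N i ` (\<Union>K \<inter> chart_dom N i) = (\<Union>S\<in>K. chart_map N i ` (S \<inter> chart_dom N i))"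
      by auto
    then show "open (chart_map N i ` (\<Union>K \<inter> chart_dom N i))"
      using K i by auto
  qed auto
  then show ?thesis
    by (simp add: atlas_topology_def)
qed

lemma chart_inv_in_dom:
  assumes "i \<in> index N" "x \<in> chart_img N i"
  shows "chart_inv N i x \<in> chart_dom N i" "chart_inv N i x \<in> points N"
  using chart_inv_charts_at[OF assms] assms(1) by (auto simp: charts_at_def points_def)

lemma chart_inv_chart_map:
  assumes "smooth_manifold N" "i \<in> charts_at N p"
  shows "chart_inv N i (chart_map N i p) = p"
  using assms by (simp add: smooth_manifold_def charts_at_def chart_inv_def)

lemma chart_map_in_img: "i \<in> charts_at N p \<Longrightarrow> chart_map N i p \<in> chart_img N i"
  by (simp add: charts_at_def chart_img_def)

lemma charts_at_index: "i \<in> charts_at N p \<Longrightarrow> i \<in> index N"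
  by (simp add: charts_at_def)

lemma charts_at_points: "i \<in> charts_at N p \<Longrightarrow> p \<in> points N"
  by (auto simp: charts_at_def points_def)

definition overlap :: "('i, 'a, 'e) atlas \<Rightarrow> 'i \<Rightarrow> 'i \<Rightarrow> 'e set" where
  "overlap N i j = chart_map N i ` (chart_dom N i \<inter> chart_dom N j)"

lemma overlap:
  assumes N: "smooth_manifold N" and i: "i \<in> index N" and j: "j \<in> index N"
  shows "open (overlap N i j)" "smooth_on (overlap N i j) (transition N i j)"
    "overlap N i j \<subseteq> chart_img N i" "transition N i j ` overlap N i j \<subseteq> overlap N j i"
    "\<And>x. x \<in> overlap N i j \<Longrightarrow> chart_inv N j (transition N i j x) = chart_inv N i x"
    "\<And>x. x \<in> overlap N i j \<Longrightarrow> i \<in> charts_at N (chart_inv N i x)"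
    "\<And>x. x \<in> overlap N i j \<Longrightarrow> j \<in> charts_at N (chart_inv N i x)"
    "\<And>x. x \<in> overlap N i j \<Longrightarrow> chart_map N i (chart_inv N i x) = x"
proof -
  have inj: "inj_on (chart_map N i) (chart_dom N i)" "inj_on (chart_map N j) (chart_dom N j)"
    using N i j by (simp_all add: smooth_manifold_def)
  show "open (overlap N i j)" "smooth_on (overlap N i j) (transition N i j)"
    using N i j by (simp_all add: smooth_manifold_def overlap_def)
  show "overlap N i j \<subseteq> chart_img N i"
    by (auto simp: overlap_def chart_img_def)
  show "transition N i j ` overlap N i j \<subseteq> overlap N j i"
    using inj by (auto simp: overlap_def transition_def chart_inv_def)
  show "chart_inv N j (transition N i j x) = chart_inv N i x"
    "i \<in> charts_at N (chart_inv N i x)" "j \<in> charts_at N (chart_inv N i x)"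
    "chart_map N i (chart_inv N i x) = x" if "x \<in> overlap N i j" for x
    using that inj i j by (auto simp: overlap_def transition_def chart_inv_def charts_at_def)
qed

lemma chart_map_in_overlap:
  "i \<in> charts_at N p \<Longrightarrow> j \<in> charts_at N p \<Longrightarrow> chart_map N i p \<in> overlap N i j"
  by (simp add: charts_at_def overlap_def)

lemma in_overlap:
  assumes "i \<in> index N" "x \<in> chart_img N i" "j \<in> charts_at N (chart_inv N i x)"
  shows "x \<in> overlap N i j"
  using chart_map_in_overlap[OF chart_inv_charts_at(1)[OF assms(1,2)] assms(3)]
    chart_inv_charts_at(2)[OF assms(1,2)] by simp

lemma topspace_atlas_topology:
  assumes N: "smooth_manifold N"
  shows "topspace (atlas_topology N) = points N"
proof -
  have "points N \<inter> chart_dom N j = chart_dom N j" if "j \<in> index N" for j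
    using that by (auto simp: points_def)
  then have "openin (atlas_topology N) (points N)"
    using open_chart_img[OF N] by (simp add: openin_atlas_topology[OF N] flip: chart_img_def)
  moreover have "topspace (atlas_topology N) \<subseteq> points N"
    using openin_topspace[of "atlas_topology N"] unfolding openin_atlas_topology[OF N] by blast
  ultimately show ?thesis
    using openin_subset by blast
qed

text \<open>In a Hausdorff space compact sets are closed. This is used for the support of a bump function, to
  extend by zero beyond the chart.\<close>

lemma compact_image_closedin:
  assumes N: "smooth_manifold N" and i: "i \<in> index N" and K: "compact K" "K \<subseteq> chart_img N i"
  shows "closedin (atlas_topology N) (chart_inv N i ` K)"
proof -
  have "continuous_map (top_of_set (chart_img N i)) (atlas_topology N) (chart_inv N i)"
    unfolding continuous_map_def
  proof (intro conjI allI impI)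
    show "chart_inv N i \<in> topspace (top_of_set (chart_img N i)) \<rightarrow> topspace (atlas_topology N)"
      using chart_inv_in_dom(2)[OF i] by (auto simp: topspace_atlas_topology[OF N])
    fix W
    assume "openin (atlas_topology N) W"
    then have "open (chart_map N i ` (W \<inter> chart_dom N i))"
      using i by (simp add: openin_atlas_topology[OF N])
    moreover have "{x \<in> chart_img N i. chart_inv N i x \<in> W} = chart_map N i ` (W \<inter> chart_dom N i)"
      using N i by (auto simp: chart_img_def chart_inv_def smooth_manifold_def)
    moreover have "{x \<in> chart_img N i. chart_inv N i x \<in> W} \<subseteq> chart_img N i"
      by blast
    ultimately show "openin (top_of_set (chart_img N i))
        {x \<in> topspace (top_of_set (chart_img N i)). chart_inv N i x \<in> W}"
      by (simp add: openin_open_eq[OF open_chart_img[OF N i]])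
  qed
  moreover have "compactin (top_of_set (chart_img N i)) K"
    using K by (simp add: compactin_subtopology)
  ultimately have "compactin (atlas_topology N) (chart_inv N i ` K)"
    by (rule image_compactin[rotated])
  then show ?thesis
    using N by (intro compactin_imp_closedin) (simp_all add: smooth_manifold_def)
qed

text \<open>A bump function times a field with constant components in one chart. Smoothness at the
  points outside that chart holds because the support is closed in the manifold, which is where the
  Hausdorff property enters.\<close>

lemma vector_field_extension:
  assumes N: "smooth_manifold N" and p: "i \<in> charts_at N p" and w: "w \<in> tangent_space N p"
  obtains X where "vector_field N X" "X p = w"
proof -
  note i = charts_at_index[OF p] and ci = chart_map_in_img[OF p]
  obtain r where r: "r > 0" "cball (chart_map N i p) r \<subseteq> chart_img N i"
    using open_chart_img[OF N i] ci open_contains_cball by blast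
  obtain \<beta> :: "_ \<Rightarrow> real" where \<beta>: "smooth_on UNIV \<beta>" "\<beta> (chart_map N i p) = 1"
    "\<And>x. x \<notin> cball (chart_map N i p) r \<Longrightarrow> \<beta> x = 0"
    using bump_function[OF r(1)] by blast
  define X where "X = (\<lambda>q. if q \<in> chart_dom N i then \<beta> (chart_map N i q) *\<^sub>R tvec_of N i q (w i) else 0)"
  define K where "K = chart_inv N i ` cball (chart_map N i p) r"
  have "vector_field N X"
    unfolding vector_field_def
  proof (intro conjI ballI)
    show "X q \<in> tangent_space N q" if "q \<in> points N" for q
    proof (cases "q \<in> chart_dom N i")
      case True
      then have "tvec_of N i q (w i) \<in> tangent_space N q"
        using i by (intro tvec_of_tangent_space[OF N]) (simp add: charts_at_def)
      then show ?thesis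
        using True by (simp add: X_def subspace_scale[OF subspace_tangent_space[OF N]])
    qed (simp add: X_def subspace_0[OF subspace_tangent_space[OF N]])
    fix j
    assume j: "j \<in> index N"
    show "smooth_on (chart_img N j) (vf_comp N X j)"
    proof (rule smooth_on_local)
      fix y
      assume y: "y \<in> chart_img N j"
      note o1 = overlap[OF N j i] and o2 = overlap[OF N i j]
      show "\<exists>T. open T \<and> y \<in> T \<and> smooth_on T (vf_comp N X j)"
      proof (cases "chart_inv N j y \<in> chart_dom N i")
        case True
        let ?T = "overlap N j i"
        have "smooth_on ?T (\<lambda>y. \<beta> (transition N j i y) *\<^sub>R fd (transition N i j) (transition N j i y) (w i))"
          by (rule smooth_on_compose[where h = "\<lambda>x. \<beta> x *\<^sub>R fd (transition N i j) x (w i)",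
                OF o1(1,4) _ o1(2)])
            (intro smooth_on_scaleR smooth_on_fd o2 smooth_on_subset[OF \<beta>(1)] subset_UNIV)
        then have "smooth_on ?T (vf_comp N X j)"
        proof (rule smooth_on_cong[OF o1(1)])
          fix y
          assume y: "y \<in> ?T"
          have t: "transition N j i y = chart_map N i (chart_inv N j y)"
            by (simp add: transition_def)
          show "\<beta> (transition N j i y) *\<^sub>R fd (transition N i j) (transition N j i y) (w i) = vf_comp N X j y"
            using o1(6,7)[OF y] by (simp add: t vf_comp_def X_def tvec_of_def charts_at_def)
        qed
        moreover have "y \<in> ?T"
          using True i by (intro in_overlap j y) (simp add: charts_at_def)
        ultimately show ?thesis
          using o1(1) by blast
      next
        case False
        let ?T = "chart_map N j ` ((points N - K) \<inter> chart_dom N j)"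
        have "K \<subseteq> chart_dom N i"
          using chart_inv_in_dom(1)[OF i] r(2) by (auto simp: K_def)
        have "closedin (atlas_topology N) K"
          unfolding K_def by (intro compact_image_closedin N i r) simp
        then have "openin (atlas_topology N) (topspace (atlas_topology N) - K)"
          by blast
        then have T: "open ?T"
          using j by (simp add: openin_atlas_topology[OF N] topspace_atlas_topology[OF N])
        have cj: "chart_inv N j y \<in> chart_dom N j" "chart_map N j (chart_inv N j y) = y"
          using chart_inv_charts_at[OF j y] by (auto simp: charts_at_def)
        have "chart_inv N j y \<in> (points N - K) \<inter> chart_dom N j"
          using False \<open>K \<subseteq> chart_dom N i\<close> chart_inv_in_dom[OF j y] by blast
        then have "y \<in> ?T"
          by (rule image_eqI[rotated]) (simp add: cj)
        moreover have "smooth_on ?T (vf_comp N X j)"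
        proof (rule smooth_on_cong[OF T smooth_on_const[of _ 0]])
          fix z
          assume "z \<in> ?T"
          then obtain q where q: "q \<notin> K" "q \<in> chart_dom N j" "z = chart_map N j q"
            by blast
          then have qz: "chart_inv N j z = q"
            using j by (intro chart_inv_chart_map[OF N, of j q, folded q(3)]) (simp add: charts_at_def)
          have "\<beta> (chart_map N i q) = 0" if "q \<in> chart_dom N i"
          proof (rule \<beta>(3), rule notI)
            assume "chart_map N i q \<in> cball (chart_map N i p) r"
            moreover have "chart_inv N i (chart_map N i q) = q"
              using that i by (intro chart_inv_chart_map[OF N]) (simp add: charts_at_def)
            ultimately show False
              using q(1) unfolding K_def by (metis image_eqI)
          qed
          then show "0 = vf_comp N X j z"
            by (simp add: vf_comp_def qz X_def)
        qed
        ultimately show ?thesis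
          using T by blast
      qed
    qed
  qed
  moreover have "X p = w"
    using p by (simp add: X_def \<beta>(2) tvec_of_eq[OF w p]) (simp add: charts_at_def)
  ultimately show ?thesis
    by (rule that)
qed

section \<open>Covariant derivatives in a chart\<close>

context local_connection
begin

text \<open>In components: covariant derivative and second covariant derivative of a vector field, and covariant
  derivative of an endomorphism field.\<close>

definition nab :: "('e \<Rightarrow> 'e) \<Rightarrow> 'e \<Rightarrow> 'e \<Rightarrow> 'e" where
  "nab F x h = fd F x h + \<Gamma> x h (F x)"

definition hess :: "('e \<Rightarrow> 'e) \<Rightarrow> 'e \<Rightarrow> 'e \<Rightarrow> 'e \<Rightarrow> 'e" where
  "hess F x h k = fd (\<lambda>y. nab F y k) x h + \<Gamma> x h (nab F x k) - nab F x (\<Gamma> x h k)"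

definition nab_end :: "('e \<Rightarrow> 'e \<Rightarrow> 'e) \<Rightarrow> 'e \<Rightarrow> 'e \<Rightarrow> 'e \<Rightarrow> 'e" where
  "nab_end S x h v = fd (\<lambda>y. S y v) x h + \<Gamma> x h (S x v) - S x (\<Gamma> x h v)"

lemma nab_linear: "x \<in> U \<Longrightarrow> F differentiable (at x) \<Longrightarrow> linear (nab F x)"
  unfolding nab_def[abs_def]
  by (intro linear_compose_add linear_frechet_derivative chr_lin1)

lemma nab_has_derivative:
  assumes F: "smooth_on U F" and x: "x \<in> U"
  shows "((\<lambda>y. nab F y k) has_derivative
    (\<lambda>h. fd (\<lambda>y. fd F y k) x h + (fd (\<lambda>y. \<Gamma> y k (F x)) x h + \<Gamma> x k (fd F x h)))) (at x)"
proof -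
  have "F differentiable (at x)" "(\<lambda>y. fd F y k) differentiable (at x)"
    using F smooth_on_fd[OF F] x by (auto intro: smooth_on_imp_differentiable)
  note d = this[THEN has_derivative_fd]
  show ?thesis
    unfolding nab_def
    using has_derivative_add[OF d(2) has_derivative_chr[where k = "\<lambda>y. y",
          OF x has_derivative_ident has_derivative_const[of k] d(1)]]
    by (simp add: chr_simps[OF x])
qed

lemma nab_differentiable: "smooth_on U F \<Longrightarrow> x \<in> U \<Longrightarrow> (\<lambda>y. nab F y k) differentiable (at x)"
  by (rule differentiableI[OF nab_has_derivative])

text \<open>The Ricci identity; second partial derivatives commute, and the Christoffel terms that survive are
  those of the curvature.\<close>

lemma hess_commutator:
  assumes F: "smooth_on U F" and x: "x \<in> U"
  shows "hess F x h k - hess F x k h = curv x h k (F x)"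
proof -
  have "hess F x h k = fd (\<lambda>y. fd F y k) x h + (fd (\<lambda>y. \<Gamma> y k (F x)) x h + \<Gamma> x k (fd F x h))
      + \<Gamma> x h (fd F x k) + \<Gamma> x h (\<Gamma> x k (F x)) - nab F x (\<Gamma> x h k)" for h k
    unfolding hess_def fd_eq[OF nab_has_derivative[OF F x]] by (simp add: nab_def chr_simps[OF x])
  moreover have "fd (\<lambda>y. fd F y k) x h = fd (\<lambda>y. fd F y h) x k"
    by (rule fd_commute[OF open_U x F])
  moreover have "\<Gamma> x k h = \<Gamma> x h k"
    by (rule chr_sym[OF x])
  ultimately show ?thesis
    by (simp add: curv_def)
qed

text \<open>\<open>\<nabla>\<^sub>h (\<nabla>\<^sub>Y F) = \<nabla>\<^sup>2F(h, Y) + \<nabla>\<^bsub>\<nabla>\<^sub>hY\<^esub> F\<close>: the derivatives of \<open>Y\<close> and the Christoffel symbols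
  combine to the covariant derivative of \<open>Y\<close>.\<close>

lemma nab_varying:
  assumes F: "smooth_on U F" and x: "x \<in> U" and Y: "Y differentiable (at x)"
  shows "nab (\<lambda>y. nab F y (Y y)) x h = hess F x h (Y x) + nab F x (nab Y x h)"
proof -
  have lin: "linear (nab F y)" if "y \<in> U" for y
    using that F by (intro nab_linear smooth_on_imp_differentiable[OF F])
  have "((\<lambda>y. nab F y (Y y)) has_derivative
      (\<lambda>h. fd (\<lambda>y. nab F y (Y x)) x h + nab F x (fd Y x h))) (at x)"
    by (rule has_derivative_apply[where k = "\<lambda>y. y" and \<phi> = "nab F",
          OF open_U x lin nab_differentiable[OF F x] has_derivative_ident has_derivative_fd[OF Y]])
  then have "nab (\<lambda>y. nab F y (Y y)) x h
      = fd (\<lambda>y. nab F y (Y x)) x h + nab F x (fd Y x h) + \<Gamma> x h (nab F x (Y x))"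
    by (simp add: nab_def[of "\<lambda>y. nab F y (Y y)"] fd_eq)
  then show ?thesis
    by (simp add: hess_def nab_def[of Y] linear_add[OF lin[OF x]])
qed

lemma nab_end_varying:
  assumes x: "x \<in> U" and S: "\<And>y. y \<in> U \<Longrightarrow> linear (S y)" "\<And>v. (\<lambda>y. S y v) differentiable (at x)"
    and Y: "Y differentiable (at x)"
  shows "nab (\<lambda>y. S y (Y y)) x h - S x (nab Y x h) = nab_end S x h (Y x)"
proof -
  have "((\<lambda>y. S y (Y y)) has_derivative (\<lambda>h. fd (\<lambda>y. S y (Y x)) x h + S x (fd Y x h))) (at x)"
    by (rule has_derivative_apply[where k = "\<lambda>y. y" and \<phi> = S,
          OF open_U x S has_derivative_ident has_derivative_fd[OF Y]])
  then show ?thesis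
    by (simp add: nab_def nab_end_def fd_eq linear_add[OF S(1)[OF x]])
qed

text \<open>The connection is torsion-free and metric, so partial derivatives in the Lie derivative of the metric
  may be replaced by covariant ones.\<close>

lemma lie_derivative_metric:
  assumes x: "x \<in> U"
  shows "fd (\<lambda>y. \<gamma> y u v) x (F x) + \<gamma> x (fd F x u) v + \<gamma> x u (fd F x v)
    = \<gamma> x (nab F x u) v + \<gamma> x u (nab F x v)"
  by (simp add: nab_def metric_compat[OF x] metric_simps[OF x] chr_sym[OF x, of "F x"])

lemma nab_cong:
  assumes "x \<in> U" "\<And>y. y \<in> U \<Longrightarrow> F y = F' y"
  shows "nab F x = nab F' x"
  using fd_cong[OF open_U assms] assms by (simp add: nab_def[abs_def])

lemma hess_cong:
  assumes x: "x \<in> U" and eq: "\<And>y. y \<in> U \<Longrightarrow> F y = F' y"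
  shows "hess F x = hess F' x"
proof -
  have "nab F y = nab F' y" if "y \<in> U" for y
    by (rule nab_cong[OF that eq])
  then show ?thesis
    using fd_cong[OF open_U x, of "\<lambda>y. nab F y k" "\<lambda>y. nab F' y k" for k] x
    by (simp add: hess_def[abs_def])
qed

text \<open>The identity is parallel.\<close>

lemma nab_end_add_scaleR:
  assumes x: "x \<in> U" and eq: "\<And>y v. y \<in> U \<Longrightarrow> S' y v = S y v + k *\<^sub>R v"
    and S: "\<And>v. (\<lambda>y. S y v) differentiable (at x)"
  shows "nab_end S' x h v = nab_end S x h v"
proof -
  have "fd (\<lambda>y. S' y v) x = fd (\<lambda>y. S y v + k *\<^sub>R v) x"
    by (rule fd_cong[OF open_U x]) (simp add: eq)
  also have "\<dots> = fd (\<lambda>y. S y v) x"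
    using fd_eq[OF has_derivative_add[OF has_derivative_fd[OF S] has_derivative_const]] by simp
  finally show ?thesis
    by (simp add: nab_end_def eq[OF x] chr_simps[OF x])
qed

section \<open>The Lie derivative of the metric of the tangent bundle\<close>

text \<open>A tangent vector \<open>W\<close> of the bundle at \<open>(x, u)\<close> is the sum of the horizontal lift of \<open>fst W\<close> and the
  vertical lift of \<open>vpart x u W\<close>. Then \<open>bundle_metric\<close> is \<open>a g\<^sup>s + b g\<^sup>h + c g\<^sup>v\<close>.\<close>

definition vpart :: "'e \<Rightarrow> 'e \<Rightarrow> 'e \<times> 'e \<Rightarrow> 'e" where
  "vpart x u W = snd W + \<Gamma> x u (fst W)"

definition bundle_metric :: "real \<Rightarrow> real \<Rightarrow> real \<Rightarrow> 'e \<Rightarrow> 'e \<Rightarrow> 'e \<times> 'e \<Rightarrow> 'e \<times> 'e \<Rightarrow> real" where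
  "bundle_metric a b c x u W W' = (a + c) * \<gamma> x (fst W) (fst W')
    + b * (\<gamma> x (fst W) (vpart x u W') + \<gamma> x (vpart x u W) (fst W'))
    + a * \<gamma> x (vpart x u W) (vpart x u W')"

text \<open>The covariant derivative of a vector field of the base that depends on the fibre variable as well,
  that is, of a section of the pullback of the tangent bundle to its own total space.\<close>

definition cov :: "('e \<times> 'e \<Rightarrow> 'e) \<Rightarrow> 'e \<Rightarrow> 'e \<Rightarrow> 'e \<times> 'e \<Rightarrow> 'e" where
  "cov F x u W = fd F (x, u) W + \<Gamma> x (fst W) (F (x, u))"

lemma vpart_linear: "x \<in> U \<Longrightarrow> linear (vpart x u)"
  unfolding vpart_def[abs_def]
  by (rule linearI) (simp_all add: chr_simps scaleR_add_right)

lemma vpart_has_derivative: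
  assumes x: "x \<in> U" and Z: "(Z has_derivative Z') (at (x, u))"
  shows "((\<lambda>q. vpart (fst q) (snd q) (Z q)) has_derivative
    (\<lambda>h. fd (\<lambda>y. \<Gamma> y u (fst (Z (x, u)))) x (fst h) + \<Gamma> x (snd h) (fst (Z (x, u)))
      + vpart x u (Z' h))) (at (x, u))"
proof -
  have "((\<lambda>q. snd (Z q) + \<Gamma> (fst q) (snd q) (fst (Z q))) has_derivative
    (\<lambda>h. snd (Z' h) + (fd (\<lambda>y. \<Gamma> y (snd (x, u)) (fst (Z (x, u)))) (fst (x, u)) (fst h)
      + \<Gamma> (fst (x, u)) (snd h) (fst (Z (x, u))) + \<Gamma> (fst (x, u)) (snd (x, u)) (fst (Z' h))))) (at (x, u))"
    by (intro has_derivative_add has_derivative_snd Z has_derivative_chr has_derivative_fst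
        has_derivative_ident) (simp add: x)
  then show ?thesis
    by (simp add: vpart_def add_ac)
qed

text \<open>The covariant Lie derivative of the tautological horizontal form is the covariant derivative
  of the horizontal part of \<open>Z\<close>. For the vertical form, commuting the derivatives along \<open>Z\<close> and \<open>W\<close>
  produces a curvature term, which vanishes here.\<close>

lemma cov_vpart:
  assumes x: "x \<in> U" and Z: "Z differentiable (at (x, u))" and flat: "\<And>h k w. curv x h k w = 0"
  defines "V \<equiv> \<lambda>q. vpart (fst q) (snd q) (Z q)"
  shows "cov V x u W = fd (\<lambda>q. vpart (fst q) (snd q) W) (x, u) (Z (x, u))
    + vpart x u (fd Z (x, u) W) + \<Gamma> x (fst (Z (x, u))) (vpart x u W)"
proof -
  let ?A = "fst (Z (x, u))" and ?B = "snd (Z (x, u))"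
  have dV: "fd V (x, u) W = fd (\<lambda>y. \<Gamma> y u ?A) x (fst W) + \<Gamma> x (snd W) ?A + vpart x u (fd Z (x, u) W)"
    unfolding V_def using fd_eq[OF vpart_has_derivative[OF x has_derivative_fd[OF Z]]] by simp
  have dK: "fd (\<lambda>q. vpart (fst q) (snd q) W) (x, u) (Z (x, u))
      = fd (\<lambda>y. \<Gamma> y u (fst W)) x ?A + \<Gamma> x ?B (fst W)"
    using fd_eq[OF vpart_has_derivative[OF x has_derivative_const[of W]]]
    by (simp add: linear_0[OF vpart_linear[OF x]])
  have "V (x, u) = ?B + \<Gamma> x u ?A" "vpart x u W = snd W + \<Gamma> x u (fst W)"
    by (simp_all add: V_def vpart_def)
  moreover have "fd (\<lambda>y. \<Gamma> y u ?A) x (fst W) + \<Gamma> x (fst W) (\<Gamma> x u ?A)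
      = fd (\<lambda>y. \<Gamma> y u (fst W)) x ?A + \<Gamma> x (\<Gamma> x u (fst W)) ?A"
    using flat[of ?A "fst W" u] unfolding curv_def
    by (simp add: chr_fd_sym[OF x, of u] chr_sym[OF x, of u] chr_sym[OF x, of "\<Gamma> x (fst W) u" ?A]
        algebra_simps)
  ultimately show ?thesis
    unfolding cov_def dV dK
    by (simp add: chr_simps[OF x] chr_sym[OF x, of "fst W" ?B] chr_sym[OF x, of ?A "snd W"]
        chr_sym[OF x, of ?A "\<Gamma> x u (fst W)"] algebra_simps)
qed

text \<open>With the covariant derivatives, the Lie derivative is computed as if the coefficients of the
  metric were constant. The combinations \<open>Q\<close> and \<open>N\<close> are the horizontal and vertical components of
  the one-form dual to \<open>Z\<close>; in terms of them the constants \<open>a\<close>, \<open>b\<close>, \<open>c\<close> disappear from the result.\<close>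

lemma lie_derivative_bundle_metric:
  fixes a b c :: real
  assumes x: "x \<in> U" and Z: "Z differentiable (at (x, u))" and flat: "\<And>h k w. curv x h k w = 0"
  defines "V \<equiv> \<lambda>q. vpart (fst q) (snd q) (Z q)"
  defines "Q \<equiv> \<lambda>q. (a + c) *\<^sub>R fst (Z q) + b *\<^sub>R V q" and "N \<equiv> \<lambda>q. b *\<^sub>R fst (Z q) + a *\<^sub>R V q"
  shows "fd (\<lambda>q. bundle_metric a b c (fst q) (snd q) W W') (x, u) (Z (x, u))
      + bundle_metric a b c x u (fd Z (x, u) W) W' + bundle_metric a b c x u W (fd Z (x, u) W')
    = \<gamma> x (cov Q x u W) (fst W') + \<gamma> x (cov N x u W) (vpart x u W')
      + \<gamma> x (fst W) (cov Q x u W') + \<gamma> x (vpart x u W) (cov N x u W')"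
proof -
  let ?A = "fst (Z (x, u))"
  let ?K = "\<lambda>W q. vpart (fst q) (snd q) W"
  let ?h = "\<lambda>W. \<Gamma> x ?A (fst W) + fst (fd Z (x, u) W)"
  let ?v = "\<lambda>W. fd (?K W) (x, u) (Z (x, u)) + \<Gamma> x ?A (vpart x u W) + vpart x u (fd Z (x, u) W)"
  have dK: "(?K W has_derivative fd (?K W) (x, u)) (at (x, u))" for W
    by (intro has_derivative_fd differentiableI[OF vpart_has_derivative[OF x has_derivative_const]])
  have dH: "((\<lambda>q. fst (Z q)) has_derivative (\<lambda>h. fst (fd Z (x, u) h))) (at (x, u))"
    by (intro has_derivative_fst has_derivative_fd Z)
  have dV: "(V has_derivative fd V (x, u)) (at (x, u))"
    unfolding V_def by (intro has_derivative_fd differentiableI[OF vpart_has_derivative[OF x has_derivative_fd[OF Z]]])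
  have covV: "cov V x u W = ?v W" for W
    unfolding V_def cov_vpart[OF x Z flat] by (simp add: add_ac)
  have covQ: "cov Q x u W = (a + c) *\<^sub>R ?h W + b *\<^sub>R ?v W" for W
  proof -
    have "fd Q (x, u) W = (a + c) *\<^sub>R fst (fd Z (x, u) W) + b *\<^sub>R fd V (x, u) W"
      unfolding Q_def
      by (subst fd_eq[OF has_derivative_add[OF has_derivative_scaleR_right[OF dH] has_derivative_scaleR_right[OF dV]]])
        simp
    then have "cov Q x u W = (a + c) *\<^sub>R ?h W + b *\<^sub>R cov V x u W"
      by (simp add: cov_def Q_def chr_simps[OF x] chr_sym[OF x, of "fst W" ?A] scaleR_add_right
          scaleR_add_left)
    then show ?thesis
      by (simp add: covV)
  qed
  have covN: "cov N x u W = b *\<^sub>R ?h W + a *\<^sub>R ?v W" for W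
  proof -
    have "fd N (x, u) W = b *\<^sub>R fst (fd Z (x, u) W) + a *\<^sub>R fd V (x, u) W"
      unfolding N_def
      by (subst fd_eq[OF has_derivative_add[OF has_derivative_scaleR_right[OF dH] has_derivative_scaleR_right[OF dV]]])
        simp
    then have "cov N x u W = b *\<^sub>R ?h W + a *\<^sub>R cov V x u W"
      by (simp add: cov_def N_def chr_simps[OF x] chr_sym[OF x, of "fst W" ?A] scaleR_add_right
          scaleR_add_left)
    then show ?thesis
      by (simp add: covV)
  qed
  have summand: "((\<lambda>q. \<gamma> (fst q) (f q) (l q)) has_derivative
      (\<lambda>h. \<gamma> x (f' h + \<Gamma> x (fst h) (f (x, u))) (l (x, u)) + \<gamma> x (f (x, u)) (l' h + \<Gamma> x (fst h) (l (x, u))))) (at (x, u))"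
    if "(f has_derivative f') (at (x, u))" "(l has_derivative l') (at (x, u))" for f f' l l'
    using has_derivative_metric[where k = fst and p = "(x, u)", OF _ has_derivative_fst[OF has_derivative_ident] that] x
    by simp
  \<comment> \<open>the four products of horizontal and vertical parts in the bundle metric\<close>
  note t = summand[OF has_derivative_const[of "fst W"] has_derivative_const[of "fst W'"]]
    summand[OF has_derivative_const[of "fst W"] dK[of W']]
    summand[OF dK[of W] has_derivative_const[of "fst W'"]] summand[OF dK[of W] dK[of W']]
  have "fd (\<lambda>q. bundle_metric a b c (fst q) (snd q) W W') (x, u) =
    (\<lambda>h. (a + c) * (\<gamma> x (0 + \<Gamma> x (fst h) (fst W)) (fst W') + \<gamma> x (fst W) (0 + \<Gamma> x (fst h) (fst W')))
    + b * ((\<gamma> x (0 + \<Gamma> x (fst h) (fst W)) (?K W' (x, u))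
        + \<gamma> x (fst W) (fd (?K W') (x, u) h + \<Gamma> x (fst h) (?K W' (x, u))))
      + (\<gamma> x (fd (?K W) (x, u) h + \<Gamma> x (fst h) (?K W (x, u))) (fst W')
        + \<gamma> x (?K W (x, u)) (0 + \<Gamma> x (fst h) (fst W'))))
    + a * (\<gamma> x (fd (?K W) (x, u) h + \<Gamma> x (fst h) (?K W (x, u))) (?K W' (x, u))
        + \<gamma> x (?K W (x, u)) (fd (?K W') (x, u) h + \<Gamma> x (fst h) (?K W' (x, u)))))"
    unfolding bundle_metric_def
    by (intro fd_eq has_derivative_add has_derivative_mult_right t)
  then show ?thesis
    unfolding covQ covN bundle_metric_def by (simp add: metric_simps[OF x] algebra_simps)
qed

section \<open>Solving the homothety equations\<close>

text \<open>Integrating along segments gives \<open>\<gamma> (f u - f u') (u - u') = k \<gamma> (u - u') (u - u')\<close>; polarising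
  this shows that \<open>f - f 0 - k\<close> has a formal adjoint, hence is linear.\<close>

lemma similarity_field_affine:
  assumes x: "x \<in> U" and der: "\<And>u. (f has_derivative f' u) (at u)"
    and eq: "\<And>u v. \<gamma> x (f' u v) v = k * \<gamma> x v v"
  shows "linear (\<lambda>u. f u - f 0)" "\<gamma> x (f u - f 0) w + \<gamma> x u (f w - f 0) = 2 * k * \<gamma> x u w"
proof -
  define F where "F = (\<lambda>u. f u - f 0 - k *\<^sub>R u)"
  have "\<gamma> x (f u - f u') (u - u') = k * \<gamma> x (u - u') (u - u')" for u u'
  proof -
    let ?d = "u - u'"
    let ?\<phi> = "\<lambda>t. \<gamma> x (f (u' + t *\<^sub>R ?d)) ?d"
    have "(?\<phi> has_derivative (\<lambda>s. s * (k * \<gamma> x ?d ?d))) (at t)" for t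
    proof -
      have "(?\<phi> has_derivative (\<lambda>s. \<gamma> x (f' (u' + t *\<^sub>R ?d) (0 + s *\<^sub>R ?d)) ?d)) (at t)"
        by (intro linear_imp_has_derivative[OF lin1[OF x], THEN has_derivative_compose[rotated]]
            has_derivative_compose[OF _ der] has_derivative_add has_derivative_const
            has_derivative_scaleR_left has_derivative_ident)
      then show ?thesis
        using linear_scale[OF has_derivative_linear[OF der]] by (simp add: metric_simps(5)[OF x] eq)
    qed
    from mvt_simple[of 0 1 ?\<phi>, OF zero_less_one has_derivative_at_withinI[OF this]] show ?thesis
      by (simp add: metric_simps(3)[OF x])
  qed
  then have F: "\<gamma> x (F u - F u') (u - u') = 0" for u u'
    by (simp add: F_def metric_simps[OF x] algebra_simps)
  have F0: "\<gamma> x (F u) u = 0" for u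
    using F[of u 0] by (simp add: F_def)
  have skew: "\<gamma> x (F u) w = - \<gamma> x (F w) u" for u w
    using F[of u w] F0[of u] F0[of w] by (simp add: metric_simps[OF x])
  have "linear F"
  proof (rule linearI; rule metric_eqI[OF x])
    fix u u' z r
    show "\<gamma> x (F (u + u')) z = \<gamma> x (F u + F u') z" "\<gamma> x (F (r *\<^sub>R u)) z = \<gamma> x (r *\<^sub>R F u) z"
      using skew[of "u + u'" z] skew[of "r *\<^sub>R u" z] skew[of u z] skew[of u' z]
      by (simp_all add: metric_simps[OF x])
  qed
  then have "linear (\<lambda>u. F u + k *\<^sub>R u)"
    by (intro linear_compose_add linear_compose_scale_right linear_ident)
  then show "linear (\<lambda>u. f u - f 0)"
    by (simp add: F_def)
  show "\<gamma> x (f u - f 0) w + \<gamma> x u (f w - f 0) = 2 * k * \<gamma> x u w"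
    using skew[of u w] sym[OF x, of u "f w - f 0"] sym[OF x, of w u]
    by (simp add: F_def metric_simps[OF x])
qed

text \<open>For a field that is affine in the fibre variable, the covariant derivative separates into the
  derivatives of the two coefficients and a purely vertical term.\<close>

lemma cov_affine:
  assumes x: "x \<in> U" and \<xi>: "\<xi> differentiable (at x)"
    and S: "\<And>y. y \<in> U \<Longrightarrow> linear (S y)" "\<And>v. (\<lambda>y. S y v) differentiable (at x)"
    and F: "\<And>y v. y \<in> U \<Longrightarrow> F (y, v) = \<xi> y + S y v"
  shows "cov F x u W = nab \<xi> x (fst W) + nab_end S x (fst W) u + S x (vpart x u W)"
proof -
  have "((\<lambda>q. \<xi> (fst q) + S (fst q) (snd q)) has_derivative
      (\<lambda>h. fd \<xi> x (fst h) + (fd (\<lambda>y. S y (snd (x, u))) (fst (x, u)) (fst h) + S (fst (x, u)) (snd h)))) (at (x, u))"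
  proof (intro has_derivative_add)
    show "((\<lambda>q. \<xi> (fst q)) has_derivative (\<lambda>h. fd \<xi> x (fst h))) (at (x, u))"
      using has_derivative_fd[OF \<xi>]
      by (intro has_derivative_compose[OF has_derivative_fst[OF has_derivative_ident]]) simp
    show "((\<lambda>q. S (fst q) (snd q)) has_derivative
      (\<lambda>h. fd (\<lambda>y. S y (snd (x, u))) (fst (x, u)) (fst h) + S (fst (x, u)) (snd h))) (at (x, u))"
      by (rule has_derivative_apply[where \<phi> = S, OF open_U _ S(1)])
        (auto simp: x S(2) intro: has_derivative_fst has_derivative_snd has_derivative_ident)
  qed
  then have "(F has_derivative (\<lambda>h. fd \<xi> x (fst h) + (fd (\<lambda>y. S y u) x (fst h) + S x (snd h)))) (at (x, u))"
    unfolding fst_conv snd_conv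
    by (rule has_derivative_transform_within_open[where s = "U \<times> UNIV"])
      (use x open_Times[OF open_U open_UNIV] in \<open>auto simp: F\<close>)
  then have "cov F x u W = fd \<xi> x (fst W) + (fd (\<lambda>y. S y u) x (fst W) + S x (snd W))
      + \<Gamma> x (fst W) (\<xi> x + S x u)"
    by (simp add: cov_def fd_eq F[OF x])
  then show ?thesis
    by (simp add: nab_def nab_end_def vpart_def chr_simps[OF x] linear_add[OF S(1)[OF x]]
        chr_sym[OF x, of "fst W" u])
qed

lemma metric_nab_end:
  assumes x: "x \<in> U" and S: "\<And>v. (\<lambda>y. S y v) differentiable (at x)"
  shows "((\<lambda>y. \<gamma> y (S y v) w) has_derivative
    (\<lambda>h. \<gamma> x (nab_end S x h v + S x (\<Gamma> x h v)) w + \<gamma> x (S x v) (\<Gamma> x h w))) (at x)"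
  using has_derivative_metric[where k = "\<lambda>y. y", OF x has_derivative_ident has_derivative_fd[OF S]
      has_derivative_const[of w]]
  by (simp add: nab_end_def)

text \<open>Endomorphisms whose symmetric part is a constant multiple of the identity have skew covariant
  derivative, since the metric and the identity are parallel.\<close>

lemma nab_end_skew:
  assumes x: "x \<in> U" and S: "\<And>v. (\<lambda>y. S y v) differentiable (at x)"
    and skew: "\<And>y v w. y \<in> U \<Longrightarrow> \<gamma> y (S y v) w + \<gamma> y v (S y w) = k * \<gamma> y v w"
  shows "\<gamma> x (nab_end S x h v) w + \<gamma> x v (nab_end S x h w) = 0"
proof -
  have "((\<lambda>y. \<gamma> y (S y v) w + \<gamma> y (S y w) v) has_derivative
    (\<lambda>h. \<gamma> x (nab_end S x h v + S x (\<Gamma> x h v)) w + \<gamma> x (S x v) (\<Gamma> x h w)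
      + (\<gamma> x (nab_end S x h w + S x (\<Gamma> x h w)) v + \<gamma> x (S x w) (\<Gamma> x h v)))) (at x)"
    by (intro has_derivative_add metric_nab_end x S)
  moreover have "((\<lambda>y. \<gamma> y (S y v) w + \<gamma> y (S y w) v) has_derivative
    (\<lambda>h. k * (\<gamma> x (0 + \<Gamma> x h v) w + \<gamma> x v (0 + \<Gamma> x h w)))) (at x)"
  proof (rule has_derivative_transform_within_open[OF _ open_U x])
    show "((\<lambda>y. k * \<gamma> y v w) has_derivative
        (\<lambda>h. k * (\<gamma> x (0 + \<Gamma> x h v) w + \<gamma> x v (0 + \<Gamma> x h w)))) (at x)"
      by (intro has_derivative_mult_right has_derivative_metric[where k = "\<lambda>y. y"] x
          has_derivative_ident has_derivative_const)
    show "k * \<gamma> y v w = \<gamma> y (S y v) w + \<gamma> y (S y w) v" if "y \<in> U" for y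
      using skew[OF that, of v w] sym[OF that, of v "S y w"] by simp
  qed
  ultimately have "\<gamma> x (nab_end S x h v + S x (\<Gamma> x h v)) w + \<gamma> x (S x v) (\<Gamma> x h w)
      + (\<gamma> x (nab_end S x h w + S x (\<Gamma> x h w)) v + \<gamma> x (S x w) (\<Gamma> x h v))
      = k * (\<gamma> x (0 + \<Gamma> x h v) w + \<gamma> x v (0 + \<Gamma> x h w))"
    by (rule has_derivative_unique[THEN fun_cong])
  then show ?thesis
    using skew[OF x, of "\<Gamma> x h v" w] skew[OF x, of v "\<Gamma> x h w"] sym[OF x]
    by (simp add: metric_simps[OF x] distrib_left)
qed

text \<open>The endomorphism \<open>T - k\<close> is the negative adjoint of \<open>nab \<xi>\<close>, so its covariant derivative is
  the negative adjoint of the second covariant derivative of \<open>\<xi>\<close>.\<close>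

lemma nab_end_adjoint:
  assumes x: "x \<in> U" and \<xi>: "smooth_on U \<xi>" and T: "\<And>v. (\<lambda>y. T y v) differentiable (at x)"
    and adj: "\<And>y v z. y \<in> U \<Longrightarrow> \<gamma> y (T y v) z = k * \<gamma> y v z - \<gamma> y v (nab \<xi> y z)"
  shows "\<gamma> x (nab_end T x h v) z = - \<gamma> x v (hess \<xi> x h z)"
proof -
  have "((\<lambda>y. \<gamma> y (T y v) z) has_derivative
    (\<lambda>h. \<gamma> x (nab_end T x h v + T x (\<Gamma> x h v)) z + \<gamma> x (T x v) (\<Gamma> x h z))) (at x)"
    by (rule metric_nab_end[OF x T])
  moreover have "((\<lambda>y. \<gamma> y (T y v) z) has_derivative
    (\<lambda>h. k * (\<gamma> x (0 + \<Gamma> x h v) z + \<gamma> x v (0 + \<Gamma> x h z))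
      - (\<gamma> x (0 + \<Gamma> x h v) (nab \<xi> x z)
        + \<gamma> x v (fd (\<lambda>y. nab \<xi> y z) x h + \<Gamma> x h (nab \<xi> x z))))) (at x)"
  proof (rule has_derivative_transform_within_open[OF _ open_U x])
    show "((\<lambda>y. k * \<gamma> y v z - \<gamma> y v (nab \<xi> y z)) has_derivative
      (\<lambda>h. k * (\<gamma> x (0 + \<Gamma> x h v) z + \<gamma> x v (0 + \<Gamma> x h z))
      - (\<gamma> x (0 + \<Gamma> x h v) (nab \<xi> x z)
        + \<gamma> x v (fd (\<lambda>y. nab \<xi> y z) x h + \<Gamma> x h (nab \<xi> x z))))) (at x)"
      by (intro has_derivative_diff has_derivative_mult_right has_derivative_metric[where k = "\<lambda>y. y"] x
          has_derivative_ident has_derivative_const has_derivative_fd nab_differentiable[OF \<xi>])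
  qed (simp add: adj)
  ultimately have "\<gamma> x (nab_end T x h v + T x (\<Gamma> x h v)) z + \<gamma> x (T x v) (\<Gamma> x h z)
      = k * (\<gamma> x (0 + \<Gamma> x h v) z + \<gamma> x v (0 + \<Gamma> x h z))
      - (\<gamma> x (0 + \<Gamma> x h v) (nab \<xi> x z) + \<gamma> x v (fd (\<lambda>y. nab \<xi> y z) x h + \<Gamma> x h (nab \<xi> x z)))"
    by (rule has_derivative_unique[THEN fun_cong])
  then show ?thesis
    by (simp add: hess_def metric_simps[OF x] adj[OF x] algebra_simps)
qed

definition homothety_system :: "real \<Rightarrow> real \<Rightarrow> real \<Rightarrow> real \<Rightarrow> ('e \<times> 'e \<Rightarrow> 'e) \<Rightarrow> ('e \<times> 'e \<Rightarrow> 'e) \<Rightarrow> bool"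
  where "homothety_system a b c \<mu> N Q \<longleftrightarrow> (\<forall>x\<in>U. \<forall>u W W'.
    \<gamma> x (cov Q x u W) (fst W') + \<gamma> x (cov N x u W) (vpart x u W')
      + \<gamma> x (fst W) (cov Q x u W') + \<gamma> x (vpart x u W) (cov N x u W')
    = 2 * \<mu> * bundle_metric a b c x u W W')"

text \<open>For affine \<open>N\<close> and \<open>Q\<close> the equation splits by type. The horizontal part holds by \<open>\<zeta>_eq\<close> and, in the
  terms linear in \<open>u\<close>, by \<open>\<xi>_eq\<close>; the mixed part by \<open>T_eq\<close> and \<open>S_parallel\<close>; the vertical part by \<open>S_eq\<close>.\<close>

lemma homothety_system_converse:
  assumes \<xi>: "smooth_on U \<xi>" and \<zeta>: "\<And>x. x \<in> U \<Longrightarrow> \<zeta> differentiable (at x)"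
    and S: "\<And>x. x \<in> U \<Longrightarrow> linear (S x)" "\<And>x v. x \<in> U \<Longrightarrow> (\<lambda>y. S y v) differentiable (at x)"
    and T: "\<And>x. x \<in> U \<Longrightarrow> linear (T x)" "\<And>x v. x \<in> U \<Longrightarrow> (\<lambda>y. T y v) differentiable (at x)"
    and N: "\<And>x u. x \<in> U \<Longrightarrow> N (x, u) = \<xi> x + S x u" and Q: "\<And>x u. x \<in> U \<Longrightarrow> Q (x, u) = \<zeta> x + T x u"
    and \<zeta>_eq: "\<And>x v w. x \<in> U \<Longrightarrow> \<gamma> x (nab \<zeta> x v) w + \<gamma> x v (nab \<zeta> x w) = 2 * \<mu> * (a + c) * \<gamma> x v w"
    and S_eq: "\<And>x v w. x \<in> U \<Longrightarrow> \<gamma> x (S x v) w + \<gamma> x v (S x w) = 2 * \<mu> * a * \<gamma> x v w"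
    and S_parallel: "\<And>x h v. x \<in> U \<Longrightarrow> nab_end S x h v = 0"
    and T_eq: "\<And>x v w. x \<in> U \<Longrightarrow> \<gamma> x (T x v) w = 2 * \<mu> * b * \<gamma> x v w - \<gamma> x v (nab \<xi> x w)"
    and \<xi>_eq: "\<And>x v w. x \<in> U \<Longrightarrow> hess \<xi> x v w + hess \<xi> x w v = 0"
  shows "homothety_system a b c \<mu> N Q"
  unfolding homothety_system_def
proof (intro ballI allI)
  fix x u W W'
  assume x: "x \<in> U"
  let ?X = "fst W" and ?X' = "fst W'" and ?K = "vpart x u W" and ?K' = "vpart x u W'"
  have covN: "cov N x u W = nab \<xi> x (fst W) + S x (vpart x u W)" for W
    using cov_affine[of x \<xi> S N u W] x S N S_parallel smooth_on_imp_differentiable[OF \<xi>] by simp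
  have covQ: "cov Q x u W = nab \<zeta> x (fst W) + nab_end T x (fst W) u + T x (vpart x u W)" for W
    by (rule cov_affine[OF x \<zeta>[OF x] T(1) T(2)[OF x] Q])
  have "\<gamma> x (nab_end T x ?X u) ?X' + \<gamma> x ?X (nab_end T x ?X' u) = - \<gamma> x u (hess \<xi> x ?X ?X' + hess \<xi> x ?X' ?X)"
    using nab_end_adjoint[where k = "2 * \<mu> * b", OF x \<xi> T(2)[OF x] T_eq] sym[OF x, of ?X]
    by (simp add: metric_simps[OF x])
  then have h: "\<gamma> x (nab_end T x ?X u) ?X' + \<gamma> x ?X (nab_end T x ?X' u) = 0"
    by (simp add: \<xi>_eq[OF x] metric_simps[OF x])
  have "\<gamma> x (cov Q x u W) ?X' + \<gamma> x (cov N x u W) ?K' + \<gamma> x ?X (cov Q x u W') + \<gamma> x ?K (cov N x u W')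
    = (\<gamma> x (nab \<zeta> x ?X) ?X' + \<gamma> x ?X (nab \<zeta> x ?X')) + (\<gamma> x (S x ?K) ?K' + \<gamma> x ?K (S x ?K'))
      + (\<gamma> x (T x ?K) ?X' + \<gamma> x ?K (nab \<xi> x ?X')) + (\<gamma> x (T x ?K') ?X + \<gamma> x ?K' (nab \<xi> x ?X))
      + (\<gamma> x (nab_end T x ?X u) ?X' + \<gamma> x ?X (nab_end T x ?X' u))"
    unfolding covN covQ
    by (simp add: metric_simps[OF x] sym[OF x, of ?X "T x ?K'"] sym[OF x, of "nab \<xi> x ?X" ?K'])
  also have "\<dots> = 2 * \<mu> * bundle_metric a b c x u W W'"
    unfolding h \<zeta>_eq[OF x] S_eq[OF x] T_eq[OF x]
    by (simp add: bundle_metric_def sym[OF x, of ?K' ?X] algebra_simps)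
  finally show "\<gamma> x (cov Q x u W) ?X' + \<gamma> x (cov N x u W) ?K' + \<gamma> x ?X (cov Q x u W') + \<gamma> x ?K (cov N x u W')
    = 2 * \<mu> * bundle_metric a b c x u W W'" .
qed

lemma smooth_slice:
  assumes "smooth_on (U \<times> UNIV) F"
  shows "smooth_on U (\<lambda>x. F (x, u))"
proof (rule smooth_on_compose[OF open_U _ assms])
  have "smooth_on U (\<lambda>x. (x, 0) + (0, u))"
    by (intro smooth_on_add open_U smooth_on_const smooth_on_linear bounded_linear_Pair
        bounded_linear_ident bounded_linear_zero)
  then show "smooth_on U (\<lambda>x. (x, u))"
    by simp
qed auto

lemma fibre_derivative:
  assumes x: "x \<in> U" and F: "F differentiable (at (x, u))"
  shows "((\<lambda>v. F (x, v)) has_derivative (\<lambda>v. fd F (x, u) (0, v))) (at u)"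
  using has_derivative_compose[OF has_derivative_Pair[OF has_derivative_const[of x] has_derivative_ident]
      has_derivative_fd[OF F]] by simp

lemma cov_vertical: "x \<in> U \<Longrightarrow> cov F x u (0, v) = fd F (x, u) (0, v)"
  by (simp add: cov_def chr_simps)

lemma vpart_simps:
  "x \<in> U \<Longrightarrow> vpart x u (0, v) = v" "x \<in> U \<Longrightarrow> vpart x u (h, - \<Gamma> x u h) = 0"
  by (simp_all add: vpart_def chr_simps)

lemma smooth_vpart:
  assumes Z: "smooth_on (U \<times> UNIV) Z"
  shows "smooth_on (U \<times> UNIV) (\<lambda>q. vpart (fst q) (snd q) (Z q))"
proof -
  let ?S = "U \<times> (UNIV :: 'e set)"
  have o: "open ?S"
    by (intro open_Times open_U open_UNIV)
  have c: "smooth_on ?S (\<lambda>q. \<Gamma> (fst q) u v)" for u v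
    by (rule smooth_on_compose[where f = fst and h = "\<lambda>x. \<Gamma> x u v",
          OF o _ smooth_chr smooth_on_linear[OF bounded_linear_fst]]) auto
  have d: "smooth_on ?S (\<lambda>q. \<Gamma> (fst q) (snd q) v)" for v
    by (rule smooth_on_apply[where \<phi> = "\<lambda>q u. \<Gamma> (fst q) u v", OF o chr_lin1 c
          smooth_on_linear[OF bounded_linear_snd]]) (simp add: mem_Times_iff)
  have "smooth_on ?S (\<lambda>q. \<Gamma> (fst q) (snd q) (fst (Z q)))"
    by (rule smooth_on_apply[where \<phi> = "\<lambda>q. \<Gamma> (fst q) (snd q)", OF o chr_lin2 d
          smooth_on_compose[OF o subset_UNIV smooth_on_linear[OF bounded_linear_fst] Z]])
      (simp add: mem_Times_iff)
  then show ?thesis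
    unfolding vpart_def
    by (intro smooth_on_add o smooth_on_compose[OF o subset_UNIV smooth_on_linear[OF bounded_linear_snd] Z])
qed

text \<open>Conversely, a solution of the system is affine in the fibre variable. Its coefficients are read off
  at the zero section.\<close>

context
  fixes a b c \<mu> :: real and N Q :: "'e \<times> 'e \<Rightarrow> 'e"
  assumes smooth_N: "smooth_on (U \<times> UNIV) N" and smooth_Q: "smooth_on (U \<times> UNIV) Q"
    and system: "homothety_system a b c \<mu> N Q"
begin

private definition \<xi> where "\<xi> = (\<lambda>x. N (x, 0))"
private definition \<zeta> where "\<zeta> = (\<lambda>x. Q (x, 0))"
private definition S where "S = (\<lambda>x u. N (x, u) - N (x, 0))"
private definition T where "T = (\<lambda>x u. Q (x, u) - Q (x, 0))"

lemma system_diff: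
  assumes "x \<in> U"
  shows "N differentiable (at (x, u))" "Q differentiable (at (x, u))"
    "\<xi> differentiable (at x)" "\<zeta> differentiable (at x)"
    "(\<lambda>y. S y u) differentiable (at x)" "(\<lambda>y. T y u) differentiable (at x)"
proof -
  show "N differentiable (at (x, u))" "Q differentiable (at (x, u))"
    using assms smooth_N smooth_Q by (auto intro: smooth_on_imp_differentiable)
  have "(\<lambda>y. N (y, u)) differentiable (at x)" "(\<lambda>y. Q (y, u)) differentiable (at x)" for u
    using assms by (auto intro: smooth_on_imp_differentiable smooth_slice smooth_N smooth_Q)
  then show "\<xi> differentiable (at x)" "\<zeta> differentiable (at x)"
    "(\<lambda>y. S y u) differentiable (at x)" "(\<lambda>y. T y u) differentiable (at x)"
    unfolding \<xi>_def \<zeta>_def S_def T_def by (auto intro: differentiable_diff)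
qed

text \<open>On vertical vectors the system says that \<open>N\<close>, restricted to a fibre, is an infinitesimal similarity of
  a Euclidean space.\<close>

lemma S_solution:
  assumes x: "x \<in> U"
  shows "linear (S x)" "\<gamma> x (S x v) w + \<gamma> x v (S x w) = 2 * \<mu> * a * \<gamma> x v w"
proof -
  have "\<gamma> x (fd N (x, u) (0, v)) v = (\<mu> * a) * \<gamma> x v v" for u v
    using system[unfolded homothety_system_def, rule_format, OF x, of u "(0, v)" "(0, v)"]
    by (simp add: cov_vertical[OF x] vpart_simps[OF x] bundle_metric_def metric_simps[OF x]
        sym[OF x, of v "fd N (x, u) (0, v)"])
  note * = similarity_field_affine[where f = "\<lambda>u. N (x, u)", OF x
      fibre_derivative[OF x system_diff(1)[OF x]] this]
  show "linear (S x)" "\<gamma> x (S x v) w + \<gamma> x v (S x w) = 2 * \<mu> * a * \<gamma> x v w"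
    using * by (simp_all add: S_def)
qed

lemma cov_N: "x \<in> U \<Longrightarrow> cov N x u W = nab \<xi> x (fst W) + nab_end S x (fst W) u + S x (vpart x u W)"
  by (rule cov_affine) (use system_diff S_solution in \<open>auto simp: \<xi>_def S_def\<close>)

text \<open>The mixed equation determines the fibre derivative of \<open>Q\<close> up to the covariant derivative of
  \<open>S\<close>. The latter is skew, so it drops out along rays; integrating along rays shows that \<open>Q\<close> is
  affine without it, and therefore it vanishes.\<close>

lemma T_solution:
  assumes x: "x \<in> U"
  shows "linear (T x)" "\<gamma> x (T x v) w = 2 * \<mu> * b * \<gamma> x v w - \<gamma> x v (nab \<xi> x w)"
    and "nab_end S x h v = 0"
proof -
  \<comment> \<open>\<open>(h, - \<Gamma> x u h)\<close> is the horizontal lift of \<open>h\<close> to \<open>(x, u)\<close>\<close>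
  have mixed: "\<gamma> x h (fd Q (x, u) (0, w)) = 2 * \<mu> * b * \<gamma> x h w - \<gamma> x (nab \<xi> x h + nab_end S x h u) w" for h u w
    using system[unfolded homothety_system_def, rule_format, OF x, of u "(h, - \<Gamma> x u h)" "(0, w)"]
    by (simp add: cov_vertical[OF x] vpart_simps[OF x] bundle_metric_def metric_simps[OF x]
        cov_N[OF x] linear_0[OF S_solution(1)[OF x]])
  have skew: "\<gamma> x (nab_end S x h u) u = 0" for h u
    using nab_end_skew[where k = "2 * \<mu> * a", OF x system_diff(5)[OF x] S_solution(2), of h u u]
      sym[OF x, of u] by simp
  have T: "\<gamma> x h (T x u) = 2 * \<mu> * b * \<gamma> x h u - \<gamma> x (nab \<xi> x h) u" for h u
  proof -
    let ?\<phi> = "\<lambda>t. \<gamma> x h (Q (x, t *\<^sub>R u))"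
    have "(?\<phi> has_derivative (\<lambda>s. s * (2 * \<mu> * b * \<gamma> x h u - \<gamma> x (nab \<xi> x h) u))) (at t)" for t
    proof -
      have "(?\<phi> has_derivative (\<lambda>s. \<gamma> x h (fd Q (x, t *\<^sub>R u) (0, s *\<^sub>R u)))) (at t)"
        by (intro linear_imp_has_derivative[OF lin2[OF x], THEN has_derivative_compose[rotated]]
            has_derivative_compose[OF _ fibre_derivative[OF x system_diff(2)[OF x]]]
            has_derivative_scaleR_left has_derivative_ident)
      then show ?thesis
        unfolding mixed using nab_end_skew[where k = "2 * \<mu> * a", OF x system_diff(5)[OF x] S_solution(2), of h "t *\<^sub>R u" u]
        skew[of h u]
        by (simp add: metric_simps[OF x] sym[OF x, of u "nab_end S x h u"] algebra_simps)
    qed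
    from mvt_simple[of 0 1 ?\<phi>, OF zero_less_one has_derivative_at_withinI[OF this]] show ?thesis
      by (simp add: T_def metric_simps[OF x])
  qed
  show lin: "linear (T x)"
  proof (rule linearI; rule metric_eqI[OF x])
    fix u u' z r
    show "\<gamma> x (T x (u + u')) z = \<gamma> x (T x u + T x u') z" "\<gamma> x (T x (r *\<^sub>R u)) z = \<gamma> x (r *\<^sub>R T x u) z"
      unfolding sym[OF x, of _ z] by (simp_all add: T metric_simps[OF x] algebra_simps)
  qed
  show "\<gamma> x (T x v) w = 2 * \<mu> * b * \<gamma> x v w - \<gamma> x v (nab \<xi> x w)" for v w
    using T[of w v] sym[OF x] by simp
  show "nab_end S x h v = 0" for h v
  proof (rule metric_eqI[OF x])
    fix w
    have "((\<lambda>v. Q (x, v)) has_derivative T x) (at v)"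
    proof -
      have "((\<lambda>v. T x v + Q (x, 0)) has_derivative (\<lambda>v. T x v + 0)) (at v)"
        by (intro has_derivative_add linear_imp_has_derivative lin has_derivative_const)
      then show ?thesis
        by (simp add: T_def)
    qed
    then have "fd Q (x, v) (0, w) = T x w"
      using fibre_derivative[OF x system_diff(2)[OF x]] by (rule has_derivative_unique[THEN fun_cong, symmetric])
    then show "\<gamma> x (nab_end S x h v) w = \<gamma> x 0 w"
      using mixed[of h v w] T[of h w] by (simp add: metric_simps[OF x])
  qed
qed

text \<open>The horizontal equation is affine in \<open>u\<close>. Its value at \<open>u = 0\<close> concerns \<open>\<zeta>\<close>; the rest concerns the
  covariant derivative of \<open>T\<close>, that is, the second covariant derivative of \<open>\<xi>\<close>.\<close>

lemma \<zeta>_\<xi>_solution: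
  assumes x: "x \<in> U"
  shows "\<gamma> x (nab \<zeta> x v) w + \<gamma> x v (nab \<zeta> x w) = 2 * \<mu> * (a + c) * \<gamma> x v w"
    and "hess \<xi> x v w + hess \<xi> x w v = 0"
proof -
  have covQ: "cov Q x u W = nab \<zeta> x (fst W) + nab_end T x (fst W) u + T x (vpart x u W)" for u W
    by (rule cov_affine) (use x system_diff T_solution in \<open>auto simp: \<zeta>_def T_def\<close>)
  have hor: "\<gamma> x (nab \<zeta> x v + nab_end T x v u) w + \<gamma> x v (nab \<zeta> x w + nab_end T x w u) = 2 * \<mu> * (a + c) * \<gamma> x v w" for u v w
    using system[unfolded homothety_system_def, rule_format, OF x, of u "(v, - \<Gamma> x u v)" "(w, - \<Gamma> x u w)"]
    by (simp add: vpart_simps[OF x] bundle_metric_def metric_simps[OF x] covQ linear_0[OF T_solution(1)[OF x]])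
  have "nab_end T x h 0 = 0" for h
  proof -
    have "fd (\<lambda>y. T y 0) x h = 0"
      by (simp add: T_def)
    then show ?thesis
      by (simp add: nab_end_def linear_0[OF T_solution(1)[OF x]] chr_simps[OF x])
  qed
  then show \<zeta>: "\<gamma> x (nab \<zeta> x v) w + \<gamma> x v (nab \<zeta> x w) = 2 * \<mu> * (a + c) * \<gamma> x v w" for v w
    using hor[of v 0 w] by simp
  have sm: "smooth_on U \<xi>"
    unfolding \<xi>_def by (rule smooth_slice[OF smooth_N])
  show "hess \<xi> x v w + hess \<xi> x w v = 0"
  proof (rule metric_eqI[OF x])
    fix u
    note adj = nab_end_adjoint[where k = "2 * \<mu> * b", OF x sm system_diff(6)[OF x] T_solution(2)]
    have "\<gamma> x (nab_end T x v u) w + \<gamma> x v (nab_end T x w u) = 0"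
      using hor[of v u w] \<zeta>[of v w] by (simp add: metric_simps[OF x])
    then have "\<gamma> x u (hess \<xi> x v w) + \<gamma> x u (hess \<xi> x w v) = 0"
      using sym[OF x, of v] by (simp add: adj)
    then show "\<gamma> x (hess \<xi> x v w + hess \<xi> x w v) u = \<gamma> x 0 u"
      unfolding sym[OF x, of _ u] by (simp add: metric_simps[OF x])
  qed
qed

lemmas homothety_system_solution =
  S_solution[unfolded S_def] T_solution[unfolded S_def T_def \<xi>_def] \<zeta>_\<xi>_solution[unfolded \<zeta>_def \<xi>_def]

end

end

section \<open>Covariant differentiation on a Riemannian manifold\<close>

lemma tangent_spaceD:
  "v \<in> tangent_space N p \<Longrightarrow> i \<in> charts_at N p \<Longrightarrow> j \<in> charts_at N p \<Longrightarrow>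
    v j = fd (transition N i j) (chart_map N i p) (v i)"
  unfolding tangent_space_def by blast

lemma tangent_spaceI:
  assumes "\<And>i j. i \<in> charts_at N p \<Longrightarrow> j \<in> charts_at N p \<Longrightarrow>
      v j = fd (transition N i j) (chart_map N i p) (v i)"
    and "\<And>i. i \<notin> charts_at N p \<Longrightarrow> v i = 0"
  shows "v \<in> tangent_space N p"
  unfolding tangent_space_def using assms by blast

lemma tangent_eqI:
  assumes "u \<in> tangent_space N p" "v \<in> tangent_space N p" "i \<in> charts_at N p" "u i = v i"
  shows "u = v"
  by (subst tvec_of_eq[OF assms(1,3), symmetric], subst assms(4)) (rule tvec_of_eq[OF assms(2,3)])

lemma points_charts_at:
  assumes "p \<in> points N"
  obtains i where "i \<in> charts_at N p"
  using assms by (auto simp: points_def charts_at_def)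

lemma tvec_of_linear:
  assumes N: "smooth_manifold N" and i: "i \<in> charts_at N p"
  shows "tvec_of N i p (u + v) = tvec_of N i p u + tvec_of N i p v"
    "tvec_of N i p (r *\<^sub>R u) = r *\<^sub>R tvec_of N i p u"
    "tvec_of N i p 0 = 0"
  using transition_linear[OF N i]
  by (simp_all add: tvec_of_def fun_eq_iff linear_add linear_scale linear_0)

lemma transition_surj:
  assumes N: "smooth_manifold N" and i: "i \<in> charts_at N p" and j: "j \<in> charts_at N p"
  shows "surj (fd (transition N i j) (chart_map N i p))"
proof (rule surjI)
  show "fd (transition N i j) (chart_map N i p) (fd (transition N j i) (chart_map N j p) u) = u" for u
    using transition_cocycle[OF N j i j, of u] transition_id[OF N j, of u] by simp
qed

lemma vf_comp_chart_map:
  "smooth_manifold N \<Longrightarrow> i \<in> charts_at N p \<Longrightarrow> vf_comp N X i (chart_map N i p) = X p i"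
  by (simp add: vf_comp_def chart_inv_chart_map)

lemma vector_fieldD:
  assumes "vector_field N X"
  shows "p \<in> points N \<Longrightarrow> X p \<in> tangent_space N p"
    and "i \<in> charts_at N p \<Longrightarrow> X p \<in> tangent_space N p"
    and "i \<in> index N \<Longrightarrow> smooth_on (chart_img N i) (vf_comp N X i)"
  using assms charts_at_points[of i N p] unfolding vector_field_def by blast+

locale riemannian_manifold =
  fixes M :: "('i, 'a, 'e::euclidean_space) atlas" and g :: "('i, 'a, 'e) tensor02"
  assumes M: "smooth_manifold M" and g: "riemannian_metric M g"
begin

abbreviation \<gamma> :: "'i \<Rightarrow> 'e \<Rightarrow> 'e \<Rightarrow> 'e \<Rightarrow> real" where "\<gamma> i \<equiv> t02_comp M g i"
abbreviation \<Gamma> :: "'i \<Rightarrow> 'e \<Rightarrow> 'e \<Rightarrow> 'e \<Rightarrow> 'e" where "\<Gamma> i \<equiv> christoffel M g i"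

lemma metricD:
  assumes "p \<in> points M" "u \<in> tangent_space M p" "v \<in> tangent_space M p" "w \<in> tangent_space M p"
  shows "g p (u + v) w = g p u w + g p v w" "g p (r *\<^sub>R u) w = r * g p u w" "g p u v = g p v u"
    "u \<noteq> 0 \<Longrightarrow> g p u u > 0"
  using g assms unfolding riemannian_metric_def by blast+

lemma metric_chart:
  assumes i: "i \<in> charts_at M p" and u: "u \<in> tangent_space M p" and v: "v \<in> tangent_space M p"
  shows "g p u v = \<gamma> i (chart_map M i p) (u i) (v i)"
  by (simp add: t02_comp_def chart_inv_chart_map[OF M i] tvec_of_eq[OF u i] tvec_of_eq[OF v i])

lemma chart_connection:
  assumes i: "i \<in> index M"
  shows "local_connection (chart_img M i) (\<gamma> i) (\<Gamma> i)"
proof (intro local_connection.intro local_metric.intro local_connection_axioms.intro)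
  show "open (chart_img M i)"
    by (rule open_chart_img[OF M i])
  fix x u v
  show "smooth_on (chart_img M i) (\<lambda>x. \<gamma> i x u v)"
    using g i by (simp add: riemannian_metric_def)
  assume x: "x \<in> chart_img M i"
  let ?p = "chart_inv M i x"
  note c = chart_inv_charts_at(1)[OF i x]
  note t = tvec_of_tangent_space(1)[OF M c] and p = charts_at_points[OF c]
  show "linear (\<lambda>u. \<gamma> i x u v)"
    by (rule linearI) (simp_all add: t02_comp_def tvec_of_linear[OF M c] metricD[OF p t t t])
  show "\<gamma> i x u v = \<gamma> i x v u"
    unfolding t02_comp_def by (rule metricD(3)[OF p t t t])
  assume "u \<noteq> 0"
  then have "tvec_of M i ?p u \<noteq> 0"
    using tvec_of_tangent_space(2)[OF M c, of u] by auto
  then show "\<gamma> i x u u > 0"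
    unfolding t02_comp_def by (rule metricD(4)[OF p t t t])
next
  show "\<Gamma> i = christoffel_symbol (\<gamma> i)"
    by (intro ext) (simp add: christoffel_def christoffel_symbol_def koszul_def)
qed

lemma metric_transform:
  assumes i: "i \<in> index M" and j: "j \<in> index M" and x: "x \<in> overlap M i j"
  shows "\<gamma> i x u v = \<gamma> j (transition M i j x) (fd (transition M i j) x u) (fd (transition M i j) x v)"
proof -
  note o = overlap[OF M i j]
  have "tvec_of M j (chart_inv M i x) (fd (transition M i j) x u) = tvec_of M i (chart_inv M i x) u" for u
    using tvec_of_eq[OF tvec_of_tangent_space(1)[OF M o(6)[OF x]] o(7)[OF x]] o(7,8)[OF x]
    by (simp add: tvec_of_def)
  then show ?thesis
    by (simp add: t02_comp_def o(5)[OF x])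
qed

lemma christoffel_transform:
  assumes i: "i \<in> charts_at M p" and j: "j \<in> charts_at M p"
  defines "x \<equiv> chart_map M i p" and "T \<equiv> transition M i j"
  shows "fd T x (\<Gamma> i x u v) = \<Gamma> j (chart_map M j p) (fd T x u) (fd T x v) + fd (\<lambda>y. fd T y u) x v"
proof -
  note ij = charts_at_index[OF i] charts_at_index[OF j]
  note o = overlap[OF M ij] and o' = overlap[OF M ij(2,1)]
  have "fd T x (\<Gamma> i x u v) = \<Gamma> j (T x) (fd T x u) (fd T x v) + fd (\<lambda>y. fd T y u) x v"
    unfolding T_def
  proof (rule chr_transform[OF chart_connection[OF ij(1)] chart_connection[OF ij(2)] o(1)])
    show "x \<in> overlap M i j"
      unfolding x_def by (rule chart_map_in_overlap[OF i j])
    show "transition M i j ` overlap M i j \<subseteq> chart_img M j"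
      using o(4) o'(3) by blast
    show "surj (fd (transition M i j) x)"
      unfolding x_def by (rule transition_surj[OF M i j])
  qed (use o metric_transform[OF ij] in auto)
  then show ?thesis
    by (simp add: T_def x_def transition_chart_map[OF M i])
qed

lemma nabla_chart:
  assumes "i \<in> charts_at M p"
  shows "nabla M g X p v i = local_connection.nab (\<Gamma> i) (vf_comp M X i) (chart_map M i p) (v i)"
  using assms by (simp add: nabla_def local_connection.nab_def[OF chart_connection[OF charts_at_index[OF assms]]]
      vf_comp_chart_map[OF M])

text \<open>Differentiating the transformation law of \<open>X\<close> produces a second derivative of the transition map, and
  so does the transformation of the Christoffel symbols; they cancel by symmetry.\<close>

lemma nabla_tangent:
  assumes X: "vector_field M X" and v: "v \<in> tangent_space M p"
  shows "nabla M g X p v \<in> tangent_space M p"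
proof (rule tangent_spaceI)
  fix i j
  assume i: "i \<in> charts_at M p" and j: "j \<in> charts_at M p"
  note ij = charts_at_index[OF i] charts_at_index[OF j]
  note o = overlap[OF M ij]
  let ?T = "transition M i j" and ?x = "chart_map M i p" and ?Xi = "vf_comp M X i" and ?Xj = "vf_comp M X j"
  interpret C: local_connection "chart_img M i" "\<gamma> i" "\<Gamma> i"
    by (rule chart_connection[OF ij(1)])
  interpret D: local_connection "chart_img M j" "\<gamma> j" "\<Gamma> j"
    by (rule chart_connection[OF ij(2)])
  have x: "?x \<in> overlap M i j"
    by (rule chart_map_in_overlap[OF i j])
  have Tx: "?T ?x = chart_map M j p"
    by (rule transition_chart_map[OF M i])
  have T: "?T differentiable (at ?x)" "linear (fd ?T y)" "(\<lambda>y. fd ?T y w) differentiable (at ?x)"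
    if "y \<in> overlap M i j" for y w
    using o(2) smooth_on_fd[OF o(2)] x that
    by (auto intro: smooth_on_imp_differentiable linear_frechet_derivative)
  have Xd: "?Xi differentiable (at ?x)" "?Xj differentiable (at (?T ?x))"
    using vector_fieldD(3)[OF X] ij chart_map_in_img[OF i] chart_map_in_img[OF j]
    by (auto simp: Tx intro: smooth_on_imp_differentiable)
  have "((\<lambda>y. fd ?T y (?Xi y)) has_derivative
      (\<lambda>h. fd (\<lambda>y. fd ?T y (?Xi ?x)) ?x h + fd ?T ?x (fd ?Xi ?x h))) (at ?x)"
    by (rule has_derivative_apply[where k = "\<lambda>y. y" and \<phi> = "\<lambda>y. fd ?T y",
          OF o(1) x T(2) T(3)[OF x] has_derivative_ident has_derivative_fd[OF Xd(1)]])
  moreover have "fd ?T y (?Xi y) = ?Xj (?T y)" if y: "y \<in> overlap M i j" for y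
    using tangent_spaceD[OF vector_fieldD(2)[OF X o(6)[OF y]] o(6)[OF y] o(7)[OF y]]
    by (simp add: vf_comp_def o(5,8)[OF y])
  ultimately have "((\<lambda>y. ?Xj (?T y)) has_derivative
      (\<lambda>h. fd (\<lambda>y. fd ?T y (?Xi ?x)) ?x h + fd ?T ?x (fd ?Xi ?x h))) (at ?x)"
    by (rule has_derivative_transform_within_open[OF _ o(1) x])
  moreover have "((\<lambda>y. ?Xj (?T y)) has_derivative (\<lambda>h. fd ?Xj (?T ?x) (fd ?T ?x h))) (at ?x)"
    by (rule has_derivative_compose[OF has_derivative_fd[OF T(1)[OF x]] has_derivative_fd[OF Xd(2)]])
  ultimately have "fd (\<lambda>y. fd ?T y (?Xi ?x)) ?x (v i) + fd ?T ?x (fd ?Xi ?x (v i))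
      = fd ?Xj (?T ?x) (fd ?T ?x (v i))"
    by (rule has_derivative_unique[THEN fun_cong])
  moreover have "fd (\<lambda>y. fd ?T y (?Xi ?x)) ?x (v i) = fd (\<lambda>y. fd ?T y (v i)) ?x (?Xi ?x)"
    by (rule fd_commute[OF o(1) x o(2)])
  moreover have "v j = fd ?T ?x (v i)" "X p j = fd ?T ?x (X p i)"
    using tangent_spaceD[OF v i j] tangent_spaceD[OF vector_fieldD(2)[OF X i] i j] by auto
  ultimately show "nabla M g X p v j = fd ?T ?x (nabla M g X p v i)"
    unfolding nabla_chart[OF i] nabla_chart[OF j] C.nab_def D.nab_def
    by (simp add: linear_add[OF T(2)[OF x]] christoffel_transform[OF i j] vf_comp_chart_map[OF M] i j Tx add_ac)
qed (simp add: nabla_def)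

lemma cov_deriv_apply: "cov_deriv M g X Y p = nabla M g Y p (X p)"
  by (simp add: cov_deriv_def)

lemma cov_deriv_chart:
  assumes i: "i \<in> index M" and y: "y \<in> chart_img M i"
  shows "vf_comp M (cov_deriv M g X Y) i y = local_connection.nab (\<Gamma> i) (vf_comp M Y i) y (vf_comp M X i y)"
  using nabla_chart[OF chart_inv_charts_at(1)[OF i y], of Y "X (chart_inv M i y)"] chart_inv_charts_at(2)[OF i y]
  by (simp add: cov_deriv_def vf_comp_def[of M "\<lambda>p. nabla M g Y p (X p)"] vf_comp_def[of M X])

lemma cov_deriv_cov_deriv_chart:
  assumes X: "vector_field M X" and Y: "vector_field M Y" and i: "i \<in> charts_at M p"
  defines "x \<equiv> chart_map M i p"
  shows "cov_deriv M g Z (cov_deriv M g Y X) p i =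
    local_connection.hess (\<Gamma> i) (vf_comp M X i) x (Z p i) (Y p i)
    + local_connection.nab (\<Gamma> i) (vf_comp M X i) x (local_connection.nab (\<Gamma> i) (vf_comp M Y i) x (Z p i))"
proof -
  note ii = charts_at_index[OF i]
  interpret C: local_connection "chart_img M i" "\<gamma> i" "\<Gamma> i"
    by (rule chart_connection[OF ii])
  have x: "x \<in> chart_img M i"
    unfolding x_def by (rule chart_map_in_img[OF i])
  have "cov_deriv M g Z (cov_deriv M g Y X) p i = C.nab (vf_comp M (cov_deriv M g Y X) i) x (Z p i)"
    by (simp add: cov_deriv_apply[where X = Z] nabla_chart[OF i] x_def)
  also have "\<dots> = C.nab (\<lambda>y. C.nab (vf_comp M X i) y (vf_comp M Y i y)) x (Z p i)"
    using cov_deriv_chart[OF ii] x fd_cong[OF C.open_U x cov_deriv_chart[OF ii]] by (simp add: C.nab_def)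
  also have "\<dots> = C.hess (vf_comp M X i) x (Z p i) (vf_comp M Y i x) + C.nab (vf_comp M X i) x (C.nab (vf_comp M Y i) x (Z p i))"
    by (intro C.nab_varying x vector_fieldD(3) X ii smooth_on_imp_differentiable[OF vector_fieldD(3)[OF Y ii]])
  finally show ?thesis
    by (simp add: x_def vf_comp_chart_map[OF M i])
qed

lemma second_cov_deriv_chart:
  assumes "vector_field M \<xi>" "vector_field M U" "vector_field M V" and i: "i \<in> charts_at M p"
  shows "second_cov_deriv M g \<xi> U V p i
    = local_connection.hess (\<Gamma> i) (vf_comp M \<xi> i) (chart_map M i p) (U p i) (V p i)"
  using cov_deriv_cov_deriv_chart[OF assms(1,3) i, of U]
  by (simp add: second_cov_deriv_def cov_deriv_apply[where X = "cov_deriv M g U V"]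
      cov_deriv_apply[where X = U and Y = V]
      nabla_chart[OF i])

text \<open>Tangent vectors extend to global fields, so an identity between values of fields can be
  evaluated at arbitrary components.\<close>

lemma vector_field_with_component:
  assumes "i \<in> charts_at M p"
  obtains X where "vector_field M X" "X p i = v"
  using vector_field_extension[OF M assms tvec_of_tangent_space(1)[OF M assms, of v]]
    tvec_of_tangent_space(2)[OF M assms, of v] by metis

lemma symmetric_hessian_iff:
  assumes \<xi>: "vector_field M \<xi>"
  shows "(\<forall>U V. vector_field M U \<longrightarrow> vector_field M V \<longrightarrow>
      (\<forall>p\<in>points M. (second_cov_deriv M g \<xi> U V + second_cov_deriv M g \<xi> V U) p = 0))
    \<longleftrightarrow> (\<forall>i\<in>index M. \<forall>x\<in>chart_img M i. \<forall>v w.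
      local_connection.hess (\<Gamma> i) (vf_comp M \<xi> i) x v w + local_connection.hess (\<Gamma> i) (vf_comp M \<xi> i) x w v = 0)"
    (is "?L \<longleftrightarrow> ?R")
proof
  assume L: ?L
  show ?R
  proof (intro ballI allI)
    fix i x v w
    assume i: "i \<in> index M" and x: "x \<in> chart_img M i"
    note c = chart_inv_charts_at[OF i x]
    obtain V W where V: "vector_field M V" "V (chart_inv M i x) i = v"
      and W: "vector_field M W" "W (chart_inv M i x) i = w"
      using vector_field_with_component[OF c(1)] by metis
    have "(second_cov_deriv M g \<xi> V W + second_cov_deriv M g \<xi> W V) (chart_inv M i x) = 0"
      using L V(1) W(1) charts_at_points[OF c(1)] by blast
    then have "(second_cov_deriv M g \<xi> V W + second_cov_deriv M g \<xi> W V) (chart_inv M i x) i = 0"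
      by simp
    then show "local_connection.hess (\<Gamma> i) (vf_comp M \<xi> i) x v w
        + local_connection.hess (\<Gamma> i) (vf_comp M \<xi> i) x w v = 0"
      using second_cov_deriv_chart[OF \<xi> V(1) W(1) c(1)] second_cov_deriv_chart[OF \<xi> W(1) V(1) c(1)]
      by (simp add: c(2) V(2) W(2))
  qed
next
  assume R: ?R
  show ?L
  proof (intro allI impI ballI ext)
    fix U V p i
    assume U: "vector_field M U" and V: "vector_field M V" and p: "p \<in> points M"
    show "(second_cov_deriv M g \<xi> U V + second_cov_deriv M g \<xi> V U) p i = (0 :: _ \<Rightarrow> _) i"
    proof (cases "i \<in> charts_at M p")
      case True
      then show ?thesis
        using R charts_at_index[OF True] chart_map_in_img[OF True]
          second_cov_deriv_chart[OF \<xi> U V True] second_cov_deriv_chart[OF \<xi> V U True] by simp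
    next
      case False
      then show ?thesis
        by (simp add: second_cov_deriv_def cov_deriv_def nabla_def)
    qed
  qed
qed

text \<open>For fields \<open>X\<close>, \<open>Y\<close>, \<open>W\<close> the definition of the curvature reduces to the commutator of second covariant
  derivatives of \<open>W\<close>, and the three values at a point are arbitrary.\<close>

lemma flat_chart:
  assumes flat: "flat M g" and i: "i \<in> index M" and x: "x \<in> chart_img M i"
  shows "local_connection.curv (\<Gamma> i) x u v w = 0"
proof -
  interpret C: local_connection "chart_img M i" "\<gamma> i" "\<Gamma> i"
    by (rule chart_connection[OF i])
  let ?p = "chart_inv M i x"
  note c = chart_inv_charts_at[OF i x]
  obtain X where X: "vector_field M X" "X ?p i = u"
    by (rule vector_field_with_component[OF c(1)])
  obtain Y where Y: "vector_field M Y" "Y ?p i = v"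
    by (rule vector_field_with_component[OF c(1)])
  obtain W where W: "vector_field M W" "W ?p i = w"
    by (rule vector_field_with_component[OF c(1)])
  let ?X = "vf_comp M X i" and ?Y = "vf_comp M Y i" and ?W = "vf_comp M W i"
  have val: "?X x = u" "?Y x = v" "?W x = w"
    by (simp_all add: vf_comp_def X Y W)
  have lin: "linear (C.nab ?W x)"
    by (intro C.nab_linear x smooth_on_imp_differentiable[OF vector_fieldD(3)[OF W(1) i]])
  have "curvature M g X Y W ?p = 0"
    using flat X(1) Y(1) W(1) charts_at_points[OF c(1)] unfolding flat_def by blast
  then have "curvature M g X Y W ?p i = 0"
    by simp
  moreover have "lie_bracket M X Y ?p i = C.nab ?Y x u - C.nab ?X x v"
    using c by (simp add: lie_bracket_def X Y C.nab_def val C.chr_sym[OF x, of u v])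
  ultimately have "C.hess ?W x u v + C.nab ?W x (C.nab ?Y x u) - (C.hess ?W x v u + C.nab ?W x (C.nab ?X x v))
      - C.nab ?W x (C.nab ?Y x u - C.nab ?X x v) = 0"
    by (simp add: curvature_def cov_deriv_cov_deriv_chart[OF W(1) Y(1) c(1)]
        cov_deriv_cov_deriv_chart[OF W(1) X(1) c(1)] cov_deriv_apply[where X = "lie_bracket M X Y"]
        nabla_chart[OF c(1)] c(2) X(2) Y(2))
  then have "C.hess ?W x u v - C.hess ?W x v u = 0"
    by (simp add: linear_diff[OF lin])
  then show ?thesis
    using C.hess_commutator[OF vector_fieldD(3)[OF W(1) i] x, of u v] by (simp add: val)
qed

lemma tensor11_chart:
  assumes P: "tensor11_field M P" and i: "i \<in> index M"
  shows "x \<in> chart_img M i \<Longrightarrow> linear (t11_comp M P i x)"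
    and "smooth_on (chart_img M i) (\<lambda>x. t11_comp M P i x u)"
proof -
  show "smooth_on (chart_img M i) (\<lambda>x. t11_comp M P i x u)"
    using P i unfolding tensor11_field_def by blast
  assume x: "x \<in> chart_img M i"
  note c = chart_inv_charts_at(1)[OF i x]
  have "P (chart_inv M i x) (tvec_of M i (chart_inv M i x) u + tvec_of M i (chart_inv M i x) v)
      = P (chart_inv M i x) (tvec_of M i (chart_inv M i x) u) + P (chart_inv M i x) (tvec_of M i (chart_inv M i x) v)"
    "P (chart_inv M i x) (r *\<^sub>R tvec_of M i (chart_inv M i x) u) = r *\<^sub>R P (chart_inv M i x) (tvec_of M i (chart_inv M i x) u)" for u v r
    using P charts_at_points[OF c] tvec_of_tangent_space(1)[OF M c] unfolding tensor11_field_def by blast+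
  then show "linear (t11_comp M P i x)"
    by (intro linearI) (simp_all add: t11_comp_def tvec_of_linear[OF M c])
qed

lemma t11_comp_eval:
  assumes "i \<in> charts_at M p" "u \<in> tangent_space M p"
  shows "P p u i = t11_comp M P i (chart_map M i p) (u i)"
  by (simp add: t11_comp_def chart_inv_chart_map[OF M assms(1)] tvec_of_eq[OF assms(2,1)])

text \<open>The expression \<open>(\<nabla>\<^sub>X P) Y\<close> depends only on the values of \<open>X\<close> and \<open>Y\<close> at the point.\<close>

lemma parallel_iff:
  assumes P: "tensor11_field M P"
  shows "parallel M g P \<longleftrightarrow> (\<forall>i\<in>index M. \<forall>x\<in>chart_img M i. \<forall>h v.
    local_connection.nab_end (\<Gamma> i) (t11_comp M P i) x h v = 0)"
proof -
  have comp: "cov_deriv M g X (\<lambda>q. P q (Y q)) p i - P p (cov_deriv M g X Y p) i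
      = local_connection.nab_end (\<Gamma> i) (t11_comp M P i) (chart_map M i p) (X p i) (Y p i)"
    if X: "vector_field M X" and Y: "vector_field M Y" and i: "i \<in> charts_at M p" for X Y p i
  proof -
    note ii = charts_at_index[OF i]
    interpret C: local_connection "chart_img M i" "\<gamma> i" "\<Gamma> i"
      by (rule chart_connection[OF ii])
    let ?x = "chart_map M i p"
    have x: "?x \<in> chart_img M i"
      by (rule chart_map_in_img[OF i])
    have PY: "vf_comp M (\<lambda>q. P q (Y q)) i y = t11_comp M P i y (vf_comp M Y i y)"
      if y: "y \<in> chart_img M i" for y
    proof -
      note c = chart_inv_charts_at[OF ii y]
      show ?thesis
        using t11_comp_eval[OF c(1) vector_fieldD(2)[OF Y c(1)], of P] by (simp add: vf_comp_def c(2))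
    qed
    have "cov_deriv M g X Y p \<in> tangent_space M p"
      unfolding cov_deriv_def by (rule nabla_tangent[OF Y vector_fieldD(2)[OF X i]])
    then have "P p (cov_deriv M g X Y p) i = t11_comp M P i ?x (C.nab (vf_comp M Y i) ?x (X p i))"
      by (subst t11_comp_eval[OF i]) (simp_all add: cov_deriv_def nabla_chart[OF i])
    moreover have "cov_deriv M g X (\<lambda>q. P q (Y q)) p i
        = C.nab (\<lambda>y. t11_comp M P i y (vf_comp M Y i y)) ?x (X p i)"
      using PY[OF x] fd_cong[OF C.open_U x PY]
      by (simp add: cov_deriv_def nabla_chart[OF i] C.nab_def)
    ultimately show ?thesis
      using C.nab_end_varying[where S = "t11_comp M P i" and Y = "vf_comp M Y i", OF x tensor11_chart(1)[OF P ii]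
          smooth_on_imp_differentiable[OF tensor11_chart(2)[OF P ii] x]
          smooth_on_imp_differentiable[OF vector_fieldD(3)[OF Y ii] x]]
      by (simp add: vf_comp_chart_map[OF M i])
  qed
  show ?thesis
  proof
    assume par: "parallel M g P"
    show "\<forall>i\<in>index M. \<forall>x\<in>chart_img M i. \<forall>h v. local_connection.nab_end (\<Gamma> i) (t11_comp M P i) x h v = 0"
    proof (intro ballI allI)
      fix i x h v
      assume i: "i \<in> index M" and x: "x \<in> chart_img M i"
      note c = chart_inv_charts_at[OF i x]
      obtain X where X: "vector_field M X" "X (chart_inv M i x) i = h"
        by (rule vector_field_with_component[OF c(1)])
      obtain Y where Y: "vector_field M Y" "Y (chart_inv M i x) i = v"
        by (rule vector_field_with_component[OF c(1)])
      have "cov_deriv M g X (\<lambda>q. P q (Y q)) (chart_inv M i x) - P (chart_inv M i x) (cov_deriv M g X Y (chart_inv M i x)) = 0"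
        using par X(1) Y(1) charts_at_points[OF c(1)] unfolding parallel_def by blast
      then have "(cov_deriv M g X (\<lambda>q. P q (Y q)) (chart_inv M i x) - P (chart_inv M i x) (cov_deriv M g X Y (chart_inv M i x))) i = 0"
        by simp
      then show "local_connection.nab_end (\<Gamma> i) (t11_comp M P i) x h v = 0"
        using comp[OF X(1) Y(1) c(1)] by (simp add: X(2) Y(2) c(2))
    qed
  next
    assume R: "\<forall>i\<in>index M. \<forall>x\<in>chart_img M i. \<forall>h v. local_connection.nab_end (\<Gamma> i) (t11_comp M P i) x h v = 0"
    show "parallel M g P"
      unfolding parallel_def
    proof (intro allI impI ballI ext)
      fix X Y p i
      assume X: "vector_field M X" and Y: "vector_field M Y" and p: "p \<in> points M"
      have "cov_deriv M g X Y p \<in> tangent_space M p"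
        unfolding cov_deriv_def by (rule nabla_tangent[OF Y vector_fieldD(1)[OF X p]])
      then have t: "P p (cov_deriv M g X Y p) \<in> tangent_space M p"
        using P p unfolding tensor11_field_def by blast
      show "(cov_deriv M g X (\<lambda>q. P q (Y q)) p - P p (cov_deriv M g X Y p)) i = (0 :: _ \<Rightarrow> _) i"
      proof (cases "i \<in> charts_at M p")
        case True
        then show ?thesis
          using comp[OF X Y True] R charts_at_index[OF True] chart_map_in_img[OF True] by simp
      next
        case False
        then show ?thesis
          using tangent_space_outside[OF t False] by (simp add: cov_deriv_def nabla_def)
      qed
    qed
  qed
qed

text \<open>Existence of the vector in the definition: it represents the covector \<open>\<omega>\<close> with respect to the metric,
  and it is a tangent vector because the covariant derivative of \<open>\<xi>\<close> is.\<close>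

lemma C_tensor:
  assumes \<xi>: "vector_field M \<xi>" and p: "p \<in> points M" and y: "y \<in> tangent_space M p"
  shows "C_tensor M g \<xi> p y \<in> tangent_space M p"
    "\<And>w. w \<in> tangent_space M p \<Longrightarrow> g p (C_tensor M g \<xi> p y) w = - g p y (nabla M g \<xi> p w)"
proof -
  obtain i where i: "i \<in> charts_at M p"
    by (rule points_charts_at[OF p])
  note ii = charts_at_index[OF i]
  interpret C: local_connection "chart_img M i" "\<gamma> i" "\<Gamma> i"
    by (rule chart_connection[OF ii])
  let ?x = "chart_map M i p" and ?X = "vf_comp M \<xi> i"
  have x: "?x \<in> chart_img M i"
    by (rule chart_map_in_img[OF i])
  define \<omega> where "\<omega> = (\<lambda>w. - \<gamma> i ?x (y i) (C.nab ?X ?x w))"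
  have "linear (C.nab ?X ?x)"
    by (intro C.nab_linear x smooth_on_imp_differentiable[OF vector_fieldD(3)[OF \<xi> ii]])
  then have lin: "linear \<omega>"
    unfolding \<omega>_def using linear_compose_neg[OF linear_compose[OF _ C.lin2[OF x]]] by (simp add: o_def)
  define z where "z = tvec_of M i p (C.sharp ?x \<omega>)"
  have z: "z \<in> tangent_space M p" "z i = C.sharp ?x \<omega>"
    unfolding z_def by (rule tvec_of_tangent_space[OF M i])+
  have rhs: "- g p y (nabla M g \<xi> p w) = \<omega> (w i)" if "w \<in> tangent_space M p" for w
    by (simp add: metric_chart[OF i y nabla_tangent[OF \<xi> that]] nabla_chart[OF i] \<omega>_def)
  have main: "(\<forall>w\<in>tangent_space M p. g p z' w = - g p y (nabla M g \<xi> p w)) \<longleftrightarrow> z' = z"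
    if z': "z' \<in> tangent_space M p" for z'
  proof
    assume a: "\<forall>w\<in>tangent_space M p. g p z' w = - g p y (nabla M g \<xi> p w)"
    have "z' i = z i"
    proof (rule C.metric_eqI[OF x])
      fix w
      note t = tvec_of_tangent_space[OF M i, of w]
      have "\<gamma> i ?x (z' i) (tvec_of M i p w i) = \<omega> (tvec_of M i p w i)"
        using a t(1) rhs[OF t(1)] metric_chart[OF i z' t(1)] by simp
      then show "\<gamma> i ?x (z' i) w = \<gamma> i ?x (z i) w"
        by (simp add: t(2) z(2) C.sharp[OF x lin])
    qed
    then show "z' = z"
      by (rule tangent_eqI[OF z' z(1) i])
  next
    assume "z' = z"
    then show "\<forall>w\<in>tangent_space M p. g p z' w = - g p y (nabla M g \<xi> p w)"
      by (simp add: metric_chart[OF i z(1)] rhs z(2) C.sharp[OF x lin])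
  qed
  have "C_tensor M g \<xi> p y = z"
    unfolding C_tensor_def
    by (rule the_equality) (use z main in blast)+
  then show "C_tensor M g \<xi> p y \<in> tangent_space M p"
    "\<And>w. w \<in> tangent_space M p \<Longrightarrow> g p (C_tensor M g \<xi> p y) w = - g p y (nabla M g \<xi> p w)"
    using z main by auto
qed

lemma C_tensor_chart:
  assumes \<xi>: "vector_field M \<xi>" and i: "i \<in> charts_at M p" and y: "y \<in> tangent_space M p"
  shows "\<gamma> i (chart_map M i p) (C_tensor M g \<xi> p y i) w
    = - \<gamma> i (chart_map M i p) (y i) (local_connection.nab (\<Gamma> i) (vf_comp M \<xi> i) (chart_map M i p) w)"
proof -
  note t = tvec_of_tangent_space[OF M i, of w] and C = C_tensor[OF \<xi> charts_at_points[OF i] y]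
  have "g p (C_tensor M g \<xi> p y) (tvec_of M i p w) = - g p y (nabla M g \<xi> p (tvec_of M i p w))"
    by (rule C(2)[OF t(1)])
  then show ?thesis
    unfolding metric_chart[OF i C(1) t(1)] metric_chart[OF i y nabla_tangent[OF \<xi> t(1)]] nabla_chart[OF i] t(2) .
qed

lemma lie_derivative_chart:
  assumes i: "i \<in> index M" and x: "x \<in> chart_img M i"
  shows "lie_derivative M X g i x u v = \<gamma> i x (local_connection.nab (\<Gamma> i) (vf_comp M X i) x u) v
    + \<gamma> i x u (local_connection.nab (\<Gamma> i) (vf_comp M X i) x v)"
  unfolding lie_derivative_def
  by (rule local_connection.lie_derivative_metric[OF chart_connection[OF i] x])

end

section \<open>The tangent bundle in charts\<close>

context riemannian_manifold
begin

abbreviation TB :: "('i, ('i, 'a, 'e) tpoint, 'e \<times> 'e) atlas" where "TB \<equiv> tangent_bundle M"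

lemma TB_index: "index TB = index M"
  by (simp add: tangent_bundle_def)

lemma charts_at_TB: "u \<in> tangent_space M p \<Longrightarrow> charts_at TB (p, u) = charts_at M p"
  by (auto simp: charts_at_def tangent_bundle_def)

lemma points_TB: "(p, u) \<in> points TB \<longleftrightarrow> p \<in> points M \<and> u \<in> tangent_space M p"
  by (auto simp: points_def tangent_bundle_def)

lemma chart_map_TB: "chart_map TB i (p, u) = (chart_map M i p, u i)"
  by (simp add: tangent_bundle_def)

lemma chart_dom_TB: "(p, u) \<in> chart_dom TB i \<longleftrightarrow> p \<in> chart_dom M i \<and> u \<in> tangent_space M p"
  by (simp add: tangent_bundle_def)

lemma inj_chart_map_TB:
  assumes i: "i \<in> index M"
  shows "inj_on (chart_map TB i) (chart_dom TB i)"
proof (rule inj_onI)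
  fix q q'
  assume "q \<in> chart_dom TB i" "q' \<in> chart_dom TB i" "chart_map TB i q = chart_map TB i q'"
  moreover obtain p u p' u' where q: "q = (p, u)" "q' = (p', u')"
    by (cases q, cases q')
  moreover have "inj_on (chart_map M i) (chart_dom M i)"
    using M i by (simp add: smooth_manifold_def)
  ultimately have "p = p'" "u i = u' i" "u \<in> tangent_space M p" "u' \<in> tangent_space M p" "i \<in> charts_at M p"
    using i by (auto simp: chart_dom_TB chart_map_TB charts_at_def inj_on_def)
  then show "q = q'"
    using tangent_eqI[of u M p u' i] by (simp add: q)
qed

lemma TB_chart_point:
  assumes i: "i \<in> index M" and x: "x \<in> chart_img M i"
  defines "p \<equiv> chart_inv M i x"
  shows "(p, tvec_of M i p u) \<in> chart_dom TB i" "(p, tvec_of M i p u) \<in> points TB"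
    "chart_map TB i (p, tvec_of M i p u) = (x, u)"
proof -
  note c = chart_inv_charts_at[OF i x, folded p_def]
  note t = tvec_of_tangent_space[OF M c(1)]
  show "(p, tvec_of M i p u) \<in> chart_dom TB i" "(p, tvec_of M i p u) \<in> points TB"
    using c(1) t(1) charts_at_points[OF c(1)] by (auto simp: chart_dom_TB points_TB charts_at_def)
  show "chart_map TB i (p, tvec_of M i p u) = (x, u)"
    by (simp add: chart_map_TB t(2) c(2))
qed

lemma chart_img_TB:
  assumes i: "i \<in> index M"
  shows "chart_img TB i = chart_img M i \<times> UNIV"
proof
  show "chart_img TB i \<subseteq> chart_img M i \<times> UNIV"
    by (auto simp: chart_img_def chart_dom_TB chart_map_TB)
  show "chart_img M i \<times> UNIV \<subseteq> chart_img TB i"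
  proof clarify
    fix x u
    assume "x \<in> chart_img M i"
    from TB_chart_point[OF i this, of u] show "(x, u) \<in> chart_img TB i"
      unfolding chart_img_def by (auto intro: rev_image_eqI)
  qed
qed

lemma chart_inv_TB:
  assumes i: "i \<in> index M" and x: "x \<in> chart_img M i"
  shows "chart_inv TB i (x, u) = (chart_inv M i x, tvec_of M i (chart_inv M i x) u)"
  unfolding chart_inv_def[of TB]
  by (rule inv_into_f_eq[OF inj_chart_map_TB[OF i] TB_chart_point(1)[OF i x] TB_chart_point(3)[OF i x]])

lemma chart_inv_TB_chart_map:
  assumes i: "i \<in> charts_at M p" and u: "u \<in> tangent_space M p"
  shows "chart_inv TB i (chart_map M i p, u i) = (p, u)"
  by (simp add: chart_inv_TB[OF charts_at_index[OF i] chart_map_in_img[OF i]] chart_inv_chart_map[OF M i]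
      tvec_of_eq[OF u i])

lemma transition_TB:
  assumes i: "i \<in> index M" and j: "j \<in> index M" and x: "x \<in> overlap M i j"
  shows "transition TB i j (x, u) = (transition M i j x, fd (transition M i j) x u)"
proof -
  note o = overlap[OF M i j]
  have xi: "x \<in> chart_img M i"
    using o(3) x by blast
  have "transition TB i j (x, u) = chart_map TB j (chart_inv M i x, tvec_of M i (chart_inv M i x) u)"
    by (simp add: transition_def chart_inv_TB[OF i xi])
  then show ?thesis
    using o(7,8)[OF x] by (simp add: chart_map_TB tvec_of_def transition_def[of M])
qed

lemma transition_TB_derivative:
  assumes i: "i \<in> charts_at M p" and j: "j \<in> charts_at M p"
  defines "x \<equiv> chart_map M i p" and "T \<equiv> transition M i j"
  shows "fd (transition TB i j) (x, u) W = (fd T x (fst W), fd (\<lambda>y. fd T y u) x (fst W) + fd T x (snd W))"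
proof -
  note ij = charts_at_index[OF i] charts_at_index[OF j]
  note o = overlap[OF M ij]
  have x: "x \<in> overlap M i j"
    unfolding x_def by (rule chart_map_in_overlap[OF i j])
  have T: "T differentiable (at x)" "\<And>y. y \<in> overlap M i j \<Longrightarrow> linear (fd T y)"
    "\<And>w. (\<lambda>y. fd T y w) differentiable (at x)"
    using o(2) smooth_on_fd[OF o(2)] x unfolding T_def
    by (auto intro: smooth_on_imp_differentiable linear_frechet_derivative)
  have "((\<lambda>q. (T (fst q), fd T (fst q) (snd q))) has_derivative
      (\<lambda>W. (fd T x (fst W), fd (\<lambda>y. fd T y (snd (x, u))) (fst (x, u)) (fst W) + fd T (fst (x, u)) (snd W)))) (at (x, u))"
  proof (rule has_derivative_Pair)
    show "((\<lambda>q. T (fst q)) has_derivative (\<lambda>W. fd T x (fst W))) (at (x, u))"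
      using has_derivative_fd[OF T(1)]
      by (intro has_derivative_compose[OF has_derivative_fst[OF has_derivative_ident]]) simp
    show "((\<lambda>q. fd T (fst q) (snd q)) has_derivative
        (\<lambda>W. fd (\<lambda>y. fd T y (snd (x, u))) (fst (x, u)) (fst W) + fd T (fst (x, u)) (snd W))) (at (x, u))"
      by (rule has_derivative_apply[where \<phi> = "\<lambda>y. fd T y", OF o(1) _ T(2)])
        (simp_all add: x T(3) has_derivative_fst has_derivative_snd)
  qed
  then have "(transition TB i j has_derivative
      (\<lambda>W. (fd T x (fst W), fd (\<lambda>y. fd T y u) x (fst W) + fd T x (snd W)))) (at (x, u))"
    unfolding fst_conv snd_conv
    by (rule has_derivative_transform_within_open[where s = "overlap M i j \<times> UNIV"])
      (use x open_Times[OF o(1) open_UNIV] in \<open>auto simp: transition_TB[OF ij] T_def\<close>)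
  then show ?thesis
    by (simp add: fd_eq)
qed

text \<open>The inhomogeneous term in the transformation of the fibre components is compensated by that
  of the Christoffel symbols.\<close>

lemma parts_of_tvec:
  assumes i: "i \<in> charts_at M p" and u: "u \<in> tangent_space M p"
  shows "h_part M (p, u) (tvec_of TB i (p, u) W) = tvec_of M i p (fst W)"
    "v_part M g (p, u) (tvec_of TB i (p, u) W)
      = tvec_of M i p (local_connection.vpart (\<Gamma> i) (chart_map M i p) (u i) W)"
proof -
  let ?x = "chart_map M i p"
  note vp = local_connection.vpart_def[OF chart_connection[OF charts_at_index[OF i]]]
  have t: "tvec_of TB i (p, u) W j = (fd (transition M i j) ?x (fst W),
      fd (\<lambda>y. fd (transition M i j) y (u i)) ?x (fst W) + fd (transition M i j) ?x (snd W))"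
    if j: "j \<in> charts_at M p" for j
    using j by (simp add: tvec_of_def charts_at_TB[OF u] chart_map_TB transition_TB_derivative[OF i j])
  show "h_part M (p, u) (tvec_of TB i (p, u) W) = tvec_of M i p (fst W)"
    by (rule ext) (simp add: h_part_def t tvec_of_def[of M])
  show "v_part M g (p, u) (tvec_of TB i (p, u) W)
      = tvec_of M i p (local_connection.vpart (\<Gamma> i) (chart_map M i p) (u i) W)"
  proof (rule ext)
    fix j
    show "v_part M g (p, u) (tvec_of TB i (p, u) W) j
      = tvec_of M i p (local_connection.vpart (\<Gamma> i) (chart_map M i p) (u i) W) j"
    proof (cases "j \<in> charts_at M p")
      case True
      then show ?thesis
        using tangent_spaceD[OF u i True] christoffel_transform[OF i True, of "u i" "fst W"]
        by (simp add: v_part_def t tvec_of_def[of M] vp linear_add[OF transition_linear[OF M i True]])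
    qed (simp add: v_part_def tvec_of_def)
  qed
qed

lemma parts_in_tangent_space:
  assumes A: "A \<in> tangent_space TB (p, u)" and p: "p \<in> points M" and u: "u \<in> tangent_space M p"
  shows "h_part M (p, u) A \<in> tangent_space M p" "v_part M g (p, u) A \<in> tangent_space M p"
proof -
  obtain i where i: "i \<in> charts_at M p"
    by (rule points_charts_at[OF p])
  have "A = tvec_of TB i (p, u) (A i)"
    using tvec_of_eq[OF A, of i] i by (simp add: charts_at_TB[OF u])
  then show "h_part M (p, u) A \<in> tangent_space M p" "v_part M g (p, u) A \<in> tangent_space M p"
    using parts_of_tvec[OF i u, of "A i"] tvec_of_tangent_space(1)[OF M i] by simp_all
qed

lemma parts_chart:
  assumes i: "i \<in> charts_at M p"
  shows "h_part M (p, u) A i = fst (A i)"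
    "v_part M g (p, u) A i = local_connection.vpart (\<Gamma> i) (chart_map M i p) (u i) (A i)"
  using i by (simp_all add: h_part_def v_part_def
      local_connection.vpart_def[OF chart_connection[OF charts_at_index[OF i]]])

context
  fixes a b c :: real
begin

abbreviation "G \<equiv> a *\<^sub>R metric_s M g + b *\<^sub>R metric_h M g + c *\<^sub>R metric_v M g"

lemma bundle_metric_chart:
  assumes i: "i \<in> index M" and x: "x \<in> chart_img M i"
  shows "t02_comp TB G i (x, u) W W' = local_connection.bundle_metric (\<gamma> i) (\<Gamma> i) a b c x u W W'"
proof -
  let ?p = "chart_inv M i x"
  let ?u = "tvec_of M i ?p u"
  note c = chart_inv_charts_at[OF i x]
  note t = tvec_of_tangent_space[OF M c(1)]
  show ?thesis
    unfolding t02_comp_def[of TB] chart_inv_TB[OF i x]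
    by (simp add: metric_s_def metric_h_def metric_v_def parts_of_tvec[OF c(1) t(1)] c(2) t(2)
        metric_chart[OF c(1) t(1) t(1)]
        local_connection.bundle_metric_def[OF chart_connection[OF i]] algebra_simps)
qed

text \<open>The horizontal and vertical components of the one-form \<open>G(Z, \<cdot>)\<close>, identified with vectors by \<open>g\<close>.\<close>

definition hor_dual :: "('i, ('i, 'a, 'e) tpoint, 'e \<times> 'e) vfield \<Rightarrow> ('i, 'a, 'e) tpoint \<Rightarrow> ('i, 'e) tvec" where
  "hor_dual Z q = (a + c) *\<^sub>R h_part M q (Z q) + b *\<^sub>R v_part M g q (Z q)"

definition ver_dual :: "('i, ('i, 'a, 'e) tpoint, 'e \<times> 'e) vfield \<Rightarrow> ('i, 'a, 'e) tpoint \<Rightarrow> ('i, 'e) tvec" where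
  "ver_dual Z q = b *\<^sub>R h_part M q (Z q) + a *\<^sub>R v_part M g q (Z q)"

definition hor_comp :: "('i, ('i, 'a, 'e) tpoint, 'e \<times> 'e) vfield \<Rightarrow> 'i \<Rightarrow> 'e \<times> 'e \<Rightarrow> 'e" where
  "hor_comp Z i q = (a + c) *\<^sub>R fst (vf_comp TB Z i q)
    + b *\<^sub>R local_connection.vpart (\<Gamma> i) (fst q) (snd q) (vf_comp TB Z i q)"

definition ver_comp :: "('i, ('i, 'a, 'e) tpoint, 'e \<times> 'e) vfield \<Rightarrow> 'i \<Rightarrow> 'e \<times> 'e \<Rightarrow> 'e" where
  "ver_comp Z i q = b *\<^sub>R fst (vf_comp TB Z i q)
    + a *\<^sub>R local_connection.vpart (\<Gamma> i) (fst q) (snd q) (vf_comp TB Z i q)"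

lemma dual_chart:
  assumes i: "i \<in> charts_at M p" and u: "u \<in> tangent_space M p"
  shows "hor_dual Z (p, u) i = hor_comp Z i (chart_map M i p, u i)"
    "ver_dual Z (p, u) i = ver_comp Z i (chart_map M i p, u i)"
  by (simp_all add: hor_dual_def ver_dual_def hor_comp_def ver_comp_def parts_chart[OF i] vf_comp_def
      chart_inv_TB_chart_map[OF i u])

lemma dual_tangent:
  assumes Z: "vector_field TB Z" and p: "p \<in> points M" and u: "u \<in> tangent_space M p"
  shows "hor_dual Z (p, u) \<in> tangent_space M p" "ver_dual Z (p, u) \<in> tangent_space M p"
proof -
  have "Z (p, u) \<in> tangent_space TB (p, u)"
    using p u by (intro vector_fieldD(1)[OF Z]) (simp add: points_TB)
  note t = parts_in_tangent_space[OF this p u]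
  show "hor_dual Z (p, u) \<in> tangent_space M p" "ver_dual Z (p, u) \<in> tangent_space M p"
    unfolding hor_dual_def ver_dual_def
    by (intro subspace_add subspace_scale subspace_tangent_space[OF M] t)+
qed

lemma comp_smooth:
  assumes Z: "vector_field TB Z" and i: "i \<in> index M"
  shows "smooth_on (chart_img M i \<times> UNIV) (hor_comp Z i)" "smooth_on (chart_img M i \<times> UNIV) (ver_comp Z i)"
proof -
  interpret C: local_connection "chart_img M i" "\<gamma> i" "\<Gamma> i"
    by (rule chart_connection[OF i])
  let ?S = "chart_img M i \<times> (UNIV :: 'e set)"
  have o: "open ?S"
    by (intro open_Times C.open_U open_UNIV)
  have Zi: "smooth_on ?S (vf_comp TB Z i)"
    using vector_fieldD(3)[OF Z, of i] i by (simp add: TB_index chart_img_TB)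
  have "smooth_on ?S (\<lambda>q. fst (vf_comp TB Z i q))"
    by (rule smooth_on_compose[OF o subset_UNIV smooth_on_linear[OF bounded_linear_fst] Zi])
  then show "smooth_on ?S (hor_comp Z i)" "smooth_on ?S (ver_comp Z i)"
    unfolding hor_comp_def[abs_def] ver_comp_def[abs_def]
    by (intro smooth_on_add smooth_on_scaleR smooth_on_const o C.smooth_vpart Zi; assumption)+
qed

text \<open>In each chart the Lie derivative of \<open>G\<close> is given by the covariant derivatives of the dual components.
  The constant is common to all charts.\<close>

lemma homothetic_iff:
  assumes flat: "flat M g" and Z: "vector_field TB Z"
  shows "lie_derivative_eq_scale TB Z G (2 * \<mu>) \<longleftrightarrow> (\<forall>i\<in>index M.
    local_connection.homothety_system (chart_img M i) (\<gamma> i) (\<Gamma> i) a b c \<mu> (ver_comp Z i) (hor_comp Z i))"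
proof -
  have "(\<forall>x\<in>chart_img TB i. \<forall>W W'. lie_derivative TB Z G i x W W' = (2 * \<mu>) * t02_comp TB G i x W W')
    \<longleftrightarrow> local_connection.homothety_system (chart_img M i) (\<gamma> i) (\<Gamma> i) a b c \<mu> (ver_comp Z i) (hor_comp Z i)"
    if i: "i \<in> index M" for i
  proof -
    interpret C: local_connection "chart_img M i" "\<gamma> i" "\<Gamma> i"
      by (rule chart_connection[OF i])
    have "lie_derivative TB Z G i (x, u) W W'
      = \<gamma> i x (C.cov (hor_comp Z i) x u W) (fst W') + \<gamma> i x (C.cov (ver_comp Z i) x u W) (C.vpart x u W')
      + \<gamma> i x (fst W) (C.cov (hor_comp Z i) x u W') + \<gamma> i x (C.vpart x u W) (C.cov (ver_comp Z i) x u W')"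
      if x: "x \<in> chart_img M i" for x u W W'
    proof -
      have "fd (\<lambda>q. t02_comp TB G i q W W') (x, u)
          = fd (\<lambda>q. C.bundle_metric a b c (fst q) (snd q) W W') (x, u)"
      proof (rule fd_cong)
        show "open (chart_img M i \<times> (UNIV :: 'e set))"
          by (intro open_Times C.open_U open_UNIV)
      qed (use x in \<open>auto simp: bundle_metric_chart[OF i]\<close>)
      moreover have "vf_comp TB Z i differentiable (at (x, u))"
        using vector_fieldD(3)[OF Z, of i] i x
        by (intro smooth_on_imp_differentiable) (auto simp: TB_index chart_img_TB)
      ultimately show ?thesis
        using C.lie_derivative_bundle_metric[OF x _ flat_chart[OF flat i x], of "vf_comp TB Z i" u a b c W W']
        unfolding lie_derivative_def hor_comp_def[abs_def] ver_comp_def[abs_def]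
        by (simp add: bundle_metric_chart[OF i x])
    qed
    then show ?thesis
      unfolding C.homothety_system_def chart_img_TB[OF i] by (auto simp: bundle_metric_chart[OF i])
  qed
  then show ?thesis
    unfolding lie_derivative_eq_scale_def TB_index by blast
qed

text \<open>The given expression for \<open>Z\<close>, solved for the dual components: the linear system
  \<open>Q = (a + c) H + b V\<close>, \<open>N = b H + a V\<close> has determinant \<open>\<alpha>\<close>.\<close>

lemma lift_formula_chart:
  fixes l :: real and \<xi> \<zeta> :: "('i, 'a, 'e) vfield" and P K :: "('i, 'a, 'e) tensor11" and u :: "('i, 'e) tvec"
  assumes \<alpha>: "\<alpha> = a * (a + c) - b\<^sup>2" "\<alpha> \<noteq> 0" and i: "i \<in> charts_at M p"
  defines "Nv \<equiv> \<xi> p i + P p u i + (l * a) *\<^sub>R u i" and "Qv \<equiv> \<zeta> p i + K p u i + (2 * l * b) *\<^sub>R u i"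
  defines "H \<equiv> (1 / \<alpha>) *\<^sub>R (a *\<^sub>R Qv - b *\<^sub>R Nv)" and "V \<equiv> (1 / \<alpha>) *\<^sub>R ((a + c) *\<^sub>R Nv - b *\<^sub>R Qv)"
  shows "((1 / \<alpha>) *\<^sub>R
              (h_lift M g (a *\<^sub>R \<zeta> - b *\<^sub>R \<xi>)
               + star_lift M g (a *\<^sub>R K - b *\<^sub>R P + (l * a * b) *\<^sub>R id_tensor)
               + v_lift M ((a + c) *\<^sub>R \<xi> - b *\<^sub>R \<zeta>)
               + iota_lift M ((a + c) *\<^sub>R P - b *\<^sub>R K + (l * (\<alpha> - b\<^sup>2)) *\<^sub>R id_tensor))) (p, u) i
    = (H, V - \<Gamma> i (chart_map M i p) (u i) H)"
proof -
  interpret C: local_connection "chart_img M i" "\<gamma> i" "\<Gamma> i"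
    by (rule chart_connection[OF charts_at_index[OF i]])
  have x: "chart_map M i p \<in> chart_img M i"
    by (rule chart_map_in_img[OF i])
  let ?h1 = "a *\<^sub>R \<zeta> p i - b *\<^sub>R \<xi> p i"
    and ?h2 = "a *\<^sub>R K p u i - b *\<^sub>R P p u i + (l * a * b) *\<^sub>R u i"
  have "l * a * b = a * (2 * l * b) - b * (l * a)"
    by simp
  then have "a *\<^sub>R Qv - b *\<^sub>R Nv = ?h1 + ?h2"
    unfolding Nv_def Qv_def by (simp only: scaleR_diff_left scaleR_add_right scaleR_scaleR) simp
  then have H: "H = (1 / \<alpha>) *\<^sub>R (?h1 + ?h2)"
    by (simp add: H_def)
  have "l * (\<alpha> - b\<^sup>2) = (a + c) * (l * a) - b * (2 * l * b)"
    by (simp add: \<alpha>(1) power2_eq_square algebra_simps)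
  then have "(a + c) *\<^sub>R Nv - b *\<^sub>R Qv = (a + c) *\<^sub>R \<xi> p i - b *\<^sub>R \<zeta> p i
      + ((a + c) *\<^sub>R P p u i - b *\<^sub>R K p u i + (l * (\<alpha> - b\<^sup>2)) *\<^sub>R u i)"
    unfolding Nv_def Qv_def by (simp only: scaleR_diff_left scaleR_add_right scaleR_scaleR) simp
  then have V: "V = (1 / \<alpha>) *\<^sub>R ((a + c) *\<^sub>R \<xi> p i - b *\<^sub>R \<zeta> p i
      + ((a + c) *\<^sub>R P p u i - b *\<^sub>R K p u i + (l * (\<alpha> - b\<^sup>2)) *\<^sub>R u i))"
    by (simp add: V_def)
  show ?thesis
    unfolding H V using i
    by (simp add: h_lift_def star_lift_def v_lift_def iota_lift_def h_lift_vec_def v_lift_vec_def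
        id_tensor_def C.chr_simps[OF x] algebra_simps)
qed

lemma comp_of_lift:
  assumes \<alpha>: "\<alpha> = a * (a + c) - b\<^sup>2" "\<alpha> \<noteq> 0"
  shows "b *\<^sub>R ((1 / \<alpha>) *\<^sub>R (a *\<^sub>R Qv - b *\<^sub>R Nv)) + a *\<^sub>R ((1 / \<alpha>) *\<^sub>R ((a + c) *\<^sub>R Nv - b *\<^sub>R Qv)) = (Nv :: 'e)"
    and "(a + c) *\<^sub>R ((1 / \<alpha>) *\<^sub>R (a *\<^sub>R Qv - b *\<^sub>R Nv)) + b *\<^sub>R ((1 / \<alpha>) *\<^sub>R ((a + c) *\<^sub>R Nv - b *\<^sub>R Qv)) = (Qv :: 'e)"
    and "(1 / \<alpha>) *\<^sub>R (a *\<^sub>R ((a + c) *\<^sub>R h + b *\<^sub>R v) - b *\<^sub>R (b *\<^sub>R h + a *\<^sub>R v)) = (h :: 'e)"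
    and "(1 / \<alpha>) *\<^sub>R ((a + c) *\<^sub>R (b *\<^sub>R h + a *\<^sub>R v) - b *\<^sub>R ((a + c) *\<^sub>R h + b *\<^sub>R v)) = (v :: 'e)"
proof -
  have inv: "(1 / \<alpha>) *\<^sub>R (\<alpha> *\<^sub>R w) = w" for w :: 'e
    using \<alpha>(2) by simp
  have "b *\<^sub>R (a *\<^sub>R Qv - b *\<^sub>R Nv) + a *\<^sub>R ((a + c) *\<^sub>R Nv - b *\<^sub>R Qv) = \<alpha> *\<^sub>R Nv"
    "(a + c) *\<^sub>R (a *\<^sub>R Qv - b *\<^sub>R Nv) + b *\<^sub>R ((a + c) *\<^sub>R Nv - b *\<^sub>R Qv) = \<alpha> *\<^sub>R Qv"
    "a *\<^sub>R ((a + c) *\<^sub>R h + b *\<^sub>R v) - b *\<^sub>R (b *\<^sub>R h + a *\<^sub>R v) = \<alpha> *\<^sub>R h"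
    "(a + c) *\<^sub>R (b *\<^sub>R h + a *\<^sub>R v) - b *\<^sub>R ((a + c) *\<^sub>R h + b *\<^sub>R v) = \<alpha> *\<^sub>R v"
    by (simp_all add: \<alpha>(1) power2_eq_square algebra_simps)
  note e = this
  show "b *\<^sub>R ((1 / \<alpha>) *\<^sub>R (a *\<^sub>R Qv - b *\<^sub>R Nv)) + a *\<^sub>R ((1 / \<alpha>) *\<^sub>R ((a + c) *\<^sub>R Nv - b *\<^sub>R Qv)) = Nv"
    using arg_cong[OF e(1), of "\<lambda>w. (1 / \<alpha>) *\<^sub>R w"] unfolding inv
    by (simp add: scaleR_add_right scaleR_left_commute del: scaleR_scaleR)
  show "(a + c) *\<^sub>R ((1 / \<alpha>) *\<^sub>R (a *\<^sub>R Qv - b *\<^sub>R Nv)) + b *\<^sub>R ((1 / \<alpha>) *\<^sub>R ((a + c) *\<^sub>R Nv - b *\<^sub>R Qv)) = Qv"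
    using arg_cong[OF e(2), of "\<lambda>w. (1 / \<alpha>) *\<^sub>R w"] unfolding inv
    by (simp add: scaleR_add_right scaleR_left_commute del: scaleR_scaleR)
  show "(1 / \<alpha>) *\<^sub>R (a *\<^sub>R ((a + c) *\<^sub>R h + b *\<^sub>R v) - b *\<^sub>R (b *\<^sub>R h + a *\<^sub>R v)) = h"
    "(1 / \<alpha>) *\<^sub>R ((a + c) *\<^sub>R (b *\<^sub>R h + a *\<^sub>R v) - b *\<^sub>R ((a + c) *\<^sub>R h + b *\<^sub>R v)) = v"
    unfolding e inv by simp_all
qed

end

end

section \<open>Homothetic fields of the tangent bundle\<close>

context riemannian_manifold
begin

lemma zero_tangent: "0 \<in> tangent_space M p"
  by (rule subspace_0[OF subspace_tangent_space[OF M]])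

lemma skew_symmetric_iff:
  assumes P: "\<And>p u. p \<in> points M \<Longrightarrow> u \<in> tangent_space M p \<Longrightarrow> P p u \<in> tangent_space M p"
  shows "skew_symmetric M g P \<longleftrightarrow> (\<forall>i\<in>index M. \<forall>x\<in>chart_img M i. \<forall>v w.
    \<gamma> i x (t11_comp M P i x v) w + \<gamma> i x v (t11_comp M P i x w) = 0)"
proof -
  have eval: "g p (P p u) v + g p u (P p v) = \<gamma> i (chart_map M i p) (t11_comp M P i (chart_map M i p) (u i)) (v i)
      + \<gamma> i (chart_map M i p) (u i) (t11_comp M P i (chart_map M i p) (v i))"
    if i: "i \<in> charts_at M p" and u: "u \<in> tangent_space M p" and v: "v \<in> tangent_space M p" for i p u v
    using P[OF charts_at_points[OF i]] u v
    by (simp add: metric_chart[OF i] t11_comp_eval[OF i])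
  show ?thesis
  proof
    assume L: "skew_symmetric M g P"
    show "\<forall>i\<in>index M. \<forall>x\<in>chart_img M i. \<forall>v w.
      \<gamma> i x (t11_comp M P i x v) w + \<gamma> i x v (t11_comp M P i x w) = 0"
    proof (intro ballI allI)
      fix i x v w
      assume i: "i \<in> index M" and x: "x \<in> chart_img M i"
      note c = chart_inv_charts_at[OF i x]
      note t = tvec_of_tangent_space[OF M c(1)]
      have "g (chart_inv M i x) (P (chart_inv M i x) (tvec_of M i (chart_inv M i x) v)) (tvec_of M i (chart_inv M i x) w)
        + g (chart_inv M i x) (tvec_of M i (chart_inv M i x) v) (P (chart_inv M i x) (tvec_of M i (chart_inv M i x) w)) = 0"
        using L charts_at_points[OF c(1)] t(1) unfolding skew_symmetric_def by blast
      then show "\<gamma> i x (t11_comp M P i x v) w + \<gamma> i x v (t11_comp M P i x w) = 0"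
        unfolding eval[OF c(1) t(1) t(1)] by (simp add: t(2) c(2))
    qed
  next
    assume R: "\<forall>i\<in>index M. \<forall>x\<in>chart_img M i. \<forall>v w.
      \<gamma> i x (t11_comp M P i x v) w + \<gamma> i x v (t11_comp M P i x w) = 0"
    show "skew_symmetric M g P"
      unfolding skew_symmetric_def
    proof (intro ballI)
      fix p u v
      assume p: "p \<in> points M" and u: "u \<in> tangent_space M p" and v: "v \<in> tangent_space M p"
      obtain i where i: "i \<in> charts_at M p"
        by (rule points_charts_at[OF p])
      show "g p (P p u) v + g p u (P p v) = 0"
        using R charts_at_index[OF i] chart_map_in_img[OF i] by (simp add: eval[OF i u v])
    qed
  qed
qed

lemma lie_derivative_eq_scale_iff:
  "lie_derivative_eq_scale M X g k \<longleftrightarrow> (\<forall>i\<in>index M. \<forall>x\<in>chart_img M i. \<forall>u v.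
    \<gamma> i x (local_connection.nab (\<Gamma> i) (vf_comp M X i) x u) v
    + \<gamma> i x u (local_connection.nab (\<Gamma> i) (vf_comp M X i) x v) = k * \<gamma> i x u v)"
  by (simp add: lie_derivative_eq_scale_def lie_derivative_chart)

context
  fixes a b c \<alpha> :: real and Z :: "('i, ('i, 'a, 'e) tpoint, 'e \<times> 'e) vfield"
  assumes flat: "flat M g" and \<alpha>: "\<alpha> = a * (a + c) - b\<^sup>2" "\<alpha> \<noteq> 0" and Z: "vector_field TB Z"
begin

abbreviation lift_formula :: "real \<Rightarrow> ('i, 'a, 'e) vfield \<Rightarrow> ('i, 'a, 'e) tensor11 \<Rightarrow> ('i, 'a, 'e) vfield
    \<Rightarrow> ('i, ('i, 'a, 'e) tpoint, 'e \<times> 'e) vfield" where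
  "lift_formula l \<zeta> P \<xi> \<equiv> (1 / \<alpha>) *\<^sub>R
              (h_lift M g (a *\<^sub>R \<zeta> - b *\<^sub>R \<xi>)
               + star_lift M g (a *\<^sub>R C_tensor M g \<xi> - b *\<^sub>R P + (l * a * b) *\<^sub>R id_tensor)
               + v_lift M ((a + c) *\<^sub>R \<xi> - b *\<^sub>R \<zeta>)
               + iota_lift M ((a + c) *\<^sub>R P - b *\<^sub>R C_tensor M g \<xi>
                   + (l * (\<alpha> - b\<^sup>2)) *\<^sub>R id_tensor))"

text \<open>The tensor fields are defined through the dual components, hence independently of charts, and their
  properties are read off in the charts. The factor \<open>\<lambda>\<close> is the homothety constant of \<open>Z\<close>.\<close>

lemma homothetic_imp_lift_formula:
  assumes hom: "lie_derivative_eq_scale TB Z (G a b c) (2 * l)"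
  shows "\<exists>\<zeta> P \<xi>. homothetic M g \<zeta> \<and> lie_derivative_eq_scale M \<zeta> g (2 * l * (a + c)) \<and>
    tensor11_field M P \<and> skew_symmetric M g P \<and> parallel M g P \<and> vector_field M \<xi> \<and>
    (\<forall>U V. vector_field M U \<longrightarrow> vector_field M V \<longrightarrow>
      (\<forall>p\<in>points M. (second_cov_deriv M g \<xi> U V + second_cov_deriv M g \<xi> V U) p = 0)) \<and>
    (\<forall>q\<in>points TB. Z q = lift_formula l \<zeta> P \<xi> q)"
proof -
  define \<zeta> where "\<zeta> = (\<lambda>p. hor_dual a b c Z (p, 0))"
  define \<xi> where "\<xi> = (\<lambda>p. ver_dual a b Z (p, 0))"
  define P where "P = (\<lambda>p u. ver_dual a b Z (p, u) - \<xi> p - (l * a) *\<^sub>R u)"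
  let ?N = "\<lambda>i. ver_comp a b Z i" and ?Q = "\<lambda>i. hor_comp a b c Z i"
  note con = chart_connection
  note smooth = comp_smooth(1)[where a = a and b = b and c = c, OF Z] comp_smooth(2)[where a = a and b = b, OF Z]
  have sys: "local_connection.homothety_system (chart_img M i) (\<gamma> i) (\<Gamma> i) a b c l (?N i) (?Q i)"
    if "i \<in> index M" for i
    using hom that by (simp add: homothetic_iff[OF flat Z])
  have sol: "x \<in> chart_img M i \<Longrightarrow> linear (\<lambda>u. ?N i (x, u) - ?N i (x, 0))"
    "x \<in> chart_img M i \<Longrightarrow> \<gamma> i x (?N i (x, v) - ?N i (x, 0)) w + \<gamma> i x v (?N i (x, w) - ?N i (x, 0))
      = 2 * l * a * \<gamma> i x v w"
    "x \<in> chart_img M i \<Longrightarrow> \<gamma> i x (?Q i (x, v) - ?Q i (x, 0)) w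
      = 2 * l * b * \<gamma> i x v w - \<gamma> i x v (local_connection.nab (\<Gamma> i) (\<lambda>x. ?N i (x, 0)) x w)"
    "x \<in> chart_img M i \<Longrightarrow> local_connection.nab_end (\<Gamma> i) (\<lambda>x u. ?N i (x, u) - ?N i (x, 0)) x h v = 0"
    "x \<in> chart_img M i \<Longrightarrow> \<gamma> i x (local_connection.nab (\<Gamma> i) (\<lambda>x. ?Q i (x, 0)) x v) w
      + \<gamma> i x v (local_connection.nab (\<Gamma> i) (\<lambda>x. ?Q i (x, 0)) x w) = 2 * l * (a + c) * \<gamma> i x v w"
    "x \<in> chart_img M i \<Longrightarrow> local_connection.hess (\<Gamma> i) (\<lambda>x. ?N i (x, 0)) x v w
      + local_connection.hess (\<Gamma> i) (\<lambda>x. ?N i (x, 0)) x w v = 0"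
    if i: "i \<in> index M" for i x v w h
    using local_connection.homothety_system_solution[OF con[OF i] smooth(2)[OF i] smooth(1)[OF i] sys[OF i]]
    by blast+
  have \<zeta>_tan: "\<zeta> p \<in> tangent_space M p" and \<xi>_tan: "\<xi> p \<in> tangent_space M p"
    if "p \<in> points M" for p
    unfolding \<zeta>_def \<xi>_def by (rule dual_tangent[OF Z that zero_tangent])+
  have P_tan: "P p u \<in> tangent_space M p" if "p \<in> points M" "u \<in> tangent_space M p" for p u
    unfolding P_def
    by (intro subspace_diff subspace_scale subspace_tangent_space[OF M] \<xi>_tan dual_tangent[OF Z] that)
  have \<zeta>_comp: "vf_comp M \<zeta> i x = ?Q i (x, 0)" and \<xi>_comp: "vf_comp M \<xi> i x = ?N i (x, 0)"
    and P_comp: "t11_comp M P i x u = ?N i (x, u) - ?N i (x, 0) - (l * a) *\<^sub>R u"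
    if i: "i \<in> index M" and x: "x \<in> chart_img M i" for i x u
  proof -
    note c = chart_inv_charts_at[OF i x]
    note t = tvec_of_tangent_space[OF M c(1)]
    note d = dual_chart[OF c(1) zero_tangent] dual_chart[OF c(1) t(1)]
    show "vf_comp M \<zeta> i x = ?Q i (x, 0)" "vf_comp M \<xi> i x = ?N i (x, 0)"
      by (simp_all add: vf_comp_def[of M] \<zeta>_def \<xi>_def d c(2))
    show "t11_comp M P i x u = ?N i (x, u) - ?N i (x, 0) - (l * a) *\<^sub>R u"
      by (simp add: t11_comp_def P_def \<xi>_def d c(2) t(2))
  qed
  have vf_\<zeta>: "vector_field M \<zeta>" and vf_\<xi>: "vector_field M \<xi>"
  proof -
    have "smooth_on (chart_img M i) (vf_comp M \<zeta> i)" "smooth_on (chart_img M i) (vf_comp M \<xi> i)"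
      if i: "i \<in> index M" for i
    proof -
      interpret C: local_connection "chart_img M i" "\<gamma> i" "\<Gamma> i"
        by (rule con[OF i])
      show "smooth_on (chart_img M i) (vf_comp M \<zeta> i)"
        by (rule smooth_on_cong[OF C.open_U C.smooth_slice[OF smooth(1)[OF i], of 0]]) (simp add: \<zeta>_comp[OF i])
      show "smooth_on (chart_img M i) (vf_comp M \<xi> i)"
        by (rule smooth_on_cong[OF C.open_U C.smooth_slice[OF smooth(2)[OF i], of 0]]) (simp add: \<xi>_comp[OF i])
    qed
    then show "vector_field M \<zeta>" "vector_field M \<xi>"
      unfolding vector_field_def using \<zeta>_tan \<xi>_tan by blast+
  qed
  have tensor: "tensor11_field M P"
    unfolding tensor11_field_def
  proof (intro conjI ballI allI)
    fix p u v r
    assume p: "p \<in> points M" and u: "u \<in> tangent_space M p" and v: "v \<in> tangent_space M p"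
    obtain i where i: "i \<in> charts_at M p"
      by (rule points_charts_at[OF p])
    note ii = charts_at_index[OF i] and x = chart_map_in_img[OF i]
    have "(\<lambda>u. ?N i (chart_map M i p, u) - ?N i (chart_map M i p, 0) - (l * a) *\<^sub>R u)
        = t11_comp M P i (chart_map M i p)"
      by (rule ext) (simp add: P_comp[OF ii x])
    moreover have "linear (\<lambda>u. ?N i (chart_map M i p, u) - ?N i (chart_map M i p, 0) - (l * a) *\<^sub>R u)"
      by (intro linear_compose_sub sol(1)[OF ii x] linear_compose_scale_right linear_ident)
    ultimately have lin: "linear (t11_comp M P i (chart_map M i p))"
      by simp
    note sub = subspace_tangent_space[OF M, of p]
    have uv: "u + v \<in> tangent_space M p" and ru: "r *\<^sub>R u \<in> tangent_space M p"
      by (intro subspace_add subspace_scale sub u v)+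
    show "P p u \<in> tangent_space M p"
      by (rule P_tan[OF p u])
    show "P p (u + v) = P p u + P p v"
    proof (rule tangent_eqI[OF P_tan[OF p uv] subspace_add[OF sub P_tan[OF p u] P_tan[OF p v]] i])
      show "P p (u + v) i = (P p u + P p v) i"
        by (simp add: t11_comp_eval[OF i] u v uv linear_add[OF lin])
    qed
    show "P p (r *\<^sub>R u) = r *\<^sub>R P p u"
    proof (rule tangent_eqI[OF P_tan[OF p ru] subspace_scale[OF sub P_tan[OF p u]] i])
      show "P p (r *\<^sub>R u) i = (r *\<^sub>R P p u) i"
        by (simp add: t11_comp_eval[OF i] u ru linear_scale[OF lin])
    qed
  next
    fix i u
    assume i: "i \<in> index M"
    interpret C: local_connection "chart_img M i" "\<gamma> i" "\<Gamma> i"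
      by (rule con[OF i])
    show "smooth_on (chart_img M i) (\<lambda>x. t11_comp M P i x u)"
    proof (rule smooth_on_cong[OF C.open_U])
      show "smooth_on (chart_img M i) (\<lambda>x. ?N i (x, u) - ?N i (x, 0) - (l * a) *\<^sub>R u)"
        by (intro smooth_on_diff smooth_on_const C.open_U C.smooth_slice smooth(2) i)
    qed (simp add: P_comp[OF i])
  qed
  have skew: "skew_symmetric M g P"
  proof (rule skew_symmetric_iff[THEN iffD2, OF P_tan], assumption, assumption, intro ballI allI)
    fix i x v w
    assume i: "i \<in> index M" and x: "x \<in> chart_img M i"
    interpret C: local_connection "chart_img M i" "\<gamma> i" "\<Gamma> i"
      by (rule con[OF i])
    show "\<gamma> i x (t11_comp M P i x v) w + \<gamma> i x v (t11_comp M P i x w) = 0"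
      using sol(2)[OF i x, of v w] by (simp add: P_comp[OF i x] C.metric_simps[OF x] algebra_simps)
  qed
  have par: "parallel M g P"
    unfolding parallel_iff[OF tensor]
  proof (intro ballI allI)
    fix i x h v
    assume i: "i \<in> index M" and x: "x \<in> chart_img M i"
    interpret C: local_connection "chart_img M i" "\<gamma> i" "\<Gamma> i"
      by (rule con[OF i])
    have "C.nab_end (\<lambda>x u. ?N i (x, u) - ?N i (x, 0)) x h v = C.nab_end (t11_comp M P i) x h v"
      by (rule C.nab_end_add_scaleR[where k = "l * a", OF x _
            smooth_on_imp_differentiable[OF tensor11_chart(2)[OF tensor i] x]])
        (simp add: P_comp[OF i])
    then show "C.nab_end (t11_comp M P i) x h v = 0"
      using sol(4)[OF i x] by simp
  qed
  have lie: "lie_derivative_eq_scale M \<zeta> g (2 * l * (a + c))"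
    unfolding lie_derivative_eq_scale_iff
  proof (intro ballI allI)
    fix i x v w
    assume i: "i \<in> index M" and x: "x \<in> chart_img M i"
    interpret C: local_connection "chart_img M i" "\<gamma> i" "\<Gamma> i"
      by (rule con[OF i])
    have "C.nab (vf_comp M \<zeta> i) x = C.nab (\<lambda>x. ?Q i (x, 0)) x"
      by (rule C.nab_cong[OF x \<zeta>_comp[OF i]])
    then show "\<gamma> i x (C.nab (vf_comp M \<zeta> i) x v) w + \<gamma> i x v (C.nab (vf_comp M \<zeta> i) x w)
        = 2 * l * (a + c) * \<gamma> i x v w"
      using sol(5)[OF i x] by simp
  qed
  have hess: "\<forall>i\<in>index M. \<forall>x\<in>chart_img M i. \<forall>v w. local_connection.hess (\<Gamma> i) (vf_comp M \<xi> i) x v w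
      + local_connection.hess (\<Gamma> i) (vf_comp M \<xi> i) x w v = 0"
  proof (intro ballI allI)
    fix i x v w
    assume i: "i \<in> index M" and x: "x \<in> chart_img M i"
    interpret C: local_connection "chart_img M i" "\<gamma> i" "\<Gamma> i"
      by (rule con[OF i])
    have "C.hess (vf_comp M \<xi> i) x = C.hess (\<lambda>x. ?N i (x, 0)) x"
      by (rule C.hess_cong[OF x \<xi>_comp[OF i]])
    then show "C.hess (vf_comp M \<xi> i) x v w + C.hess (vf_comp M \<xi> i) x w v = 0"
      using sol(6)[OF i x] by simp
  qed
  have formula: "Z (p, u) = lift_formula l \<zeta> P \<xi> (p, u)" if q: "(p, u) \<in> points TB" for p u
  proof (rule ext)
    fix i
    have p: "p \<in> points M" and u: "u \<in> tangent_space M p"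
      using q by (simp_all add: points_TB)
    show "Z (p, u) i = lift_formula l \<zeta> P \<xi> (p, u) i"
    proof (cases "i \<in> charts_at M p")
      case i: True
      note ii = charts_at_index[OF i] and x = chart_map_in_img[OF i]
      interpret C: local_connection "chart_img M i" "\<gamma> i" "\<Gamma> i"
        by (rule con[OF ii])
      let ?x = "chart_map M i p"
      let ?h = "fst (Z (p, u) i)" and ?v = "C.vpart ?x (u i) (Z (p, u) i)"
      \<comment> \<open>both sides have the same scalar products, by the mixed equation\<close>
      have "C_tensor M g \<xi> p u i + (2 * l * b) *\<^sub>R u i = ?Q i (?x, u i) - ?Q i (?x, 0)"
      proof (rule C.metric_eqI[OF x])
        fix w
        have "C.nab (vf_comp M \<xi> i) ?x = C.nab (\<lambda>x. ?N i (x, 0)) ?x"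
          by (rule C.nab_cong[OF x \<xi>_comp[OF ii]])
        then show "\<gamma> i ?x (C_tensor M g \<xi> p u i + (2 * l * b) *\<^sub>R u i) w = \<gamma> i ?x (?Q i (?x, u i) - ?Q i (?x, 0)) w"
          unfolding sol(3)[OF ii x] by (simp add: C.metric_simps[OF x] C_tensor_chart[OF vf_\<xi> i u])
      qed
      moreover have "\<zeta> p i = ?Q i (?x, 0)"
        using dual_chart(1)[OF i zero_tangent] by (simp add: \<zeta>_def)
      ultimately have Q: "\<zeta> p i + C_tensor M g \<xi> p u i + (2 * l * b) *\<^sub>R u i = (a + c) *\<^sub>R ?h + b *\<^sub>R ?v"
        using dual_chart(1)[OF i u, of a b c Z] by (simp add: hor_dual_def parts_chart[OF i] add.assoc)
      have N: "\<xi> p i + P p u i + (l * a) *\<^sub>R u i = b *\<^sub>R ?h + a *\<^sub>R ?v"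
        by (simp add: P_def ver_dual_def[of _ _ _ "(p, u)"] parts_chart[OF i])
      show ?thesis
        unfolding lift_formula_chart[OF \<alpha> i] Q N comp_of_lift(3,4)[OF \<alpha>]
        by (simp add: C.vpart_def)
    next
      case False
      have "Z (p, u) \<in> tangent_space TB (p, u)"
        by (rule vector_fieldD(1)[OF Z q])
      then have "Z (p, u) i = 0"
        by (rule tangent_space_outside) (simp add: charts_at_TB[OF u] False)
      then show ?thesis
        using False
        by (simp add: h_lift_def star_lift_def v_lift_def iota_lift_def h_lift_vec_def v_lift_vec_def)
    qed
  qed
  have "homothetic M g \<zeta>"
    unfolding homothetic_def using vf_\<zeta> lie by (auto simp: mult.assoc)
  then show ?thesis
    using lie tensor skew par vf_\<xi> symmetric_hessian_iff[OF vf_\<xi>] hess formula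
    by (intro exI[of _ \<zeta>] exI[of _ P] exI[of _ \<xi>]) auto
qed

text \<open>The formula makes both dual components affine in the fibre variable, with coefficients that satisfy
  the homothety system.\<close>

lemma lift_formula_imp_homothetic:
  assumes hom: "homothetic M g \<zeta>" and lie: "lie_derivative_eq_scale M \<zeta> g (2 * l * (a + c))"
    and P: "tensor11_field M P" "skew_symmetric M g P" "parallel M g P"
    and \<xi>: "vector_field M \<xi>" "\<forall>U V. vector_field M U \<longrightarrow> vector_field M V \<longrightarrow>
      (\<forall>p\<in>points M. (second_cov_deriv M g \<xi> U V + second_cov_deriv M g \<xi> V U) p = 0)"
    and formula: "\<forall>q\<in>points TB. Z q = lift_formula l \<zeta> P \<xi> q"
  shows "lie_derivative_eq_scale TB Z (G a b c) (2 * l)"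
  unfolding homothetic_iff[OF flat Z]
proof
  fix i
  assume i: "i \<in> index M"
  have \<zeta>: "vector_field M \<zeta>"
    using hom by (simp add: homothetic_def)
  interpret C: local_connection "chart_img M i" "\<gamma> i" "\<Gamma> i"
    by (rule chart_connection[OF i])
  let ?N = "ver_comp a b Z i" and ?Q = "hor_comp a b c Z i"
  let ?P = "t11_comp M P i" and ?C = "t11_comp M (C_tensor M g \<xi>) i"
  let ?S = "\<lambda>x u. ?P x u + (l * a) *\<^sub>R u" and ?T = "\<lambda>x u. ?C x u + (2 * l * b) *\<^sub>R u"
  have comps: "?N (x, u) = vf_comp M \<xi> i x + ?S x u" "?Q (x, u) = vf_comp M \<zeta> i x + ?T x u"
    if x: "x \<in> chart_img M i" for x u
  proof -
    note c = chart_inv_charts_at[OF i x]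
    note t = tvec_of_tangent_space[OF M c(1)]
    let ?p = "chart_inv M i x"
    let ?u = "tvec_of M i ?p u"
    have "Z (?p, ?u) i = lift_formula l \<zeta> P \<xi> (?p, ?u) i"
      using formula t(1) charts_at_points[OF c(1)] by (simp add: points_TB)
    note Zi = this[unfolded lift_formula_chart[OF \<alpha> c(1)]]
    have "vf_comp TB Z i (x, u) = Z (?p, ?u) i"
      by (simp add: vf_comp_def chart_inv_TB[OF i x])
    then have "fst (vf_comp TB Z i (x, u)) = (1 / \<alpha>) *\<^sub>R (a *\<^sub>R (vf_comp M \<zeta> i x + ?T x u) - b *\<^sub>R (vf_comp M \<xi> i x + ?S x u))"
      "C.vpart x u (vf_comp TB Z i (x, u)) = (1 / \<alpha>) *\<^sub>R ((a + c) *\<^sub>R (vf_comp M \<xi> i x + ?S x u) - b *\<^sub>R (vf_comp M \<zeta> i x + ?T x u))"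
      unfolding Zi by (simp_all add: C.vpart_def c(2) t(2) vf_comp_def t11_comp_def add.assoc)
    then show "?N (x, u) = vf_comp M \<xi> i x + ?S x u" "?Q (x, u) = vf_comp M \<zeta> i x + ?T x u"
      unfolding ver_comp_def hor_comp_def fst_conv snd_conv by (simp_all only: comp_of_lift(1,2)[OF \<alpha>])
  qed
  have T_eq: "\<gamma> i x (?T x v) w = 2 * l * b * \<gamma> i x v w - \<gamma> i x v (C.nab (vf_comp M \<xi> i) x w)"
    if x: "x \<in> chart_img M i" for x v w
    using C_tensor_chart[OF \<xi>(1) chart_inv_charts_at(1)[OF i x] tvec_of_tangent_space(1)[OF M chart_inv_charts_at(1)[OF i x]], of v w]
    by (simp add: C.metric_simps[OF x] t11_comp_def chart_inv_charts_at(2)[OF i x]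
        tvec_of_tangent_space(2)[OF M chart_inv_charts_at(1)[OF i x]])
  show "C.homothety_system a b c l ?N ?Q"
  proof (rule C.homothety_system_converse[where \<xi> = "vf_comp M \<xi> i" and \<zeta> = "vf_comp M \<zeta> i" and S = ?S and T = ?T])
    show "smooth_on (chart_img M i) (vf_comp M \<xi> i)"
      by (rule vector_fieldD(3)[OF \<xi>(1) i])
    fix x v w h u
    assume x: "x \<in> chart_img M i"
    show "vf_comp M \<zeta> i differentiable (at x)"
      by (rule smooth_on_imp_differentiable[OF vector_fieldD(3)[OF \<zeta> i] x])
    show "linear (?S x)"
      by (intro linear_compose_add tensor11_chart(1)[OF P(1) i x] linear_compose_scale_right linear_ident)
    have P_diff: "(\<lambda>y. ?P y v) differentiable (at x)" for v
      by (rule smooth_on_imp_differentiable[OF tensor11_chart(2)[OF P(1) i] x])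
    then show "(\<lambda>y. ?S y v) differentiable (at x)"
      by simp
    show "linear (?T x)"
    proof (rule linearI; rule C.metric_eqI[OF x])
      fix u u' z r
      show "\<gamma> i x (?T x (u + u')) z = \<gamma> i x (?T x u + ?T x u') z" "\<gamma> i x (?T x (r *\<^sub>R u)) z = \<gamma> i x (r *\<^sub>R ?T x u) z"
        unfolding C.metric_simps(1)[OF x, of "?T x u" "?T x u'"] C.metric_simps(5)[OF x, of r "?T x u"] T_eq[OF x]
        by (simp_all add: C.metric_simps[OF x] algebra_simps)
    qed
    \<comment> \<open>\<open>C(\<xi>)\<close> is differentiable because \<open>Z\<close> is: it is the linear part of the horizontal component\<close>
    show "(\<lambda>y. ?T y v) differentiable (at x)"
    proof (rule differentiable_cong[OF C.open_U x])
      show "(\<lambda>y. ?Q (y, v) - vf_comp M \<zeta> i y) differentiable (at x)"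
        by (intro differentiable_diff smooth_on_imp_differentiable[OF C.smooth_slice[OF comp_smooth(1)[OF Z i]] x]
            smooth_on_imp_differentiable[OF vector_fieldD(3)[OF \<zeta> i] x])
    qed (simp add: comps)
    show "?N (x, u) = vf_comp M \<xi> i x + ?S x u" "?Q (x, u) = vf_comp M \<zeta> i x + ?T x u"
      by (rule comps[OF x])+
    show "\<gamma> i x (C.nab (vf_comp M \<zeta> i) x v) w + \<gamma> i x v (C.nab (vf_comp M \<zeta> i) x w) = 2 * l * (a + c) * \<gamma> i x v w"
      using lie i x unfolding lie_derivative_eq_scale_iff by blast
    show "\<gamma> i x (?S x v) w + \<gamma> i x v (?S x w) = 2 * l * a * \<gamma> i x v w"
    proof -
      have "\<And>p u. p \<in> points M \<Longrightarrow> u \<in> tangent_space M p \<Longrightarrow> P p u \<in> tangent_space M p"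
        using P(1) unfolding tensor11_field_def by blast
      then have "\<gamma> i x (?P x v) w + \<gamma> i x v (?P x w) = 0"
        using P(2) i x by (simp add: skew_symmetric_iff)
      then show ?thesis
        by (simp add: C.metric_simps[OF x])
    qed
    show "C.nab_end ?S x h v = 0"
      using C.nab_end_add_scaleR[where S' = ?S and S = ?P, OF x refl P_diff] P(3) i x
      by (simp add: parallel_iff[OF P(1)])
    show "\<gamma> i x (?T x v) w = 2 * l * b * \<gamma> i x v w - \<gamma> i x v (C.nab (vf_comp M \<xi> i) x w)"
      by (rule T_eq[OF x])
    show "C.hess (vf_comp M \<xi> i) x v w + C.hess (vf_comp M \<xi> i) x w v = 0"
      using symmetric_hessian_iff[OF \<xi>(1)] \<xi>(2) i x by blast
  qed
qed

end

end

theorem theorem4: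
  fixes M :: "('i, 'a, 'e::euclidean_space) atlas"
    and g :: "('i, 'a, 'e) tensor02"
    and a b c \<alpha> :: real
    and Z :: "('i, ('i, 'a, 'e) tpoint, 'e \<times> 'e) vfield"
  assumes "smooth_manifold M" and "riemannian_metric M g" and "flat M g"
    and "a \<noteq> 0" and "a + c \<noteq> 0"
    and "\<alpha> = a * (a + c) - b\<^sup>2" and "\<alpha> \<noteq> 0"
    and "vector_field (tangent_bundle M) Z"
  shows "homothetic (tangent_bundle M)
           (a *\<^sub>R metric_s M g + b *\<^sub>R metric_h M g + c *\<^sub>R metric_v M g) Z
     \<longleftrightarrow> (\<exists>(l::real) \<zeta> P \<xi>.
           homothetic M g \<zeta> \<and> lie_derivative_eq_scale M \<zeta> g (2 * l * (a + c)) \<and>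
           tensor11_field M P \<and> skew_symmetric M g P \<and> parallel M g P \<and>
           vector_field M \<xi> \<and>
           (\<forall>U V. vector_field M U \<longrightarrow> vector_field M V \<longrightarrow>
              (\<forall>p\<in>points M. (second_cov_deriv M g \<xi> U V + second_cov_deriv M g \<xi> V U) p = 0)) \<and>
           (\<forall>q\<in>points (tangent_bundle M). Z q = ((1 / \<alpha>) *\<^sub>R
              (h_lift M g (a *\<^sub>R \<zeta> - b *\<^sub>R \<xi>)
               + star_lift M g (a *\<^sub>R C_tensor M g \<xi> - b *\<^sub>R P + (l * a * b) *\<^sub>R id_tensor)
               + v_lift M ((a + c) *\<^sub>R \<xi> - b *\<^sub>R \<zeta>)
               + iota_lift M ((a + c) *\<^sub>R P - b *\<^sub>R C_tensor M g \<xi>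
                   + (l * (\<alpha> - b\<^sup>2)) *\<^sub>R id_tensor))) q))"
    (is "?L \<longleftrightarrow> ?R")
proof -
  interpret riemannian_manifold M g
    using assms by unfold_locales
  note data = assms(3,6,7,8)
  show ?thesis
  proof
    assume ?L
    then obtain l where "lie_derivative_eq_scale (tangent_bundle M) Z
        (a *\<^sub>R metric_s M g + b *\<^sub>R metric_h M g + c *\<^sub>R metric_v M g) (2 * l)"
      unfolding homothetic_def by blast
    from homothetic_imp_lift_formula[OF data this] show ?R
      by blast
  next
    assume ?R
    then show ?L
    proof (elim exE conjE)
      fix l \<zeta> P \<xi>
      assume "homothetic M g \<zeta>" "lie_derivative_eq_scale M \<zeta> g (2 * l * (a + c))"
        "tensor11_field M P" "skew_symmetric M g P" "parallel M g P" "vector_field M \<xi>"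
      note lift_formula_imp_homothetic[OF data this]
      moreover assume "\<forall>U V. vector_field M U \<longrightarrow> vector_field M V \<longrightarrow>
        (\<forall>p\<in>points M. (second_cov_deriv M g \<xi> U V + second_cov_deriv M g \<xi> V U) p = 0)"
      moreover assume "\<forall>q\<in>points TB. Z q = lift_formula a b c \<alpha> l \<zeta> P \<xi> q"
      ultimately show ?L
        unfolding homothetic_def using assms(8) by blast
    qed
  qed
qed

end
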